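(* Let $\mathcal C_1,\mathcal C_2$ be symmetric monoidal closed categories and let $f^*:\mathcal C_1\to\mathcal C_2$ be a symmetric monoidal functor that has a right adjoint $f_*:\mathcal C_2\to\mathcal C_1$, which itself has a right adjoint $f^!:\mathcal C_1\to\mathcal C_2$. Let $\zeta$ be the morphism of bifunctors with components $$\zeta_{A,K}: f_*[A,f^!K]\xrightarrow{\ \mu\ }[f_*A,f_*f^!K]\xrightarrow{\ \epsilon^!_*\ }[f_*A,K]\qquad(A\in\mathcal C_2,\ K\in\mathcal C_1),$$ where the second arrow is induced by the counit $\epsilon^!_*:f_*f^!\to\mathrm{Id}$. Then for every object $K$ of $\mathcal C_1$, $\{f_*,\zeta_K\}$ is a duality preserving functor from $(\mathcal C_2,D_{f^!K},\varpi_{f^!K})$ to $(\mathcal C_1,D_K,\varpi_K)$. If $\mathcal C_1,\mathcal C_2,f^*$ are suspended (resp. triangulated, with $f^*$ exact), then $\{f_*,\zeta_K\}$ is a suspended (resp. exact) duality preserving functor.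
   Context: Closed categories. A symmetric monoidal closed category $(\mathcal C,\otimes)$ (with symmetry $s$) has an internal Hom $[-,-]$ with adjunctions $(-\otimes X)\dashv[X,-]$ natural in $X$, with counit $\mathrm{ev}^l_{X,A}:[X,A]\otimes X\to A$ and unit $\mathrm{coev}^l_{X,A}:A\to[X,A\otimes X]$. Put $\mathrm{ev}^r_{A,K}=\mathrm{ev}^l_{A,K}\circ s:A\otimes[A,K]\to K$. Dualities. For an object $K$, $D_K=[-,K]:\mathcal C\to\mathcal C^o$, with opposite functor $D_K^o$, and $\varpi_K:\mathrm{Id}\to D_K^oD_K$ has component $\varpi_{K,A}:A\to[[A,K],K]$ corresponding to $\mathrm{ev}^r_{A,K}$ under $(-\otimes[A,K])\dashv[[A,K],-]$. A duality preserving functor $\{F,\phi\}:(\mathcal C_1,D_1,\varpi_1)\to(\mathcal C_2,D_2,\varpi_2)$ is a functor $F$ and a natural transformation $\phi:FD_1^o\to D_2^oF^o$ (components $\phi_A:FD_1A\to D_2FA$) such that $\phi_{D_1A}\circ F(\varpi_{1,A})=D_2(\phi_A)\circ\varpi_{2,FA}$ for all $A$. Functors. A symmetric monoidal functor $f^*$ comes with a natural isomorphism $\alpha_{A,B}:f^*A\otimes f^*B\to f^*(A\otimes B)$ compatible with associativity and symmetry (and units, when considered). Let $\eta^*_*:\mathrm{Id}\to f_*f^*$, $\epsilon^*_*:f^*f_*\to\mathrm{Id}$ be the unit and counit of $f^*\dashv f_*$. Define $\lambda_{A,B}$ as the composition $f_*A\otimes f_*B\xrightarrow{\eta^*_*}f_*f^*(f_*A\otimes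 f_*B)\xrightarrow{\alpha^{-1}}f_*(f^*f_*A\otimes f^*f_*B)\xrightarrow{\epsilon^*_*\otimes\epsilon^*_*}f_*(A\otimes B)$ and $\mu_{A,B}$ as the composition $f_*[A,B]\xrightarrow{\mathrm{coev}^l}[f_*A,f_*[A,B]\otimes f_*A]\xrightarrow{\lambda}[f_*A,f_*([A,B]\otimes A)]\xrightarrow{\mathrm{ev}^l}[f_*A,f_*B]$. Suspended and triangulated versions. A suspended category is an additive category with a functor $T$ having a strict inverse $T^{-1}$; $\mathcal C^o$ is suspended by $(T^{-1})^o$. A suspended functor is a functor $F$ with an isomorphism $FT\to TF$; morphisms of suspended functors are natural transformations commuting with these isomorphisms. A suspended bifunctor is a bifunctor $B$ with natural isomorphisms $b_1:B(TA,C)\to TB(A,C)$, $b_2:B(A,TC)\to TB(A,C)$ such that $T(b_{1,A,C})\circ b_{2,TA,C}=-T(b_{2,A,C})\circ b_{1,A,TC}$; morphisms of suspended bifunctors are natural transformations commuting with the $b_1$'s and $b_2$'s. A symmetric monoidal closed category is suspended if $\mathcal C$ is suspended and $\otimes$ is a suspended bifunctor, with structure $tp_1:TA\otimes B\to T(A\otimes B)$, $tp_2:A\otimes TB\to T(A\otimes B)$, such that for each of the three variables the ways of moving $T$ out of a triple tensor product commute with associativity, and $T(s)\circ tp_1=tp_2\circ s$. Then $[-,-]$ is a suspended bifunctor via the unique $th_1:[T^{-1}A,K]\to T[A,K]$ and $th_2:[A,TK]\to T[A,K]$ with $T(\mathrm{ev}^l_{A,K})\circ tp_1\circ(th_2\otimes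 \mathrm{id})=\mathrm{ev}^l_{A,TK}$ and $\mathrm{ev}^l_{TA,K}\circ(T^{-1}th_{1,TA,K}\otimes\mathrm{id})=\mathrm{ev}^l_{A,K}\circ tp_1^{-1}\circ tp_2$ on $T^{-1}[A,K]\otimes TA$; $D_K$ and $D_K^o$ are suspended via $th_1$. It is triangulated if $\mathcal C$ is triangulated with suspension $T$, $\otimes$ is exact in both variables and $[-,-]$ is exact in the first variable; a suspended functor $(F,\varphi)$ is exact if it sends an exact triangle $(u,v,w)$ to the exact triangle $(Fu,Fv,\varphi\circ Fw)$ (contravariant case: $A\xrightarrow{u}B\xrightarrow{v}C\xrightarrow{w}TA$ is sent to $(Fv,Fu,\varphi_C\circ FT^{-1}w)$). A suspended (resp. triangulated) symmetric monoidal functor is a suspended (resp. exact) functor for which $\alpha$ is a morphism of suspended bifunctors. In the suspended setting, $f_*$ and $f^!$ carry the unique suspended structures for which the units and counits of $f^*\dashv f_*$ and $f_*\dashv f^!$ are morphisms of suspended functors. A duality preserving functor $\{F,\phi\}$ is suspended (resp. exact) if $F$ is suspended (resp. exact) and $\phi$ is a morphism of suspended functors. *)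

theory Defs
  imports "HOL-Algebra.Group"
begin

section \<open>Categories, functors, natural transformations\<close>

record ('o, 'a) cat =
  Obj :: "'o set"
  Arr :: "'a set"
  Dom :: "'a \<Rightarrow> 'o"
  Cod :: "'a \<Rightarrow> 'o"
  Id :: "'o \<Rightarrow> 'a"
  Comp :: "'a \<Rightarrow> 'a \<Rightarrow> 'a"  (infixl "\<cdot>\<index>" 55)

definition Hom :: "('o, 'a) cat \<Rightarrow> 'o \<Rightarrow> 'o \<Rightarrow> 'a set" where
  "Hom C A B = {f \<in> Arr C. Dom C f = A \<and> Cod C f = B}"

locale category =
  fixes C :: "('o, 'a) cat" (structure)
  assumes Dom_Obj: "f \<in> Arr C \<Longrightarrow> Dom C f \<in> Obj C"
    and Cod_Obj: "f \<in> Arr C \<Longrightarrow> Cod C f \<in> Obj C"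
    and Id_Hom: "A \<in> Obj C \<Longrightarrow> Id C A \<in> Hom C A A"
    and Comp_Hom: "f \<in> Hom C A B \<Longrightarrow> g \<in> Hom C B D \<Longrightarrow> g \<cdot> f \<in> Hom C A D"
    and Comp_Id: "f \<in> Hom C A B \<Longrightarrow> f \<cdot> Id C A = f"
    and Id_Comp: "f \<in> Hom C A B \<Longrightarrow> Id C B \<cdot> f = f"
    and Comp_assoc: "f \<in> Hom C A B \<Longrightarrow> g \<in> Hom C B D \<Longrightarrow> h \<in> Hom C D E \<Longrightarrow>
          h \<cdot> (g \<cdot> f) = (h \<cdot> g) \<cdot> f"

definition inverse_arrows :: "('o, 'a) cat \<Rightarrow> 'a \<Rightarrow> 'a \<Rightarrow> bool" where
  "inverse_arrows C f g \<longleftrightarrow> f \<in> Arr C \<and> g \<in> Hom C (Cod C f) (Dom C f) \<and>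
     g \<cdot>\<^bsub>C\<^esub> f = Id C (Dom C f) \<and> f \<cdot>\<^bsub>C\<^esub> g = Id C (Cod C f)"

definition iso_arr :: "('o, 'a) cat \<Rightarrow> 'a \<Rightarrow> bool" where
  "iso_arr C f \<longleftrightarrow> (\<exists>g. inverse_arrows C f g)"

definition inv_arr :: "('o, 'a) cat \<Rightarrow> 'a \<Rightarrow> 'a" where
  "inv_arr C f = (THE g. inverse_arrows C f g)"

definition op_cat :: "('o, 'a) cat \<Rightarrow> ('o, 'a) cat" where
  "op_cat C = \<lparr>Obj = Obj C, Arr = Arr C, Dom = Cod C, Cod = Dom C, Id = Id C,
     Comp = (\<lambda>g f. f \<cdot>\<^bsub>C\<^esub> g)\<rparr>"

definition prod_cat :: "('o, 'a) cat \<Rightarrow> ('p, 'b) cat \<Rightarrow> ('o \<times> 'p, 'a \<times> 'b) cat"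
    (infixr "\<times>\<^sub>C" 75) where
  "C \<times>\<^sub>C D = \<lparr>Obj = Obj C \<times> Obj D, Arr = Arr C \<times> Arr D,
     Dom = map_prod (Dom C) (Dom D), Cod = map_prod (Cod C) (Cod D),
     Id = map_prod (Id C) (Id D),
     Comp = (\<lambda>(g, g') (f, f'). (g \<cdot>\<^bsub>C\<^esub> f, g' \<cdot>\<^bsub>D\<^esub> f'))\<rparr>"

text \<open>
  A functor is given by its action on objects and on arrows only, so \<open>F\<close> from \<open>C\<close> to \<open>D\<close> and its
  opposite from \<open>op_cat C\<close> to \<open>op_cat D\<close> are the same \<open>func\<close>.
\<close>

record ('o, 'a, 'p, 'b) func =
  ob :: "'o \<Rightarrow> 'p"
  ar :: "'a \<Rightarrow> 'b"

locale cat_functor =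
  dom_cat: category C + cod_cat: category D
  for C :: "('o, 'a) cat" and D :: "('p, 'b) cat" +
  fixes F :: "('o, 'a, 'p, 'b) func"
  assumes ob_Obj: "A \<in> Obj C \<Longrightarrow> ob F A \<in> Obj D"
    and ar_Hom: "f \<in> Hom C A B \<Longrightarrow> ar F f \<in> Hom D (ob F A) (ob F B)"
    and ar_Id: "A \<in> Obj C \<Longrightarrow> ar F (Id C A) = Id D (ob F A)"
    and ar_Comp: "f \<in> Hom C A B \<Longrightarrow> g \<in> Hom C B E \<Longrightarrow>
          ar F (g \<cdot>\<^bsub>C\<^esub> f) = ar F g \<cdot>\<^bsub>D\<^esub> ar F f"

definition id_func :: "('o, 'a, 'o, 'a) func" where
  "id_func = \<lparr>ob = id, ar = id\<rparr>"

definition func_comp :: "('p, 'b, 'q, 'c) func \<Rightarrow> ('o, 'a, 'p, 'b) func \<Rightarrow> ('o, 'a, 'q, 'c) func"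
    (infixr "\<circ>\<^sub>F" 55) where
  "G \<circ>\<^sub>F F = \<lparr>ob = ob G \<circ> ob F, ar = ar G \<circ> ar F\<rparr>"

definition func_prod ::
    "('o, 'a, 'p, 'b) func \<Rightarrow> ('o', 'a', 'p', 'b') func \<Rightarrow>
     ('o \<times> 'o', 'a \<times> 'a', 'p \<times> 'p', 'b \<times> 'b') func"
    (infixr "\<times>\<^sub>F" 75) where
  "F \<times>\<^sub>F G = \<lparr>ob = map_prod (ob F) (ob G), ar = map_prod (ar F) (ar G)\<rparr>"

definition swap_func :: "('o \<times> 'p, 'a \<times> 'b, 'p \<times> 'o, 'b \<times> 'a) func" where
  "swap_func = \<lparr>ob = prod.swap, ar = prod.swap\<rparr>"

definition fix_fst :: "('o, 'a) cat \<Rightarrow> ('o \<times> 'p, 'a \<times> 'b, 'q, 'c) func \<Rightarrow> 'o \<Rightarrow> ('p, 'b, 'q, 'c) func" where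
  "fix_fst C B X = \<lparr>ob = (\<lambda>A. ob B (X, A)), ar = (\<lambda>f. ar B (Id C X, f))\<rparr>"

definition fix_snd :: "('p, 'b) cat \<Rightarrow> ('o \<times> 'p, 'a \<times> 'b, 'q, 'c) func \<Rightarrow> 'p \<Rightarrow> ('o, 'a, 'q, 'c) func" where
  "fix_snd C B X = \<lparr>ob = (\<lambda>A. ob B (A, X)), ar = (\<lambda>f. ar B (f, Id C X))\<rparr>"

locale nat_trans =
  source: cat_functor C D F + target: cat_functor C D G
  for C :: "('o, 'a) cat" and D :: "('p, 'b) cat" and F G +
  fixes \<theta> :: "'o \<Rightarrow> 'b"
  assumes component: "A \<in> Obj C \<Longrightarrow> \<theta> A \<in> Hom D (ob F A) (ob G A)"
    and naturality: "f \<in> Hom C A B \<Longrightarrow> ar G f \<cdot>\<^bsub>D\<^esub> \<theta> A = \<theta> B \<cdot>\<^bsub>D\<^esub> ar F f"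

locale nat_iso = nat_trans +
  assumes component_iso: "A \<in> Obj C \<Longrightarrow> iso_arr D (\<theta> A)"

text \<open>\<open>F\<close> is left adjoint to \<open>G\<close>, with unit \<open>\<eta>\<close> and counit \<open>\<epsilon>\<close>.\<close>

locale adjunction =
  unit: nat_trans C C id_func "G \<circ>\<^sub>F F" \<eta> + counit: nat_trans D D "F \<circ>\<^sub>F G" id_func \<epsilon> +
  left: cat_functor C D F + right: cat_functor D C G
  for C :: "('o, 'a) cat" and D :: "('p, 'b) cat" and F G \<eta> \<epsilon> +
  assumes triangle_left: "A \<in> Obj C \<Longrightarrow> \<epsilon> (ob F A) \<cdot>\<^bsub>D\<^esub> ar F (\<eta> A) = Id D (ob F A)"
    and triangle_right: "B \<in> Obj D \<Longrightarrow> ar G (\<epsilon> B) \<cdot>\<^bsub>C\<^esub> \<eta> (ob G B) = Id C (ob G B)"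


section \<open>Symmetric monoidal closed categories\<close>

record ('o, 'a) smc =
  tensor :: "('o \<times> 'o, 'a \<times> 'a, 'o, 'a) func"
  unit_ob :: 'o
  associator :: "'o \<times> 'o \<times> 'o \<Rightarrow> 'a"
  lunitor :: "'o \<Rightarrow> 'a"
  runitor :: "'o \<Rightarrow> 'a"
  symm :: "'o \<times> 'o \<Rightarrow> 'a"
  ihom :: "('o \<times> 'o, 'a \<times> 'a, 'o, 'a) func"
  ev :: "'o \<Rightarrow> 'o \<Rightarrow> 'a"
  coev :: "'o \<Rightarrow> 'o \<Rightarrow> 'a"

abbreviation tensor_ob  (infixl "\<otimes>\<^sub>o\<index>" 70) where
  "A \<otimes>\<^sub>o\<^bsub>M\<^esub> B \<equiv> ob (tensor M) (A, B)"
abbreviation tensor_ar  (infixl "\<otimes>\<^sub>a\<index>" 70) where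
  "f \<otimes>\<^sub>a\<^bsub>M\<^esub> g \<equiv> ar (tensor M) (f, g)"

text \<open>
  The internal Hom \<open>[A, B]\<close> is written \<open>A \<leadsto>\<^sub>o B\<close>. It is contravariant in the first variable: for \<open>f\<close>
  from \<open>A'\<close> to \<open>A\<close> and \<open>g\<close> from \<open>B\<close> to \<open>B'\<close>, \<open>f \<leadsto>\<^sub>a g\<close> goes from \<open>[A, B]\<close> to \<open>[A', B']\<close>.
\<close>

abbreviation ihom_ob  (infixr "\<leadsto>\<^sub>o\<index>" 68) where
  "A \<leadsto>\<^sub>o\<^bsub>M\<^esub> B \<equiv> ob (ihom M) (A, B)"
abbreviation ihom_ar  (infixr "\<leadsto>\<^sub>a\<index>" 68) where
  "f \<leadsto>\<^sub>a\<^bsub>M\<^esub> g \<equiv> ar (ihom M) (f, g)"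

definition tensor_l3 :: "('o, 'a) smc \<Rightarrow> ('o \<times> 'o \<times> 'o, 'a \<times> 'a \<times> 'a, 'o, 'a) func" where
  "tensor_l3 M = \<lparr>ob = (\<lambda>(A, B, D). (A \<otimes>\<^sub>o\<^bsub>M\<^esub> B) \<otimes>\<^sub>o\<^bsub>M\<^esub> D),
                  ar = (\<lambda>(f, g, h). (f \<otimes>\<^sub>a\<^bsub>M\<^esub> g) \<otimes>\<^sub>a\<^bsub>M\<^esub> h)\<rparr>"

definition tensor_r3 :: "('o, 'a) smc \<Rightarrow> ('o \<times> 'o \<times> 'o, 'a \<times> 'a \<times> 'a, 'o, 'a) func" where
  "tensor_r3 M = \<lparr>ob = (\<lambda>(A, B, D). A \<otimes>\<^sub>o\<^bsub>M\<^esub> (B \<otimes>\<^sub>o\<^bsub>M\<^esub> D)),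
                  ar = (\<lambda>(f, g, h). f \<otimes>\<^sub>a\<^bsub>M\<^esub> (g \<otimes>\<^sub>a\<^bsub>M\<^esub> h))\<rparr>"

locale symmetric_monoidal_category =
  category C for C :: "('o, 'a) cat" (structure) +
  fixes M :: "('o, 'a) smc"
  assumes tensor_functor: "cat_functor (C \<times>\<^sub>C C) C (tensor M)"
    and unit_Obj: "unit_ob M \<in> Obj C"
    and associator_iso: "nat_iso (C \<times>\<^sub>C C \<times>\<^sub>C C) C (tensor_l3 M) (tensor_r3 M) (associator M)"
    and lunitor_iso: "nat_iso C C (fix_fst C (tensor M) (unit_ob M)) id_func (lunitor M)"
    and runitor_iso: "nat_iso C C (fix_snd C (tensor M) (unit_ob M)) id_func (runitor M)"
    and symm_iso: "nat_iso (C \<times>\<^sub>C C) C (tensor M) (tensor M \<circ>\<^sub>F swap_func) (symm M)"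
    and pentagon: "A \<in> Obj C \<Longrightarrow> B \<in> Obj C \<Longrightarrow> D \<in> Obj C \<Longrightarrow> E \<in> Obj C \<Longrightarrow>
      associator M (A, B, D \<otimes>\<^sub>o\<^bsub>M\<^esub> E) \<cdot> associator M (A \<otimes>\<^sub>o\<^bsub>M\<^esub> B, D, E) =
      (Id C A \<otimes>\<^sub>a\<^bsub>M\<^esub> associator M (B, D, E)) \<cdot> associator M (A, B \<otimes>\<^sub>o\<^bsub>M\<^esub> D, E)
        \<cdot> (associator M (A, B, D) \<otimes>\<^sub>a\<^bsub>M\<^esub> Id C E)"
    and triangle: "A \<in> Obj C \<Longrightarrow> B \<in> Obj C \<Longrightarrow>
      (Id C A \<otimes>\<^sub>a\<^bsub>M\<^esub> lunitor M B) \<cdot> associator M (A, unit_ob M, B) = runitor M A \<otimes>\<^sub>a\<^bsub>M\<^esub> Id C B"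
    and hexagon: "A \<in> Obj C \<Longrightarrow> B \<in> Obj C \<Longrightarrow> D \<in> Obj C \<Longrightarrow>
      associator M (B, D, A) \<cdot> symm M (A, B \<otimes>\<^sub>o\<^bsub>M\<^esub> D) \<cdot> associator M (A, B, D) =
      (Id C B \<otimes>\<^sub>a\<^bsub>M\<^esub> symm M (A, D)) \<cdot> associator M (B, A, D) \<cdot> (symm M (A, B) \<otimes>\<^sub>a\<^bsub>M\<^esub> Id C D)"
    and symm_symm: "A \<in> Obj C \<Longrightarrow> B \<in> Obj C \<Longrightarrow>
      symm M (B, A) \<cdot> symm M (A, B) = Id C (A \<otimes>\<^sub>o\<^bsub>M\<^esub> B)"
    and symm_unit: "A \<in> Obj C \<Longrightarrow> lunitor M A \<cdot> symm M (A, unit_ob M) = runitor M A"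

text \<open>
  For each \<open>X\<close>, tensoring with \<open>X\<close> on the right is left adjoint to \<open>[X, -]\<close>; naturality of these
  adjunctions in \<open>X\<close> is extranaturality of the counit and of the unit.
\<close>

locale symmetric_monoidal_closed_category =
  symmetric_monoidal_category C M for C :: "('o, 'a) cat" (structure) and M +
  assumes ihom_functor: "cat_functor (op_cat C \<times>\<^sub>C C) C (ihom M)"
    and tensor_ihom_adjunction: "X \<in> Obj C \<Longrightarrow>
      adjunction C C (fix_snd C (tensor M) X) (fix_fst C (ihom M) X) (coev M X) (ev M X)"
    and ev_natural: "f \<in> Hom C X Y \<Longrightarrow> A \<in> Obj C \<Longrightarrow>
      ev M X A \<cdot> ((f \<leadsto>\<^sub>a\<^bsub>M\<^esub> Id C A) \<otimes>\<^sub>a\<^bsub>M\<^esub> Id C X) = ev M Y A \<cdot> (Id C (Y \<leadsto>\<^sub>o\<^bsub>M\<^esub> A) \<otimes>\<^sub>a\<^bsub>M\<^esub> f)"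
    and coev_natural: "f \<in> Hom C X Y \<Longrightarrow> A \<in> Obj C \<Longrightarrow>
      (Id C X \<leadsto>\<^sub>a\<^bsub>M\<^esub> (Id C A \<otimes>\<^sub>a\<^bsub>M\<^esub> f)) \<cdot> coev M X A = (f \<leadsto>\<^sub>a\<^bsub>M\<^esub> Id C (A \<otimes>\<^sub>o\<^bsub>M\<^esub> Y)) \<cdot> coev M Y A"

definition ev_r :: "('o, 'a) cat \<Rightarrow> ('o, 'a) smc \<Rightarrow> 'o \<Rightarrow> 'o \<Rightarrow> 'a" where
  "ev_r C M A K = ev M A K \<cdot>\<^bsub>C\<^esub> symm M (A, A \<leadsto>\<^sub>o\<^bsub>M\<^esub> K)"

text \<open>
  The comparison isomorphism of unit objects is optional: with \<open>\<upsilon> = None\<close> the functor is only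
  required to be compatible with associativity and symmetry.
\<close>

locale symmetric_monoidal_functor =
  cat_functor C D F
  for C :: "('o, 'a) cat" and M :: "('o, 'a) smc"
    and D :: "('p, 'b) cat" and N :: "('p, 'b) smc" and F +
  fixes \<alpha> :: "'o \<times> 'o \<Rightarrow> 'b" and \<upsilon> :: "'b option"
  assumes alpha_iso: "nat_iso (C \<times>\<^sub>C C) D (tensor N \<circ>\<^sub>F (F \<times>\<^sub>F F)) (F \<circ>\<^sub>F tensor M) \<alpha>"
    and alpha_associator: "A \<in> Obj C \<Longrightarrow> B \<in> Obj C \<Longrightarrow> E \<in> Obj C \<Longrightarrow>
      ar F (associator M (A, B, E)) \<cdot>\<^bsub>D\<^esub> \<alpha> (A \<otimes>\<^sub>o\<^bsub>M\<^esub> B, E) \<cdot>\<^bsub>D\<^esub> (\<alpha> (A, B) \<otimes>\<^sub>a\<^bsub>N\<^esub> Id D (ob F E)) =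
      \<alpha> (A, B \<otimes>\<^sub>o\<^bsub>M\<^esub> E) \<cdot>\<^bsub>D\<^esub> (Id D (ob F A) \<otimes>\<^sub>a\<^bsub>N\<^esub> \<alpha> (B, E)) \<cdot>\<^bsub>D\<^esub> associator N (ob F A, ob F B, ob F E)"
    and alpha_symm: "A \<in> Obj C \<Longrightarrow> B \<in> Obj C \<Longrightarrow>
      ar F (symm M (A, B)) \<cdot>\<^bsub>D\<^esub> \<alpha> (A, B) = \<alpha> (B, A) \<cdot>\<^bsub>D\<^esub> symm N (ob F A, ob F B)"
    and unit_iso: "\<upsilon> = Some u \<Longrightarrow> u \<in> Hom D (unit_ob N) (ob F (unit_ob M)) \<and> iso_arr D u"
    and unit_left: "\<upsilon> = Some u \<Longrightarrow> A \<in> Obj C \<Longrightarrow>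
      ar F (lunitor M A) \<cdot>\<^bsub>D\<^esub> \<alpha> (unit_ob M, A) \<cdot>\<^bsub>D\<^esub> (u \<otimes>\<^sub>a\<^bsub>N\<^esub> Id D (ob F A)) = lunitor N (ob F A)"
    and unit_right: "\<upsilon> = Some u \<Longrightarrow> A \<in> Obj C \<Longrightarrow>
      ar F (runitor M A) \<cdot>\<^bsub>D\<^esub> \<alpha> (A, unit_ob M) \<cdot>\<^bsub>D\<^esub> (Id D (ob F A) \<otimes>\<^sub>a\<^bsub>N\<^esub> u) = runitor N (ob F A)"


section \<open>Dualities\<close>

text \<open>
  A duality on \<open>C\<close> is a functor \<open>D\<close> from \<open>C\<close> to \<open>op_cat C\<close>; the same \<open>func\<close> read from \<open>op_cat C\<close> to \<open>C\<close>
  is its opposite, and \<open>D \<circ>\<^sub>F D\<close> below is the bidual, from \<open>C\<close> to \<open>C\<close>.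
\<close>

locale category_with_duality =
  duality: cat_functor C "op_cat C" D + bidual: nat_trans C C id_func "D \<circ>\<^sub>F D" \<omega>
  for C :: "('o, 'a) cat" and D \<omega>

locale duality_preserving_functor =
  source: category_with_duality C1 D1 \<omega>1 + target: category_with_duality C2 D2 \<omega>2 +
  cat_functor C1 C2 F + nat_trans "op_cat C1" C2 "F \<circ>\<^sub>F D1" "D2 \<circ>\<^sub>F F" \<phi>
  for C1 :: "('o, 'a) cat" and D1 \<omega>1 and C2 :: "('p, 'b) cat" and D2 \<omega>2 and F \<phi> +
  assumes bidual_compatible: "A \<in> Obj C1 \<Longrightarrow>
    \<phi> (ob D1 A) \<cdot>\<^bsub>C2\<^esub> ar F (\<omega>1 A) = ar D2 (\<phi> A) \<cdot>\<^bsub>C2\<^esub> \<omega>2 (ob F A)"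

definition dual :: "('o, 'a) cat \<Rightarrow> ('o, 'a) smc \<Rightarrow> 'o \<Rightarrow> ('o, 'a, 'o, 'a) func" where
  "dual C M K = fix_snd C (ihom M) K"

definition bidual_map :: "('o, 'a) cat \<Rightarrow> ('o, 'a) smc \<Rightarrow> 'o \<Rightarrow> 'o \<Rightarrow> 'a" where
  "bidual_map C M K A =
     (Id C (A \<leadsto>\<^sub>o\<^bsub>M\<^esub> K) \<leadsto>\<^sub>a\<^bsub>M\<^esub> ev_r C M A K) \<cdot>\<^bsub>C\<^esub> coev M (A \<leadsto>\<^sub>o\<^bsub>M\<^esub> K) A"


section \<open>The morphisms lambda, mu and zeta\<close>

text \<open>
  Here \<open>F\<close> is the monoidal functor \<open>f\<^sup>*\<close> from \<open>C1\<close> to \<open>C2\<close>, \<open>G\<close> its right adjoint \<open>f\<^sub>*\<close> with unit \<open>\<eta>\<close>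
  and counit \<open>\<epsilon>\<close>, and \<open>H\<close> the right adjoint \<open>f\<^sup>!\<close> of \<open>G\<close>, with counit \<open>\<epsilon>'\<close>.
\<close>

definition lambda_map ::
  "('o, 'a) smc \<Rightarrow> ('o, 'a) cat \<Rightarrow> ('p, 'b) cat \<Rightarrow> ('p, 'b) smc \<Rightarrow> ('o \<times> 'o \<Rightarrow> 'b) \<Rightarrow>
   ('p, 'b, 'o, 'a) func \<Rightarrow> ('o \<Rightarrow> 'a) \<Rightarrow> ('p \<Rightarrow> 'b) \<Rightarrow> 'p \<times> 'p \<Rightarrow> 'a" where
  "lambda_map M1 C1 C2 M2 \<alpha> G \<eta> \<epsilon> = (\<lambda>(A, B).
     ar G (\<epsilon> A \<otimes>\<^sub>a\<^bsub>M2\<^esub> \<epsilon> B) \<cdot>\<^bsub>C1\<^esub> ar G (inv_arr C2 (\<alpha> (ob G A, ob G B))) \<cdot>\<^bsub>C1\<^esub> \<eta> (ob G A \<otimes>\<^sub>o\<^bsub>M1\<^esub> ob G B))"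

definition mu_map ::
  "('o, 'a) smc \<Rightarrow> ('o, 'a) cat \<Rightarrow> ('p, 'b) cat \<Rightarrow> ('p, 'b) smc \<Rightarrow> ('o \<times> 'o \<Rightarrow> 'b) \<Rightarrow>
   ('p, 'b, 'o, 'a) func \<Rightarrow> ('o \<Rightarrow> 'a) \<Rightarrow> ('p \<Rightarrow> 'b) \<Rightarrow> 'p \<times> 'p \<Rightarrow> 'a" where
  "mu_map M1 C1 C2 M2 \<alpha> G \<eta> \<epsilon> = (\<lambda>(A, B).
     (Id C1 (ob G A) \<leadsto>\<^sub>a\<^bsub>M1\<^esub> ar G (ev M2 A B))
     \<cdot>\<^bsub>C1\<^esub> (Id C1 (ob G A) \<leadsto>\<^sub>a\<^bsub>M1\<^esub> lambda_map M1 C1 C2 M2 \<alpha> G \<eta> \<epsilon> (A \<leadsto>\<^sub>o\<^bsub>M2\<^esub> B, A))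
     \<cdot>\<^bsub>C1\<^esub> coev M1 (ob G A) (ob G (A \<leadsto>\<^sub>o\<^bsub>M2\<^esub> B)))"

definition zeta_map ::
  "('o, 'a) cat \<Rightarrow> ('o, 'a) smc \<Rightarrow> ('p, 'b) cat \<Rightarrow> ('p, 'b) smc \<Rightarrow> ('o \<times> 'o \<Rightarrow> 'b) \<Rightarrow>
   ('p, 'b, 'o, 'a) func \<Rightarrow> ('o \<Rightarrow> 'a) \<Rightarrow> ('p \<Rightarrow> 'b) \<Rightarrow>
   ('o, 'a, 'p, 'b) func \<Rightarrow> ('o \<Rightarrow> 'a) \<Rightarrow> 'p \<times> 'o \<Rightarrow> 'a" where
  "zeta_map C1 M1 C2 M2 \<alpha> G \<eta> \<epsilon> H \<epsilon>' = (\<lambda>(A, K).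
     (Id C1 (ob G A) \<leadsto>\<^sub>a\<^bsub>M1\<^esub> \<epsilon>' K) \<cdot>\<^bsub>C1\<^esub> mu_map M1 C1 C2 M2 \<alpha> G \<eta> \<epsilon> (A, ob H K))"


section \<open>Additive and suspended categories\<close>

record ('o, 'a) addcat =
  Add :: "'a \<Rightarrow> 'a \<Rightarrow> 'a"
  Zero :: "'o \<Rightarrow> 'o \<Rightarrow> 'a"

definition Hom_group :: "('o, 'a) cat \<Rightarrow> ('o, 'a, 'm) addcat_scheme \<Rightarrow> 'o \<Rightarrow> 'o \<Rightarrow> 'a monoid" where
  "Hom_group C S A B = \<lparr>carrier = Hom C A B, mult = Add S, one = Zero S A B\<rparr>"

definition Neg :: "('o, 'a) cat \<Rightarrow> ('o, 'a, 'm) addcat_scheme \<Rightarrow> 'a \<Rightarrow> 'a" where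
  "Neg C S f = inv\<^bsub>Hom_group C S (Dom C f) (Cod C f)\<^esub> f"

definition zero_object :: "('o, 'a) cat \<Rightarrow> ('o, 'a, 'm) addcat_scheme \<Rightarrow> 'o \<Rightarrow> bool" where
  "zero_object C S Z \<longleftrightarrow> Z \<in> Obj C \<and> Id C Z = Zero S Z Z"

locale additive_category =
  category C for C :: "('o, 'a) cat" (structure) +
  fixes S :: "('o, 'a, 'm) addcat_scheme"
  assumes Hom_comm_group: "A \<in> Obj C \<Longrightarrow> B \<in> Obj C \<Longrightarrow> comm_group (Hom_group C S A B)"
    and Comp_Add: "f \<in> Hom C A B \<Longrightarrow> f' \<in> Hom C A B \<Longrightarrow> g \<in> Hom C B D \<Longrightarrow>
          g \<cdot> Add S f f' = Add S (g \<cdot> f) (g \<cdot> f')"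
    and Add_Comp: "f \<in> Hom C A B \<Longrightarrow> g \<in> Hom C B D \<Longrightarrow> g' \<in> Hom C B D \<Longrightarrow>
          Add S g g' \<cdot> f = Add S (g \<cdot> f) (g' \<cdot> f)"
    and ex_zero_object: "\<exists>Z. zero_object C S Z"
    and ex_biproduct: "A \<in> Obj C \<Longrightarrow> B \<in> Obj C \<Longrightarrow>
          \<exists>P \<in> Obj C. \<exists>i1 \<in> Hom C A P. \<exists>i2 \<in> Hom C B P. \<exists>p1 \<in> Hom C P A. \<exists>p2 \<in> Hom C P B.
            p1 \<cdot> i1 = Id C A \<and> p2 \<cdot> i2 = Id C B \<and> p1 \<cdot> i2 = Zero S B A \<and> p2 \<cdot> i1 = Zero S A B \<and>
            Add S (i1 \<cdot> p1) (i2 \<cdot> p2) = Id C P"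

record ('o, 'a) susp = "('o, 'a) addcat" +
  Susp :: "('o, 'a, 'o, 'a) func"
  Desusp :: "('o, 'a, 'o, 'a) func"

locale suspended_category =
  additive_category C S +
  susp: cat_functor C C "Susp S" + desusp: cat_functor C C "Desusp S"
  for C :: "('o, 'a) cat" and S :: "('o, 'a) susp" +
  assumes Susp_Desusp_ob: "A \<in> Obj C \<Longrightarrow> ob (Susp S) (ob (Desusp S) A) = A"
    and Desusp_Susp_ob: "A \<in> Obj C \<Longrightarrow> ob (Desusp S) (ob (Susp S) A) = A"
    and Susp_Desusp_ar: "f \<in> Arr C \<Longrightarrow> ar (Susp S) (ar (Desusp S) f) = f"
    and Desusp_Susp_ar: "f \<in> Arr C \<Longrightarrow> ar (Desusp S) (ar (Susp S) f) = f"

definition op_susp :: "('o, 'a) susp \<Rightarrow> ('o, 'a) susp" where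
  "op_susp S = \<lparr>Add = Add S, Zero = (\<lambda>A B. Zero S B A), Susp = Desusp S, Desusp = Susp S\<rparr>"

locale suspended_functor =
  source: suspended_category C S + target: suspended_category C' S' +
  cat_functor C C' F + structure_iso: nat_iso C C' "F \<circ>\<^sub>F Susp S" "Susp S' \<circ>\<^sub>F F" \<phi>
  for C :: "('o, 'a) cat" and S and C' :: "('p, 'b) cat" and S' F \<phi>

definition id_susp :: "('o, 'a) cat \<Rightarrow> ('o, 'a) susp \<Rightarrow> 'o \<Rightarrow> 'a" where
  "id_susp C S A = Id C (ob (Susp S) A)"

text \<open>The suspended structure of the composite of \<open>(F, \<phi>)\<close> and \<open>(G, \<gamma>)\<close>, \<open>C\<close> being the target of \<open>G\<close>.\<close>

definition comp_susp ::
  "('q, 'c) cat \<Rightarrow> ('p, 'b, 'q, 'c) func \<Rightarrow> ('p \<Rightarrow> 'c) \<Rightarrow> ('o, 'a, 'p, 'b) func \<Rightarrow> ('o \<Rightarrow> 'b) \<Rightarrow> 'o \<Rightarrow> 'c" where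
  "comp_susp C G \<gamma> F \<phi> A = \<gamma> (ob F A) \<cdot>\<^bsub>C\<^esub> ar G (\<phi> A)"

text \<open>
  The suspended structure of the opposite of \<open>(F, \<phi>)\<close>. In \<open>op_cat C'\<close> its component at \<open>A\<close> must go from
  \<open>F (T\<^sup>- A)\<close> to \<open>T'\<^sup>- (F A)\<close>, where \<open>T\<^sup>-\<close> is the inverse of \<open>T\<close>; this is the arrow of \<open>C'\<close>
  from \<open>T'\<^sup>- (F A) = T'\<^sup>- (F (T (T\<^sup>- A)))\<close> to \<open>T'\<^sup>- (T' (F (T\<^sup>- A))) = F (T\<^sup>- A)\<close> obtained
  by applying \<open>T'\<^sup>-\<close> to \<open>\<phi>\<close> at \<open>T\<^sup>- A\<close>.
\<close>

definition opposite_susp :: "('o, 'a) susp \<Rightarrow> ('p, 'b) susp \<Rightarrow> ('o \<Rightarrow> 'b) \<Rightarrow> 'o \<Rightarrow> 'b" where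
  "opposite_susp S S' \<phi> A = ar (Desusp S') (\<phi> (ob (Desusp S) A))"

locale suspended_morphism =
  source: suspended_functor C S C' S' F \<phi> + target: suspended_functor C S C' S' G \<gamma> +
  nat_trans C C' F G \<theta>
  for C :: "('o, 'a) cat" and S and C' :: "('p, 'b) cat" and S' F \<phi> G \<gamma> \<theta> +
  assumes Susp_compatible: "A \<in> Obj C \<Longrightarrow>
    ar (Susp S') (\<theta> A) \<cdot>\<^bsub>C'\<^esub> \<phi> A = \<gamma> A \<cdot>\<^bsub>C'\<^esub> \<theta> (ob (Susp S) A)"

text \<open>
  The suspended structure that a right adjoint \<open>G\<close> inherits from \<open>(F, \<phi>)\<close>. Families of arrows are
  taken extensional because their values off the objects are otherwise arbitrary.
\<close>

definition right_adjoint_susp ::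
  "('o, 'a) cat \<Rightarrow> ('o, 'a) susp \<Rightarrow> ('p, 'b) cat \<Rightarrow> ('p, 'b) susp \<Rightarrow>
   ('o, 'a, 'p, 'b) func \<Rightarrow> ('o \<Rightarrow> 'b) \<Rightarrow> ('p, 'b, 'o, 'a) func \<Rightarrow> ('o \<Rightarrow> 'a) \<Rightarrow> ('p \<Rightarrow> 'b) \<Rightarrow> 'p \<Rightarrow> 'a" where
  "right_adjoint_susp C S D R F \<phi> G \<eta> \<epsilon> = (THE \<gamma>. \<gamma> \<in> extensional (Obj D) \<and>
     suspended_functor D R C S G \<gamma> \<and>
     suspended_morphism C S C S id_func (id_susp C S) (G \<circ>\<^sub>F F) (comp_susp C G \<gamma> F \<phi>) \<eta> \<and>
     suspended_morphism D R D R (F \<circ>\<^sub>F G) (comp_susp D F \<phi> G \<gamma>) id_func (id_susp D R) \<epsilon>)"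

locale suspended_bifunctor =
  first: suspended_category C1 S1 + second: suspended_category C2 S2 +
  target: suspended_category C3 S3 + cat_functor "C1 \<times>\<^sub>C C2" C3 B +
  first_iso: nat_iso "C1 \<times>\<^sub>C C2" C3 "B \<circ>\<^sub>F (Susp S1 \<times>\<^sub>F id_func)" "Susp S3 \<circ>\<^sub>F B" b1 +
  second_iso: nat_iso "C1 \<times>\<^sub>C C2" C3 "B \<circ>\<^sub>F (id_func \<times>\<^sub>F Susp S2)" "Susp S3 \<circ>\<^sub>F B" b2
  for C1 :: "('o, 'a) cat" and S1 and C2 :: "('p, 'b) cat" and S2
    and C3 :: "('q, 'c) cat" and S3 B b1 b2 +
  assumes anticommute: "A \<in> Obj C1 \<Longrightarrow> D \<in> Obj C2 \<Longrightarrow>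
    ar (Susp S3) (b1 (A, D)) \<cdot>\<^bsub>C3\<^esub> b2 (ob (Susp S1) A, D) =
    Neg C3 S3 (ar (Susp S3) (b2 (A, D)) \<cdot>\<^bsub>C3\<^esub> b1 (A, ob (Susp S2) D))"

locale suspended_bimorphism =
  source: suspended_bifunctor C1 S1 C2 S2 C3 S3 B b1 b2 +
  target: suspended_bifunctor C1 S1 C2 S2 C3 S3 B' b1' b2' +
  nat_trans "C1 \<times>\<^sub>C C2" C3 B B' \<theta>
  for C1 :: "('o, 'a) cat" and S1 and C2 :: "('p, 'b) cat" and S2
    and C3 :: "('q, 'c) cat" and S3 B b1 b2 B' b1' b2' \<theta> +
  assumes first_compatible: "A \<in> Obj C1 \<Longrightarrow> D \<in> Obj C2 \<Longrightarrow>
      ar (Susp S3) (\<theta> (A, D)) \<cdot>\<^bsub>C3\<^esub> b1 (A, D) = b1' (A, D) \<cdot>\<^bsub>C3\<^esub> \<theta> (ob (Susp S1) A, D)"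
    and second_compatible: "A \<in> Obj C1 \<Longrightarrow> D \<in> Obj C2 \<Longrightarrow>
      ar (Susp S3) (\<theta> (A, D)) \<cdot>\<^bsub>C3\<^esub> b2 (A, D) = b2' (A, D) \<cdot>\<^bsub>C3\<^esub> \<theta> (A, ob (Susp S2) D)"


section \<open>Suspended symmetric monoidal closed categories\<close>

locale suspended_symmetric_monoidal_closed_category =
  symmetric_monoidal_closed_category C M +
  suspended_bifunctor C S C S C S "tensor M" tp1 tp2
  for C :: "('o, 'a) cat" (structure) and M and S and tp1 tp2 +
  assumes associator_first: "A \<in> Obj C \<Longrightarrow> B \<in> Obj C \<Longrightarrow> D \<in> Obj C \<Longrightarrow>
      ar (Susp S) (associator M (A, B, D)) \<cdot> tp1 (A \<otimes>\<^sub>o\<^bsub>M\<^esub> B, D) \<cdot> (tp1 (A, B) \<otimes>\<^sub>a\<^bsub>M\<^esub> Id C D) =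
      tp1 (A, B \<otimes>\<^sub>o\<^bsub>M\<^esub> D) \<cdot> associator M (ob (Susp S) A, B, D)"
    and associator_second: "A \<in> Obj C \<Longrightarrow> B \<in> Obj C \<Longrightarrow> D \<in> Obj C \<Longrightarrow>
      ar (Susp S) (associator M (A, B, D)) \<cdot> tp1 (A \<otimes>\<^sub>o\<^bsub>M\<^esub> B, D) \<cdot> (tp2 (A, B) \<otimes>\<^sub>a\<^bsub>M\<^esub> Id C D) =
      tp2 (A, B \<otimes>\<^sub>o\<^bsub>M\<^esub> D) \<cdot> (Id C A \<otimes>\<^sub>a\<^bsub>M\<^esub> tp1 (B, D)) \<cdot> associator M (A, ob (Susp S) B, D)"
    and associator_third: "A \<in> Obj C \<Longrightarrow> B \<in> Obj C \<Longrightarrow> D \<in> Obj C \<Longrightarrow>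
      ar (Susp S) (associator M (A, B, D)) \<cdot> tp2 (A \<otimes>\<^sub>o\<^bsub>M\<^esub> B, D) =
      tp2 (A, B \<otimes>\<^sub>o\<^bsub>M\<^esub> D) \<cdot> (Id C A \<otimes>\<^sub>a\<^bsub>M\<^esub> tp2 (B, D)) \<cdot> associator M (A, B, ob (Susp S) D)"
    and symm_Susp: "A \<in> Obj C \<Longrightarrow> B \<in> Obj C \<Longrightarrow>
      ar (Susp S) (symm M (A, B)) \<cdot> tp1 (A, B) = tp2 (B, A) \<cdot> symm M (ob (Susp S) A, B)"

text \<open>
  \<open>ihom_susp1\<close> is the structure \<open>th\<^sub>1\<close> from \<open>[T\<^sup>- A, K]\<close> to \<open>T [A, K]\<close>. With \<open>B = T\<^sup>- A\<close>, the defining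
  equation is that of two arrows from \<open>T\<^sup>- [B, K] \<otimes> T B\<close> to \<open>K\<close>.
\<close>

definition ihom_susp1 ::
  "('o, 'a) cat \<Rightarrow> ('o, 'a) smc \<Rightarrow> ('o, 'a) susp \<Rightarrow> ('o \<times> 'o \<Rightarrow> 'a) \<Rightarrow> ('o \<times> 'o \<Rightarrow> 'a) \<Rightarrow> 'o \<Rightarrow> 'o \<Rightarrow> 'a" where
  "ihom_susp1 C M S tp1 tp2 A K =
     (let B = ob (Desusp S) A; X = ob (Desusp S) (B \<leadsto>\<^sub>o\<^bsub>M\<^esub> K) in
      THE h. h \<in> Hom C (B \<leadsto>\<^sub>o\<^bsub>M\<^esub> K) (ob (Susp S) (A \<leadsto>\<^sub>o\<^bsub>M\<^esub> K)) \<and>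
        ev M A K \<cdot>\<^bsub>C\<^esub> (ar (Desusp S) h \<otimes>\<^sub>a\<^bsub>M\<^esub> Id C A) =
        ev M B K \<cdot>\<^bsub>C\<^esub> inv_arr C (tp1 (X, B)) \<cdot>\<^bsub>C\<^esub> tp2 (X, B))"

text \<open>
  The structure of \<open>dual C M K\<close> as a suspended functor from \<open>C\<close> to \<open>op_cat C\<close>: its component at \<open>A\<close> is an
  arrow of \<open>C\<close> from \<open>T\<^sup>- [A, K]\<close> to \<open>[T A, K]\<close>. The opposite structure is \<open>th\<^sub>1\<close> itself.
\<close>

definition dual_susp ::
  "('o, 'a) cat \<Rightarrow> ('o, 'a) smc \<Rightarrow> ('o, 'a) susp \<Rightarrow> ('o \<times> 'o \<Rightarrow> 'a) \<Rightarrow> ('o \<times> 'o \<Rightarrow> 'a) \<Rightarrow> 'o \<Rightarrow> 'o \<Rightarrow> 'a" where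
  "dual_susp C M S tp1 tp2 K A = ar (Desusp S) (ihom_susp1 C M S tp1 tp2 (ob (Susp S) A) K)"

locale suspended_symmetric_monoidal_functor =
  symmetric_monoidal_functor C M D N F \<alpha> \<upsilon> + suspended_functor C S D R F \<phi> +
  suspended_bimorphism C S C S D R
    "tensor N \<circ>\<^sub>F (F \<times>\<^sub>F F)"
    "\<lambda>(A, B). tq1 (ob F A, ob F B) \<cdot>\<^bsub>D\<^esub> (\<phi> A \<otimes>\<^sub>a\<^bsub>N\<^esub> Id D (ob F B))"
    "\<lambda>(A, B). tq2 (ob F A, ob F B) \<cdot>\<^bsub>D\<^esub> (Id D (ob F A) \<otimes>\<^sub>a\<^bsub>N\<^esub> \<phi> B)"
    "F \<circ>\<^sub>F tensor M"
    "\<lambda>(A, B). \<phi> (A \<otimes>\<^sub>o\<^bsub>M\<^esub> B) \<cdot>\<^bsub>D\<^esub> ar F (tp1 (A, B))"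
    "\<lambda>(A, B). \<phi> (A \<otimes>\<^sub>o\<^bsub>M\<^esub> B) \<cdot>\<^bsub>D\<^esub> ar F (tp2 (A, B))"
    \<alpha>
  for C :: "('o, 'a) cat" and M S tp1 tp2 and D :: "('p, 'b) cat" and N R tq1 tq2 and F \<alpha> \<upsilon> \<phi>

locale suspended_duality_preserving_functor =
  duality_preserving_functor C1 D1 \<omega>1 C2 D2 \<omega>2 F \<theta> +
  source_dual: suspended_functor C1 S1 "op_cat C1" "op_susp S1" D1 d1 +
  target_dual: suspended_functor C2 S2 "op_cat C2" "op_susp S2" D2 d2 +
  suspended_functor C1 S1 C2 S2 F \<phi> +
  suspended_morphism "op_cat C1" "op_susp S1" C2 S2
    "F \<circ>\<^sub>F D1" "comp_susp C2 F \<phi> D1 (opposite_susp S1 (op_susp S1) d1)"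
    "D2 \<circ>\<^sub>F F" "comp_susp C2 D2 (opposite_susp S2 (op_susp S2) d2) F (opposite_susp S1 S2 \<phi>)"
    \<theta>
  for C1 :: "('o, 'a) cat" and S1 D1 d1 \<omega>1 and C2 :: "('p, 'b) cat" and S2 D2 d2 \<omega>2 and F \<phi> \<theta>


section \<open>Triangulated categories\<close>

text \<open>\<open>\<Delta>\<close> is the class of exact triangles, as triples \<open>(u, v, w)\<close> of consecutive arrows.\<close>

definition is_triangle :: "('o, 'a) cat \<Rightarrow> ('o, 'a) susp \<Rightarrow> 'a \<times> 'a \<times> 'a \<Rightarrow> bool" where
  "is_triangle C S = (\<lambda>(u, v, w). \<exists>A B D.
     u \<in> Hom C A B \<and> v \<in> Hom C B D \<and> w \<in> Hom C D (ob (Susp S) A))"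

definition triangle_morphism ::
    "('o, 'a) cat \<Rightarrow> ('o, 'a) susp \<Rightarrow> 'a \<times> 'a \<times> 'a \<Rightarrow> 'a \<times> 'a \<times> 'a \<Rightarrow> 'a \<Rightarrow> 'a \<Rightarrow> 'a \<Rightarrow> bool" where
  "triangle_morphism C S = (\<lambda>(u, v, w) (u', v', w') a b d.
     a \<in> Hom C (Dom C u) (Dom C u') \<and> b \<in> Hom C (Dom C v) (Dom C v') \<and> d \<in> Hom C (Dom C w) (Dom C w') \<and>
     b \<cdot>\<^bsub>C\<^esub> u = u' \<cdot>\<^bsub>C\<^esub> a \<and> d \<cdot>\<^bsub>C\<^esub> v = v' \<cdot>\<^bsub>C\<^esub> b \<and> ar (Susp S) a \<cdot>\<^bsub>C\<^esub> w = w' \<cdot>\<^bsub>C\<^esub> d)"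

locale triangulated_category =
  suspended_category C S for C :: "('o, 'a) cat" (structure) and S +
  fixes \<Delta> :: "('a \<times> 'a \<times> 'a) set"
  assumes exact_is_triangle: "t \<in> \<Delta> \<Longrightarrow> is_triangle C S t"
    and exact_iso_closed: "t \<in> \<Delta> \<Longrightarrow> is_triangle C S t' \<Longrightarrow> triangle_morphism C S t t' a b d \<Longrightarrow>
      iso_arr C a \<Longrightarrow> iso_arr C b \<Longrightarrow> iso_arr C d \<Longrightarrow> t' \<in> \<Delta>"
    and exact_Id: "A \<in> Obj C \<Longrightarrow> zero_object C S Z \<Longrightarrow>
      (Id C A, Zero S A Z, Zero S Z (ob (Susp S) A)) \<in> \<Delta>"
    and exact_cone: "u \<in> Arr C \<Longrightarrow> \<exists>v w. (u, v, w) \<in> \<Delta>"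
    and exact_rotate: "is_triangle C S (u, v, w) \<Longrightarrow>
      (u, v, w) \<in> \<Delta> \<longleftrightarrow> (v, w, Neg C S (ar (Susp S) u)) \<in> \<Delta>"
    and exact_fill: "(u, v, w) \<in> \<Delta> \<Longrightarrow> (u', v', w') \<in> \<Delta> \<Longrightarrow>
      a \<in> Hom C (Dom C u) (Dom C u') \<Longrightarrow> b \<in> Hom C (Cod C u) (Cod C u') \<Longrightarrow> b \<cdot> u = u' \<cdot> a \<Longrightarrow>
      \<exists>d. triangle_morphism C S (u, v, w) (u', v', w') a b d"
    and octahedron: "(u, j, k) \<in> \<Delta> \<Longrightarrow> (v, l, i) \<in> \<Delta> \<Longrightarrow> Cod C u = Dom C v \<Longrightarrow> (v \<cdot> u, m, n) \<in> \<Delta> \<Longrightarrow>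
      \<exists>f \<in> Hom C (Cod C j) (Cod C m). \<exists>g \<in> Hom C (Cod C m) (Cod C l).
        (f, g, ar (Susp S) j \<cdot> i) \<in> \<Delta> \<and>
        f \<cdot> j = m \<cdot> v \<and> n \<cdot> f = k \<and> g \<cdot> m = l \<and> i \<cdot> g = ar (Susp S) u \<cdot> n"

locale exact_functor =
  source: triangulated_category C S \<Delta> + target: triangulated_category C' S' \<Delta>' +
  suspended_functor C S C' S' F \<phi>
  for C :: "('o, 'a) cat" and S \<Delta> and C' :: "('p, 'b) cat" and S' \<Delta>' F \<phi> +
  assumes preserves_exact: "(u, v, w) \<in> \<Delta> \<Longrightarrow>
    (ar F u, ar F v, \<phi> (Dom C u) \<cdot>\<^bsub>C'\<^esub> ar F w) \<in> \<Delta>'"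

text \<open>Here \<open>F\<close> is contravariant, and \<open>\<phi>\<close> at \<open>A\<close> goes from \<open>F (T\<^sup>- A)\<close> to \<open>T' (F A)\<close>.\<close>

locale contravariant_exact_functor =
  source: triangulated_category C S \<Delta> + target: triangulated_category C' S' \<Delta>' +
  suspended_functor "op_cat C" "op_susp S" C' S' F \<phi>
  for C :: "('o, 'a) cat" and S \<Delta> and C' :: "('p, 'b) cat" and S' \<Delta>' F \<phi> +
  assumes preserves_exact: "(u, v, w) \<in> \<Delta> \<Longrightarrow>
    (ar F v, ar F u, \<phi> (Cod C v) \<cdot>\<^bsub>C'\<^esub> ar F (ar (Desusp S) w)) \<in> \<Delta>'"

locale triangulated_symmetric_monoidal_closed_category =
  suspended_symmetric_monoidal_closed_category C M S tp1 tp2 + triangulated_category C S \<Delta>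
  for C :: "('o, 'a) cat" and M S tp1 tp2 \<Delta> +
  assumes tensor_exact_first: "B \<in> Obj C \<Longrightarrow>
      exact_functor C S \<Delta> C S \<Delta> (fix_snd C (tensor M) B) (\<lambda>A. tp1 (A, B))"
    and tensor_exact_second: "A \<in> Obj C \<Longrightarrow>
      exact_functor C S \<Delta> C S \<Delta> (fix_fst C (tensor M) A) (\<lambda>B. tp2 (A, B))"
    and ihom_exact_first: "K \<in> Obj C \<Longrightarrow>
      contravariant_exact_functor C S \<Delta> C S \<Delta> (fix_snd C (ihom M) K) (\<lambda>A. ihom_susp1 C M S tp1 tp2 A K)"

locale triangulated_symmetric_monoidal_functor =
  suspended_symmetric_monoidal_functor C M S tp1 tp2 D N R tq1 tq2 F \<alpha> \<upsilon> \<phi> +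
  exact_functor C S \<Delta> D R \<Gamma> F \<phi>
  for C :: "('o, 'a) cat" and M S tp1 tp2 \<Delta>
    and D :: "('p, 'b) cat" and N R tq1 tq2 \<Gamma> and F \<alpha> \<upsilon> \<phi>

locale exact_duality_preserving_functor =
  suspended_duality_preserving_functor C1 S1 D1 d1 \<omega>1 C2 S2 D2 d2 \<omega>2 F \<phi> \<theta> +
  exact_functor C1 S1 \<Delta>1 C2 S2 \<Delta>2 F \<phi>
  for C1 :: "('o, 'a) cat" and S1 \<Delta>1 D1 d1 \<omega>1 and C2 :: "('p, 'b) cat" and S2 \<Delta>2 D2 d2 \<omega>2
    and F \<phi> \<theta>

end

theory Submission
  imports Defs
begin

text \<open>
  Every identity is checked after transposition along an adjunction. The transpose of \<open>\<zeta>\<close> at \<open>(A, K)\<close> is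
  \<open>\<epsilon>' K \<cdot> f\<^sub>*(ev) \<cdot> \<lambda>\<close>, so naturality of \<open>\<zeta>\<close> reduces to that of \<open>\<lambda>\<close> and its compatibility with
  the bidual maps to \<open>f\<^sub>*(s) \<cdot> \<lambda> = \<lambda> \<cdot> s\<close>, which is the symmetry of \<open>\<alpha>\<close> transposed along the
  adjunction of \<open>f\<^sup>*\<close> and \<open>f\<^sub>*\<close>.
  Similarly \<open>\<lambda>\<close> commutes with the suspension structures because \<open>\<alpha>\<close> does; both variables of this are
  needed for \<open>\<zeta>\<close>, since \<open>th\<^sub>1\<close> is defined by the exchange \<open>tp\<^sub>1\<^sup>-\<^sup>1 \<cdot> tp\<^sub>2\<close>.

  For exactness of \<open>f\<^sub>*\<close>, compare the image of a triangle on \<open>u\<close> with a cone of \<open>f\<^sub>* u\<close>: the counit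
  extends to a morphism of triangles from the image under \<open>f\<^sup>*\<close> of the latter, and its transpose is an
  isomorphism by the five lemma, as \<open>Hom(X, f\<^sub>*(-)) = Hom(f\<^sup>* X, -)\<close> is exact on triangles.
\<close>

section \<open>Categories and functors\<close>

text \<open>Two difficulties shape the proof. An arrow into \<open>T (G B)\<close> does not land in
  the image of \<open>G\<close>, so ordinary transposition does not reach it. As \<open>T\<close>
  has a strict inverse, such an arrow can be desuspended, transposed and suspended again; the
  resulting correspondence between \<open>h\<close> and
  \<open>T (\<epsilon> B) \<cdot> \<phi> \<cdot> F h\<close> produces the suspended structure of
  \<open>f_*\<close> and proves identities about it. In the same way \<open>th1\<close> is only
  handled through its desuspension, which can be evaluated. The other difficulty lies in exactness:
  the filler over the counit need not be invertible, only its transpose is, so the five lemma has to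
  be run in \<open>C1\<close> while half of the lifts are taken in \<open>C2\<close>. Functors carry
  no additivity in their definition. What the argument requires is preservation of zero arrows, and
  this is extracted from the adjunction. Evaluation rules carry arbitrary arrows \<open>h\<close>
  and \<open>k\<close> in the two tensor factors, because simplification merges composites of tensor
  products and a rule for identities alone would no longer match.\<close>

lemma op_cat_simps [simp]:
  "Obj (op_cat C) = Obj C" "Arr (op_cat C) = Arr C" "Dom (op_cat C) = Cod C" "Cod (op_cat C) = Dom C"
  "Id (op_cat C) = Id C" "Comp (op_cat C) g f = Comp C f g"
  by (simp_all add: op_cat_def)

lemma op_cat_op_cat [simp]: "op_cat (op_cat C) = C"
  by (simp add: op_cat_def)

lemma op_susp_simps [simp]:
  "Susp (op_susp S) = Desusp S" "Desusp (op_susp S) = Susp S" "Add (op_susp S) = Add S"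
  "Zero (op_susp S) A B = Zero S B A"
  by (simp_all add: op_susp_def)

lemma op_susp_op_susp [simp]: "op_susp (op_susp S) = S"
  by (simp add: op_susp_def)

lemma prod_cat_simps [simp]:
  "Obj (C \<times>\<^sub>C D) = Obj C \<times> Obj D" "Arr (C \<times>\<^sub>C D) = Arr C \<times> Arr D"
  "Dom (C \<times>\<^sub>C D) (f, g) = (Dom C f, Dom D g)" "Cod (C \<times>\<^sub>C D) (f, g) = (Cod C f, Cod D g)"
  "Id (C \<times>\<^sub>C D) (A, B) = (Id C A, Id D B)"
  "Comp (C \<times>\<^sub>C D) (f', g') (f, g) = (Comp C f' f, Comp D g' g)"
  by (simp_all add: prod_cat_def)

lemma func_simps [simp]:
  "ob id_func A = A" "ar id_func f = f"
  "ob (G \<circ>\<^sub>F F) A = ob G (ob F A)" "ar (G \<circ>\<^sub>F F) f = ar G (ar F f)"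
  "ob (F' \<times>\<^sub>F G') (P, Q) = (ob F' P, ob G' Q)" "ar (F' \<times>\<^sub>F G') (p, q) = (ar F' p, ar G' q)"
  "ob swap_func (P', Q') = (Q', P')" "ar swap_func (p', q') = (q', p')"
  by (simp_all add: id_func_def func_comp_def func_prod_def swap_func_def)

lemma fix_simps [simp]:
  "ob (fix_fst C B X) A = ob B (X, A)" "ar (fix_fst C B X) f = ar B (Id C X, f)"
  "ob (fix_snd D B' Y) A' = ob B' (A', Y)" "ar (fix_snd D B' Y) f' = ar B' (f', Id D Y)"
  by (simp_all add: fix_fst_def fix_snd_def)

lemma Hom_iff: "f \<in> Hom C A B \<longleftrightarrow> f \<in> Arr C \<and> Dom C f = A \<and> Cod C f = B"
  by (simp add: Hom_def)

context category
begin

declare Dom_Obj [simp] Cod_Obj [simp]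

lemma Id_simps [simp]:
  assumes "A \<in> Obj C"
  shows "Id C A \<in> Arr C" "Dom C (Id C A) = A" "Cod C (Id C A) = A"
  using Id_Hom[OF assms] by (simp_all add: Hom_iff)

lemma Comp_simps [simp]:
  assumes "f \<in> Arr C" "g \<in> Arr C" "Cod C f = Dom C g"
  shows "g \<cdot> f \<in> Arr C" "Dom C (g \<cdot> f) = Dom C f" "Cod C (g \<cdot> f) = Cod C g"
  using Comp_Hom[of f "Dom C f" "Cod C f" g "Cod C g"] assms by (simp_all add: Hom_iff)

lemma Comp_Id_simp [simp]: "f \<in> Arr C \<Longrightarrow> Dom C f = A \<Longrightarrow> f \<cdot> Id C A = f"
  using Comp_Id by (auto simp: Hom_iff)

lemma Id_Comp_simp [simp]: "f \<in> Arr C \<Longrightarrow> Cod C f = A \<Longrightarrow> Id C A \<cdot> f = f"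
  using Id_Comp by (auto simp: Hom_iff)

lemma assoc [simp]:
  "f \<in> Arr C \<Longrightarrow> g \<in> Arr C \<Longrightarrow> h \<in> Arr C \<Longrightarrow> Cod C f = Dom C g \<Longrightarrow> Cod C g = Dom C h \<Longrightarrow>
    (h \<cdot> g) \<cdot> f = h \<cdot> (g \<cdot> f)"
  using Comp_assoc by (simp add: Hom_iff)

text \<open>Turns an equation of composites into one that rewrites inside a right-nested composite.\<close>

lemma tail:
  "g \<cdot> f = k \<Longrightarrow> f \<in> Arr C \<Longrightarrow> g \<in> Arr C \<Longrightarrow> Cod C f = Dom C g \<Longrightarrow>
    x \<in> Arr C \<Longrightarrow> Cod C x = Dom C f \<Longrightarrow> g \<cdot> (f \<cdot> x) = k \<cdot> x"
  using assoc by metis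

end

text \<open>Membership in \<open>Hom\<close> is traded for equations on \<open>Dom\<close> and
  \<open>Cod\<close>, the form in which the simplifier discharges typing conditions; the
  introduction rules below for functors and natural transformations follow the same pattern.\<close>

lemma categoryI:
  assumes "\<And>f. f \<in> Arr C \<Longrightarrow> Dom C f \<in> Obj C \<and> Cod C f \<in> Obj C"
    and "\<And>A. A \<in> Obj C \<Longrightarrow> Id C A \<in> Arr C \<and> Dom C (Id C A) = A \<and> Cod C (Id C A) = A"
    and "\<And>f g. f \<in> Arr C \<Longrightarrow> g \<in> Arr C \<Longrightarrow> Cod C f = Dom C g \<Longrightarrow>
      Comp C g f \<in> Arr C \<and> Dom C (Comp C g f) = Dom C f \<and> Cod C (Comp C g f) = Cod C g"
    and "\<And>f. f \<in> Arr C \<Longrightarrow> Comp C f (Id C (Dom C f)) = f \<and> Comp C (Id C (Cod C f)) f = f"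
    and "\<And>f g h. f \<in> Arr C \<Longrightarrow> g \<in> Arr C \<Longrightarrow> h \<in> Arr C \<Longrightarrow> Cod C f = Dom C g \<Longrightarrow> Cod C g = Dom C h \<Longrightarrow>
      Comp C h (Comp C g f) = Comp C (Comp C h g) f"
  shows "category C"
  by unfold_locales (use assms in \<open>auto simp: Hom_iff\<close>)

lemma category_op: "category C \<Longrightarrow> category (op_cat C)"
  by (rule categoryI) (simp_all add: category.Dom_Obj category.Cod_Obj category.Id_simps category.Comp_simps
      category.Comp_Id_simp category.Id_Comp_simp category.assoc)

lemma category_prod:
  assumes "category C" "category D"
  shows "category (C \<times>\<^sub>C D)"
proof -
  interpret C: category C by fact
  interpret D: category D by fact
  show ?thesis by (rule categoryI) auto
qed

context cat_functor
begin

declare ob_Obj [simp] ar_Id [simp]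

lemma ar_simps [simp]:
  assumes "f \<in> Arr C"
  shows "ar F f \<in> Arr D" "Dom D (ar F f) = ob F (Dom C f)" "Cod D (ar F f) = ob F (Cod C f)"
  using ar_Hom[of f "Dom C f" "Cod C f"] assms by (simp_all add: Hom_iff)

lemma ar_Comp_simp [simp]:
  "f \<in> Arr C \<Longrightarrow> g \<in> Arr C \<Longrightarrow> Cod C f = Dom C g \<Longrightarrow>
    ar F (g \<cdot>\<^bsub>C\<^esub> f) = ar F g \<cdot>\<^bsub>D\<^esub> ar F f"
  using ar_Comp by (simp add: Hom_iff)

lemma ar_eq:
  "g \<cdot>\<^bsub>C\<^esub> f = k \<Longrightarrow> f \<in> Arr C \<Longrightarrow> g \<in> Arr C \<Longrightarrow> Cod C f = Dom C g \<Longrightarrow>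
    ar F g \<cdot>\<^bsub>D\<^esub> ar F f = ar F k"
  using ar_Comp_simp by metis

end

lemma cat_functorI:
  assumes "category C" "category D"
    and "\<And>A. A \<in> Obj C \<Longrightarrow> ob F A \<in> Obj D"
    and "\<And>f. f \<in> Arr C \<Longrightarrow> ar F f \<in> Arr D \<and> Dom D (ar F f) = ob F (Dom C f) \<and> Cod D (ar F f) = ob F (Cod C f)"
    and "\<And>A. A \<in> Obj C \<Longrightarrow> ar F (Id C A) = Id D (ob F A)"
    and "\<And>f g. f \<in> Arr C \<Longrightarrow> g \<in> Arr C \<Longrightarrow> Cod C f = Dom C g \<Longrightarrow>
      ar F (Comp C g f) = Comp D (ar F g) (ar F f)"
  shows "cat_functor C D F"
  using assms by (simp add: cat_functor_def cat_functor_axioms_def Hom_iff)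

lemma cat_functor_id: "category C \<Longrightarrow> cat_functor C C id_func"
  by (rule cat_functorI) auto

lemma cat_functor_op:
  assumes "cat_functor C D F"
  shows "cat_functor (op_cat C) (op_cat D) F"
proof -
  interpret cat_functor C D F by fact
  show ?thesis
    by (rule cat_functorI) (auto intro: category_op dom_cat.category_axioms cod_cat.category_axioms)
qed

lemma cat_functor_comp:
  assumes "cat_functor C D F" "cat_functor D E G"
  shows "cat_functor C E (G \<circ>\<^sub>F F)"
proof -
  interpret F: cat_functor C D F by fact
  interpret G: cat_functor D E G by fact
  show ?thesis
    by (rule cat_functorI) (auto intro: F.dom_cat.category_axioms G.cod_cat.category_axioms)
qed

lemma cat_functor_prod:
  assumes "cat_functor C D F" "cat_functor C' D' F'"
  shows "cat_functor (C \<times>\<^sub>C C') (D \<times>\<^sub>C D') (F \<times>\<^sub>F F')"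
proof -
  interpret F: cat_functor C D F by fact
  interpret F': cat_functor C' D' F' by fact
  show ?thesis
    by (rule cat_functorI) (auto intro!: category_prod F.dom_cat.category_axioms F'.dom_cat.category_axioms
      F.cod_cat.category_axioms F'.cod_cat.category_axioms)
qed

lemma cat_functor_fix_snd:
  assumes "cat_functor (C \<times>\<^sub>C D) E B" "category C" "category D" "X \<in> Obj D"
  shows "cat_functor C E (fix_snd D B X)"
proof -
  interpret B: cat_functor "C \<times>\<^sub>C D" E B by fact
  interpret C: category C by fact
  interpret D: category D by fact
  have "ar B (g \<cdot>\<^bsub>C\<^esub> f, Id D X) = ar B (g, Id D X) \<cdot>\<^bsub>E\<^esub> ar B (f, Id D X)"
    if "f \<in> Arr C" "g \<in> Arr C" "Cod C f = Dom C g" for f g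
    using B.ar_Comp_simp[of "(f, Id D X)" "(g, Id D X)"] that assms(4) by simp
  moreover have "ar B (Id C A, Id D X) = Id E (ob B (A, X))" if "A \<in> Obj C" for A
    using B.ar_Id[of "(A, X)"] that assms(4) by simp
  ultimately show ?thesis
    using assms(4) by (intro cat_functorI) (auto intro: assms B.cod_cat.category_axioms)
qed

context nat_trans
begin

lemma component_simps [simp]:
  assumes "A \<in> Obj C"
  shows "\<theta> A \<in> Arr D" "Dom D (\<theta> A) = ob F A" "Cod D (\<theta> A) = ob G A"
  using component[OF assms] by (simp_all add: Hom_iff)

text \<open>The object is tied to \<open>f\<close> by an equation, so the rule also fires when the
  component is written at another name of that object. \<open>naturality_Cod\<close> is the same
  square rewritten in the opposite direction.\<close>

lemma naturality_Dom:
  "f \<in> Arr C \<Longrightarrow> Dom C f = A \<Longrightarrow> ar G f \<cdot>\<^bsub>D\<^esub> \<theta> A = \<theta> (Cod C f) \<cdot>\<^bsub>D\<^esub> ar F f"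
  using naturality by (auto simp: Hom_iff)

lemma naturality_Cod:
  "f \<in> Arr C \<Longrightarrow> Cod C f = B \<Longrightarrow> \<theta> B \<cdot>\<^bsub>D\<^esub> ar F f = ar G f \<cdot>\<^bsub>D\<^esub> \<theta> (Dom C f)"
  using naturality by (auto simp: Hom_iff)

end

lemma nat_transI:
  assumes "cat_functor C D F" "cat_functor C D G"
    and "\<And>A. A \<in> Obj C \<Longrightarrow> \<theta> A \<in> Arr D \<and> Dom D (\<theta> A) = ob F A \<and> Cod D (\<theta> A) = ob G A"
    and "\<And>f. f \<in> Arr C \<Longrightarrow> Comp D (ar G f) (\<theta> (Dom C f)) = Comp D (\<theta> (Cod C f)) (ar F f)"
  shows "nat_trans C D F G \<theta>"
  using assms by (auto simp: nat_trans_def nat_trans_axioms_def Hom_iff)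

lemma nat_isoI:
  assumes "nat_trans C D F G \<theta>" "\<And>A. A \<in> Obj C \<Longrightarrow> iso_arr D (\<theta> A)"
  shows "nat_iso C D F G \<theta>"
  using assms by (auto simp: nat_iso_def nat_iso_axioms_def)

section \<open>Isomorphisms and their inverses\<close>

context category
begin

lemma inverse_arrows_iff:
  "inverse_arrows C f g \<longleftrightarrow> f \<in> Arr C \<and> g \<in> Arr C \<and> Dom C g = Cod C f \<and> Cod C g = Dom C f \<and>
    g \<cdot> f = Id C (Dom C f) \<and> f \<cdot> g = Id C (Cod C f)"
  by (auto simp: inverse_arrows_def Hom_iff)

lemma inverse_arrows_unique:
  assumes "inverse_arrows C f g" "inverse_arrows C f g'"
  shows "g = g'"
proof -
  have "g = (g' \<cdot> f) \<cdot> g" using assms unfolding inverse_arrows_iff by (metis Id_Comp_simp)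
  also have "\<dots> = g' \<cdot> (f \<cdot> g)" using assms by (intro assoc) (simp_all add: inverse_arrows_iff)
  also have "\<dots> = g'" using assms unfolding inverse_arrows_iff by (metis Comp_Id_simp)
  finally show ?thesis .
qed

lemma inv_arr_eq: "inverse_arrows C f g \<Longrightarrow> inv_arr C f = g"
  unfolding inv_arr_def using inverse_arrows_unique by blast

lemma inv_arr_simps [simp]:
  assumes "iso_arr C f"
  shows "inv_arr C f \<in> Arr C" "Dom C (inv_arr C f) = Cod C f" "Cod C (inv_arr C f) = Dom C f"
    "inv_arr C f \<cdot> f = Id C (Dom C f)" "f \<cdot> inv_arr C f = Id C (Cod C f)"
  using assms inv_arr_eq by (auto simp: iso_arr_def inverse_arrows_iff)

lemma iso_arr_Arr: "iso_arr C f \<Longrightarrow> f \<in> Arr C"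
  by (auto simp: iso_arr_def inverse_arrows_iff)

lemma inv_arr_tail [simp]:
  assumes "iso_arr C f" "x \<in> Arr C"
  shows "Cod C x = Dom C f \<Longrightarrow> inv_arr C f \<cdot> (f \<cdot> x) = x"
    "Cod C x = Cod C f \<Longrightarrow> f \<cdot> (inv_arr C f \<cdot> x) = x"
  using assms iso_arr_Arr[of f] tail[of "inv_arr C f" f "Id C (Dom C f)" x]
    tail[of f "inv_arr C f" "Id C (Cod C f)" x] by simp_all

lemma iso_arrI:
  "f \<in> Arr C \<Longrightarrow> g \<in> Arr C \<Longrightarrow> Dom C g = Cod C f \<Longrightarrow> Cod C g = Dom C f \<Longrightarrow>
    g \<cdot> f = Id C (Dom C f) \<Longrightarrow> f \<cdot> g = Id C (Cod C f) \<Longrightarrow> iso_arr C f"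
  by (auto simp: iso_arr_def inverse_arrows_iff)

lemma iso_arr_Id: "A \<in> Obj C \<Longrightarrow> iso_arr C (Id C A)"
  by (rule iso_arrI[of _ "Id C A"]) simp_all

lemma iso_arr_Comp: "iso_arr C f \<Longrightarrow> iso_arr C g \<Longrightarrow> Cod C f = Dom C g \<Longrightarrow> iso_arr C (g \<cdot> f)"
  by (rule iso_arrI[of _ "inv_arr C f \<cdot> inv_arr C g"]) (simp_all add: iso_arr_Arr)

lemma iso_arr_inv_arr: "iso_arr C f \<Longrightarrow> iso_arr C (inv_arr C f)"
  by (rule iso_arrI[of _ f]) (simp_all add: iso_arr_Arr)

lemma iso_cancel_left:
  assumes "iso_arr C f" "f \<cdot> x = f \<cdot> y" "x \<in> Arr C" "y \<in> Arr C" "Cod C x = Dom C f" "Cod C y = Dom C f"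
  shows "x = y"
  using assms inv_arr_tail(1)[of f] by metis

lemma iso_cancel_right:
  assumes "iso_arr C f" "x \<cdot> f = y \<cdot> f" "x \<in> Arr C" "y \<in> Arr C" "Dom C x = Cod C f" "Dom C y = Cod C f"
  shows "x = y"
proof -
  have "z = (z \<cdot> f) \<cdot> inv_arr C f" if "z \<in> Arr C" "Dom C z = Cod C f" for z
    using that assms(1) iso_arr_Arr[of f] by simp
  then show ?thesis using assms by metis
qed

text \<open>A commutative square with two parallel invertible sides stays commutative when both are
  inverted. This yields naturality of inverse components, the symmetry of the inverse of
  \<open>\<alpha>\<close>, and a step in the invertibility of \<open>th1\<close>.\<close>

lemma inv_arr_swap:
  assumes "iso_arr C a" "iso_arr C b" "b \<cdot> x = y \<cdot> a" "x \<in> Arr C" "y \<in> Arr C"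
    "Dom C x = Dom C a" "Cod C x = Dom C b" "Dom C y = Cod C a" "Cod C y = Cod C b"
  shows "inv_arr C b \<cdot> y = x \<cdot> inv_arr C a"
proof (rule iso_cancel_right[OF assms(1)])
  have "(inv_arr C b \<cdot> y) \<cdot> a = inv_arr C b \<cdot> (b \<cdot> x)"
    using assms iso_arr_Arr by simp
  also have "\<dots> = (x \<cdot> inv_arr C a) \<cdot> a"
    using assms(1,2,4-) iso_arr_Arr by simp
  finally show "(inv_arr C b \<cdot> y) \<cdot> a = (x \<cdot> inv_arr C a) \<cdot> a" .
qed (use assms iso_arr_Arr in simp_all)

lemma iso_arr_op: "iso_arr (op_cat C) f \<longleftrightarrow> iso_arr C f"
  unfolding iso_arr_def inverse_arrows_def by (auto simp: Hom_iff)

end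

lemma (in cat_functor) iso_arr_ar: "iso_arr C f \<Longrightarrow> iso_arr D (ar F f)"
  by (rule cod_cat.iso_arrI[of _ "ar F (inv_arr C f)"])
    (simp_all add: dom_cat.iso_arr_Arr ar_eq[of "inv_arr C f" f] ar_eq[of f "inv_arr C f"])

lemma (in nat_iso) naturality_inv:
  assumes "f \<in> Arr C"
  shows "inv_arr D (\<theta> (Cod C f)) \<cdot>\<^bsub>D\<^esub> ar G f = ar F f \<cdot>\<^bsub>D\<^esub> inv_arr D (\<theta> (Dom C f))"
  by (rule source.cod_cat.inv_arr_swap) (use assms component_iso in \<open>simp_all add: naturality_Dom\<close>)

section \<open>Transposition along an adjunction\<close>

context adjunction
begin

lemma triangle_left_simp [simp]:
  "A \<in> Obj C \<Longrightarrow> B = ob F A \<Longrightarrow> \<epsilon> B \<cdot>\<^bsub>D\<^esub> ar F (\<eta> A) = Id D (ob F A)"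
  using triangle_left by simp

lemma triangle_right_simp [simp]:
  "B \<in> Obj D \<Longrightarrow> A = ob G B \<Longrightarrow> ar G (\<epsilon> B) \<cdot>\<^bsub>C\<^esub> \<eta> A = Id C (ob G B)"
  using triangle_right by simp

lemma eta_naturality: "f \<in> Arr C \<Longrightarrow> Cod C f = B \<Longrightarrow> \<eta> B \<cdot>\<^bsub>C\<^esub> f = ar G (ar F f) \<cdot>\<^bsub>C\<^esub> \<eta> (Dom C f)"
  using unit.naturality_Cod by simp

lemma eps_naturality: "f \<in> Arr D \<Longrightarrow> Cod D f = B \<Longrightarrow> \<epsilon> B \<cdot>\<^bsub>D\<^esub> ar F (ar G f) = f \<cdot>\<^bsub>D\<^esub> \<epsilon> (Dom D f)"
  using counit.naturality_Cod by simp

text \<open>By naturality of the counit the composite becomes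
  \<open>k \<cdot> \<epsilon> \<cdot> F \<eta>\<close>, which the triangle identity collapses.
  Together with \<open>transpose_right\<close>, this makes the two transpositions mutually
  inverse.\<close>

lemma transpose_left:
  assumes "k \<in> Arr D" "Dom D k = ob F A" "A \<in> Obj C" "Cod D k = B"
  shows "\<epsilon> B \<cdot>\<^bsub>D\<^esub> ar F (ar G k \<cdot>\<^bsub>C\<^esub> \<eta> A) = k"
proof -
  have "B \<in> Obj D" using assms counit.source.dom_cat.Cod_Obj by blast
  then show ?thesis using assms by (simp add: counit.source.dom_cat.tail[OF eps_naturality])
qed

lemma transpose_right:
  assumes "h \<in> Arr C" "Dom C h = A" "Cod C h = ob G B" "B \<in> Obj D"
  shows "ar G (\<epsilon> B \<cdot>\<^bsub>D\<^esub> ar F h) \<cdot>\<^bsub>C\<^esub> \<eta> A = h"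
proof -
  have A: "A \<in> Obj C" using assms unit.source.dom_cat.Dom_Obj by blast
  have "ar G (\<epsilon> B \<cdot>\<^bsub>D\<^esub> ar F h) \<cdot>\<^bsub>C\<^esub> \<eta> A = ar G (\<epsilon> B) \<cdot>\<^bsub>C\<^esub> (\<eta> (ob G B) \<cdot>\<^bsub>C\<^esub> h)"
    using assms A by (simp add: eta_naturality)
  also have "\<dots> = h"
    using assms by (simp add: unit.source.dom_cat.tail[OF triangle_right])
  finally show ?thesis .
qed

text \<open>Injectivity of transposition: the way in which equations between arrows into an object
  \<open>G B\<close> are proved throughout.\<close>

lemma transpose_inject:
  assumes "\<epsilon> B \<cdot>\<^bsub>D\<^esub> ar F h = \<epsilon> B \<cdot>\<^bsub>D\<^esub> ar F h'" "h \<in> Arr C" "h' \<in> Arr C" "Dom C h = Dom C h'"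
    "Cod C h = ob G B" "Cod C h' = ob G B" "B \<in> Obj D"
  shows "h = h'"
  using transpose_right[of h "Dom C h" B] transpose_right[of h' "Dom C h" B] assms by simp

end

section \<open>Symmetric monoidal closed categories and their dualities\<close>

sublocale symmetric_monoidal_category \<subseteq> tensor: cat_functor "C \<times>\<^sub>C C" C "tensor M"
  by (rule tensor_functor)

sublocale symmetric_monoidal_category \<subseteq> symm: nat_iso "C \<times>\<^sub>C C" C "tensor M" "tensor M \<circ>\<^sub>F swap_func" "symm M"
  by (rule symm_iso)

sublocale symmetric_monoidal_closed_category \<subseteq> ihom: cat_functor "op_cat C \<times>\<^sub>C C" C "ihom M"
  by (rule ihom_functor)

context symmetric_monoidal_category
begin

lemma tensor_Id [simp]:
  "A \<in> Obj C \<Longrightarrow> B \<in> Obj C \<Longrightarrow> Id C A \<otimes>\<^sub>a\<^bsub>M\<^esub> Id C B = Id C (A \<otimes>\<^sub>o\<^bsub>M\<^esub> B)"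
  using tensor.ar_Id[of "(A, B)"] by simp

lemma tensor_Comp [simp]:
  "f \<in> Arr C \<Longrightarrow> f' \<in> Arr C \<Longrightarrow> g \<in> Arr C \<Longrightarrow> g' \<in> Arr C \<Longrightarrow> Cod C f = Dom C g \<Longrightarrow> Cod C f' = Dom C g' \<Longrightarrow>
    (g \<otimes>\<^sub>a\<^bsub>M\<^esub> g') \<cdot> (f \<otimes>\<^sub>a\<^bsub>M\<^esub> f') = (g \<cdot> f) \<otimes>\<^sub>a\<^bsub>M\<^esub> (g' \<cdot> f')"
  using tensor.ar_Comp_simp[of "(f, f')" "(g, g')"] by simp

lemma tensor_Comp_tail [simp]:
  "f \<in> Arr C \<Longrightarrow> f' \<in> Arr C \<Longrightarrow> g \<in> Arr C \<Longrightarrow> g' \<in> Arr C \<Longrightarrow> Cod C f = Dom C g \<Longrightarrow> Cod C f' = Dom C g' \<Longrightarrow>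
    x \<in> Arr C \<Longrightarrow> Cod C x = Dom C f \<otimes>\<^sub>o\<^bsub>M\<^esub> Dom C f' \<Longrightarrow>
    (g \<otimes>\<^sub>a\<^bsub>M\<^esub> g') \<cdot> ((f \<otimes>\<^sub>a\<^bsub>M\<^esub> f') \<cdot> x) = ((g \<cdot> f) \<otimes>\<^sub>a\<^bsub>M\<^esub> (g' \<cdot> f')) \<cdot> x"
  by (rule tail[OF tensor_Comp]) simp_all

lemma symm_naturality:
  "f \<in> Arr C \<Longrightarrow> g \<in> Arr C \<Longrightarrow> Cod C f = A \<Longrightarrow> Cod C g = B \<Longrightarrow>
    symm M (A, B) \<cdot> (f \<otimes>\<^sub>a\<^bsub>M\<^esub> g) = (g \<otimes>\<^sub>a\<^bsub>M\<^esub> f) \<cdot> symm M (Dom C f, Dom C g)"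
  using symm.naturality_Cod[of "(f, g)" "(A, B)"] by simp

end

section \<open>Evaluation calculus for the internal Hom\<close>

context symmetric_monoidal_closed_category
begin

lemma ihom_Comp [simp]:
  "f \<in> Arr C \<Longrightarrow> f' \<in> Arr C \<Longrightarrow> g \<in> Arr C \<Longrightarrow> g' \<in> Arr C \<Longrightarrow> Dom C f = Cod C g \<Longrightarrow> Cod C f' = Dom C g' \<Longrightarrow>
    (g \<leadsto>\<^sub>a\<^bsub>M\<^esub> g') \<cdot> (f \<leadsto>\<^sub>a\<^bsub>M\<^esub> f') = (f \<cdot> g) \<leadsto>\<^sub>a\<^bsub>M\<^esub> (g' \<cdot> f')"
  using ihom.ar_Comp_simp[of "(f, f')" "(g, g')"] by simp

lemma ihom_Comp_tail [simp]:
  "f \<in> Arr C \<Longrightarrow> f' \<in> Arr C \<Longrightarrow> g \<in> Arr C \<Longrightarrow> g' \<in> Arr C \<Longrightarrow> Dom C f = Cod C g \<Longrightarrow> Cod C f' = Dom C g' \<Longrightarrow>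
    x \<in> Arr C \<Longrightarrow> Cod C x = Cod C f \<leadsto>\<^sub>o\<^bsub>M\<^esub> Dom C f' \<Longrightarrow>
    (g \<leadsto>\<^sub>a\<^bsub>M\<^esub> g') \<cdot> ((f \<leadsto>\<^sub>a\<^bsub>M\<^esub> f') \<cdot> x) = ((f \<cdot> g) \<leadsto>\<^sub>a\<^bsub>M\<^esub> (g' \<cdot> f')) \<cdot> x"
  by (rule tail[OF ihom_Comp]) simp_all

lemma ev_simps [simp]:
  assumes "X \<in> Obj C" "A \<in> Obj C"
  shows "ev M X A \<in> Arr C" "Dom C (ev M X A) = (X \<leadsto>\<^sub>o\<^bsub>M\<^esub> A) \<otimes>\<^sub>o\<^bsub>M\<^esub> X" "Cod C (ev M X A) = A"
proof -
  interpret adjunction C C "fix_snd C (tensor M) X" "fix_fst C (ihom M) X" "coev M X" "ev M X"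
    by (rule tensor_ihom_adjunction) fact
  show "ev M X A \<in> Arr C" "Dom C (ev M X A) = (X \<leadsto>\<^sub>o\<^bsub>M\<^esub> A) \<otimes>\<^sub>o\<^bsub>M\<^esub> X" "Cod C (ev M X A) = A"
    using assms by simp_all
qed

lemma coev_simps [simp]:
  assumes "X \<in> Obj C" "A \<in> Obj C"
  shows "coev M X A \<in> Arr C" "Dom C (coev M X A) = A" "Cod C (coev M X A) = X \<leadsto>\<^sub>o\<^bsub>M\<^esub> (A \<otimes>\<^sub>o\<^bsub>M\<^esub> X)"
proof -
  interpret adjunction C C "fix_snd C (tensor M) X" "fix_fst C (ihom M) X" "coev M X" "ev M X"
    by (rule tensor_ihom_adjunction) fact
  show "coev M X A \<in> Arr C" "Dom C (coev M X A) = A" "Cod C (coev M X A) = X \<leadsto>\<^sub>o\<^bsub>M\<^esub> (A \<otimes>\<^sub>o\<^bsub>M\<^esub> X)"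
    using assms by simp_all
qed

text \<open>An arrow into \<open>[X, A]\<close> is determined by its evaluation, by
  \<open>transpose_inject\<close> for the adjunction of tensoring with \<open>X\<close>.\<close>

lemma ihom_eqI:
  assumes "ev M X A \<cdot> (h \<otimes>\<^sub>a\<^bsub>M\<^esub> Id C X) = ev M X A \<cdot> (h' \<otimes>\<^sub>a\<^bsub>M\<^esub> Id C X)"
    and "h \<in> Arr C" "h' \<in> Arr C" "Dom C h = Dom C h'" "Cod C h = X \<leadsto>\<^sub>o\<^bsub>M\<^esub> A" "Cod C h' = X \<leadsto>\<^sub>o\<^bsub>M\<^esub> A"
    and "X \<in> Obj C" "A \<in> Obj C"
  shows "h = h'"
proof -
  interpret adjunction C C "fix_snd C (tensor M) X" "fix_fst C (ihom M) X" "coev M X" "ev M X"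
    by (rule tensor_ihom_adjunction) fact
  show ?thesis
    by (rule transpose_inject[of A]) (use assms in simp_all)
qed

text \<open>Naturality of evaluation in the target and extranaturality in \<open>X\<close>, merged
  into one rule: \<open>g\<close> comes out in front while \<open>f\<close> crosses the tensor
  product to the second factor, where it meets \<open>k\<close>.\<close>

lemma ev_ihom:
  assumes "f \<in> Arr C" "g \<in> Arr C" "k \<in> Arr C" "Dom C f = X" "Cod C g = B" "Cod C k = X"
  shows "ev M X B \<cdot> ((f \<leadsto>\<^sub>a\<^bsub>M\<^esub> g) \<otimes>\<^sub>a\<^bsub>M\<^esub> k) =
    g \<cdot> (ev M (Cod C f) (Dom C g) \<cdot> (Id C (Cod C f \<leadsto>\<^sub>o\<^bsub>M\<^esub> Dom C g) \<otimes>\<^sub>a\<^bsub>M\<^esub> (f \<cdot> k)))"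
proof -
  have X: "X \<in> Obj C" and B: "B \<in> Obj C" using assms by auto
  interpret adj: adjunction C C "fix_snd C (tensor M) X" "fix_fst C (ihom M) X" "coev M X" "ev M X"
    by (rule tensor_ihom_adjunction) fact
  let ?Y = "Cod C f" and ?A = "Dom C g"
  have "ev M X B \<cdot> ((f \<leadsto>\<^sub>a\<^bsub>M\<^esub> g) \<otimes>\<^sub>a\<^bsub>M\<^esub> k) =
    ev M X B \<cdot> (((Id C X \<leadsto>\<^sub>a\<^bsub>M\<^esub> g) \<otimes>\<^sub>a\<^bsub>M\<^esub> Id C X) \<cdot> (((f \<leadsto>\<^sub>a\<^bsub>M\<^esub> Id C ?A) \<otimes>\<^sub>a\<^bsub>M\<^esub> Id C X) \<cdot> (Id C (?Y \<leadsto>\<^sub>o\<^bsub>M\<^esub> ?A) \<otimes>\<^sub>a\<^bsub>M\<^esub> k)))"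
    using assms X B by simp
  also have "\<dots> = (ev M X B \<cdot> ((Id C X \<leadsto>\<^sub>a\<^bsub>M\<^esub> g) \<otimes>\<^sub>a\<^bsub>M\<^esub> Id C X)) \<cdot> (((f \<leadsto>\<^sub>a\<^bsub>M\<^esub> Id C ?A) \<otimes>\<^sub>a\<^bsub>M\<^esub> Id C X) \<cdot> (Id C (?Y \<leadsto>\<^sub>o\<^bsub>M\<^esub> ?A) \<otimes>\<^sub>a\<^bsub>M\<^esub> k))"
    using assms X B by simp
  also have "ev M X B \<cdot> ((Id C X \<leadsto>\<^sub>a\<^bsub>M\<^esub> g) \<otimes>\<^sub>a\<^bsub>M\<^esub> Id C X) = g \<cdot> ev M X ?A"
    using adj.eps_naturality[of g B] assms by simp
  also have "(g \<cdot> ev M X ?A) \<cdot> (((f \<leadsto>\<^sub>a\<^bsub>M\<^esub> Id C ?A) \<otimes>\<^sub>a\<^bsub>M\<^esub> Id C X) \<cdot> (Id C (?Y \<leadsto>\<^sub>o\<^bsub>M\<^esub> ?A) \<otimes>\<^sub>a\<^bsub>M\<^esub> k)) =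
    g \<cdot> ((ev M X ?A \<cdot> ((f \<leadsto>\<^sub>a\<^bsub>M\<^esub> Id C ?A) \<otimes>\<^sub>a\<^bsub>M\<^esub> Id C X)) \<cdot> (Id C (?Y \<leadsto>\<^sub>o\<^bsub>M\<^esub> ?A) \<otimes>\<^sub>a\<^bsub>M\<^esub> k))"
    using assms X B by simp
  also have "ev M X ?A \<cdot> ((f \<leadsto>\<^sub>a\<^bsub>M\<^esub> Id C ?A) \<otimes>\<^sub>a\<^bsub>M\<^esub> Id C X) = ev M ?Y ?A \<cdot> (Id C (?Y \<leadsto>\<^sub>o\<^bsub>M\<^esub> ?A) \<otimes>\<^sub>a\<^bsub>M\<^esub> f)"
    by (rule ev_natural) (use assms in \<open>simp_all add: Hom_iff\<close>)
  finally show ?thesis using assms X B by simp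
qed

text \<open>A composite inside the first tensor factor would hide the pattern of
  \<open>ev_ihom\<close>; splitting off \<open>h\<close> beforehand reduces to that rule.\<close>

lemma ev_ihom_Comp:
  assumes "f \<in> Arr C" "g \<in> Arr C" "k \<in> Arr C" "h \<in> Arr C" "Dom C f = X" "Cod C g = B" "Cod C k = X"
    "Cod C h = Cod C f \<leadsto>\<^sub>o\<^bsub>M\<^esub> Dom C g"
  shows "ev M X B \<cdot> (((f \<leadsto>\<^sub>a\<^bsub>M\<^esub> g) \<cdot> h) \<otimes>\<^sub>a\<^bsub>M\<^esub> k) = g \<cdot> (ev M (Cod C f) (Dom C g) \<cdot> (h \<otimes>\<^sub>a\<^bsub>M\<^esub> (f \<cdot> k)))"
proof -
  have X: "X \<in> Obj C" and B: "B \<in> Obj C" using assms by auto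
  have "ev M X B \<cdot> (((f \<leadsto>\<^sub>a\<^bsub>M\<^esub> g) \<cdot> h) \<otimes>\<^sub>a\<^bsub>M\<^esub> k) =
    ev M X B \<cdot> (((f \<leadsto>\<^sub>a\<^bsub>M\<^esub> g) \<otimes>\<^sub>a\<^bsub>M\<^esub> k) \<cdot> (h \<otimes>\<^sub>a\<^bsub>M\<^esub> Id C (Dom C k)))"
    using assms X B by simp
  also have "\<dots> = g \<cdot> (ev M (Cod C f) (Dom C g) \<cdot> (h \<otimes>\<^sub>a\<^bsub>M\<^esub> (f \<cdot> k)))"
    by (subst tail[OF ev_ihom]) (use assms X B in simp_all)
  finally show ?thesis .
qed

lemma ev_coev:
  assumes "X \<in> Obj C" "h \<in> Arr C" "k \<in> Arr C" "Cod C h = A" "Cod C k = X"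
  shows "ev M X (A \<otimes>\<^sub>o\<^bsub>M\<^esub> X) \<cdot> ((coev M X A \<cdot> h) \<otimes>\<^sub>a\<^bsub>M\<^esub> k) = h \<otimes>\<^sub>a\<^bsub>M\<^esub> k"
proof -
  have A: "A \<in> Obj C" using assms by auto
  interpret adj: adjunction C C "fix_snd C (tensor M) X" "fix_fst C (ihom M) X" "coev M X" "ev M X"
    by (rule tensor_ihom_adjunction) fact
  have eq: "ev M X (A \<otimes>\<^sub>o\<^bsub>M\<^esub> X) \<cdot> (coev M X A \<otimes>\<^sub>a\<^bsub>M\<^esub> Id C X) = Id C (A \<otimes>\<^sub>o\<^bsub>M\<^esub> X)"
    using adj.triangle_left[of A] A by simp
  have "ev M X (A \<otimes>\<^sub>o\<^bsub>M\<^esub> X) \<cdot> ((coev M X A \<cdot> h) \<otimes>\<^sub>a\<^bsub>M\<^esub> k) =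
    ev M X (A \<otimes>\<^sub>o\<^bsub>M\<^esub> X) \<cdot> ((coev M X A \<otimes>\<^sub>a\<^bsub>M\<^esub> Id C X) \<cdot> (h \<otimes>\<^sub>a\<^bsub>M\<^esub> k))"
    using assms A by simp
  also have "\<dots> = h \<otimes>\<^sub>a\<^bsub>M\<^esub> k"
    by (subst tail[OF eq]) (use assms A in simp_all)
  finally show ?thesis .
qed

text \<open>The bidual map is the transpose of \<open>ev_r\<close>, so evaluating it exchanges the
  argument and the functional; naturality of the symmetry then moves \<open>h\<close> and
  \<open>k\<close> in front of it.\<close>

lemma ev_bidual_map:
  assumes "A \<in> Obj C" "K \<in> Obj C" "h \<in> Arr C" "k \<in> Arr C" "Cod C h = A" "Cod C k = A \<leadsto>\<^sub>o\<^bsub>M\<^esub> K"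
  shows "ev M (A \<leadsto>\<^sub>o\<^bsub>M\<^esub> K) K \<cdot> ((bidual_map C M K A \<cdot> h) \<otimes>\<^sub>a\<^bsub>M\<^esub> k) =
    ev M A K \<cdot> ((k \<otimes>\<^sub>a\<^bsub>M\<^esub> h) \<cdot> symm M (Dom C h, Dom C k))"
  using assms by (simp add: bidual_map_def ev_r_def ev_ihom_Comp ev_coev symm_naturality)

lemma ev_bidual_map_Id:
  assumes "A \<in> Obj C" "K \<in> Obj C" "k \<in> Arr C" "Cod C k = A \<leadsto>\<^sub>o\<^bsub>M\<^esub> K"
  shows "ev M (A \<leadsto>\<^sub>o\<^bsub>M\<^esub> K) K \<cdot> (bidual_map C M K A \<otimes>\<^sub>a\<^bsub>M\<^esub> k) =
    ev M A K \<cdot> ((k \<otimes>\<^sub>a\<^bsub>M\<^esub> Id C A) \<cdot> symm M (A, Dom C k))"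
  using ev_bidual_map[of A K "Id C A" k] assms by (simp add: bidual_map_def ev_r_def)

lemma bidual_map_simps [simp]:
  assumes "A \<in> Obj C" "K \<in> Obj C"
  shows "bidual_map C M K A \<in> Arr C" "Dom C (bidual_map C M K A) = A"
    "Cod C (bidual_map C M K A) = (A \<leadsto>\<^sub>o\<^bsub>M\<^esub> K) \<leadsto>\<^sub>o\<^bsub>M\<^esub> K"
  using assms by (simp_all add: bidual_map_def ev_r_def)

lemma dual_simps [simp]:
  "ob (dual C M K) A = A \<leadsto>\<^sub>o\<^bsub>M\<^esub> K" "ar (dual C M K) f = f \<leadsto>\<^sub>a\<^bsub>M\<^esub> Id C K"
  by (simp_all add: dual_def)

lemma dual_functor:
  assumes "K \<in> Obj C"
  shows "cat_functor (op_cat C) C (dual C M K)"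
  unfolding dual_def
  by (rule cat_functor_fix_snd) (use assms category_axioms category_op ihom_functor in auto)

lemma category_with_duality_dual:
  assumes K: "K \<in> Obj C"
  shows "category_with_duality C (dual C M K) (bidual_map C M K)"
proof -
  have D: "cat_functor C (op_cat C) (dual C M K)"
    using cat_functor_op[OF dual_functor[OF K]] by simp
  \<comment> \<open>Evaluated at the dual of \<open>Cod C f\<close>, both sides become evaluation
    after \<open>id \<otimes> f\<close> and the symmetry.\<close>
  have "((f \<leadsto>\<^sub>a\<^bsub>M\<^esub> Id C K) \<leadsto>\<^sub>a\<^bsub>M\<^esub> Id C K) \<cdot> bidual_map C M K (Dom C f) = bidual_map C M K (Cod C f) \<cdot> f"
    if "f \<in> Arr C" for f
    by (rule ihom_eqI[of "Cod C f \<leadsto>\<^sub>o\<^bsub>M\<^esub> K" K])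
      (use that K in \<open>simp_all add: ev_ihom_Comp ev_ihom ev_bidual_map ev_bidual_map_Id tail[OF ev_ihom]\<close>)
  then have "nat_trans C C id_func (dual C M K \<circ>\<^sub>F dual C M K) (bidual_map C M K)"
    using K by (intro nat_transI cat_functor_id cat_functor_comp[OF D dual_functor]) (auto intro: category_axioms)
  then show ?thesis using D by (simp add: category_with_duality_def)
qed

end

section \<open>Suspended functors\<close>

context suspended_category
begin

declare Susp_Desusp_ob [simp] Desusp_Susp_ob [simp] Susp_Desusp_ar [simp] Desusp_Susp_ar [simp]

lemma Susp_inject:
  assumes "ar (Susp S) f = ar (Susp S) g" "f \<in> Arr C" "g \<in> Arr C"
  shows "f = g"
  using assms Desusp_Susp_ar by metis

lemma Desusp_inject:
  assumes "ar (Desusp S) f = ar (Desusp S) g" "f \<in> Arr C" "g \<in> Arr C"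
  shows "f = g"
  using assms Susp_Desusp_ar by metis

end

lemma additive_category_op:
  assumes "additive_category C S"
  shows "additive_category (op_cat C) (op_susp S)"
proof -
  interpret additive_category C S by fact
  have H: "Hom (op_cat C) A B = Hom C B A" for A B
    by (auto simp: Hom_iff)
  have G: "Hom_group (op_cat C) (op_susp S) A B = Hom_group C S B A" for A B
    by (simp add: Hom_group_def H)
  have Z: "zero_object (op_cat C) (op_susp S) A = zero_object C S A" for A
    by (simp add: zero_object_def)
  show ?thesis
  proof (intro additive_category.intro additive_category_axioms.intro)
    show "category (op_cat C)" by (rule category_op) (rule category_axioms)
  next
    fix A B assume "A \<in> Obj (op_cat C)" "B \<in> Obj (op_cat C)"
    then show "comm_group (Hom_group (op_cat C) (op_susp S) A B)"
      by (simp add: G Hom_comm_group)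
    obtain P i1 i2 p1 p2 where "P \<in> Obj C" "i1 \<in> Hom C A P" "i2 \<in> Hom C B P" "p1 \<in> Hom C P A" "p2 \<in> Hom C P B"
      "p1 \<cdot>\<^bsub>C\<^esub> i1 = Id C A" "p2 \<cdot>\<^bsub>C\<^esub> i2 = Id C B" "p1 \<cdot>\<^bsub>C\<^esub> i2 = Zero S B A" "p2 \<cdot>\<^bsub>C\<^esub> i1 = Zero S A B"
      "Add S (i1 \<cdot>\<^bsub>C\<^esub> p1) (i2 \<cdot>\<^bsub>C\<^esub> p2) = Id C P"
      using ex_biproduct[of A B] \<open>A \<in> Obj (op_cat C)\<close> \<open>B \<in> Obj (op_cat C)\<close>
      unfolding op_cat_simps by blast
    \<comment> \<open>The same biproduct serves, its projections and inclusions exchanging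
      roles.\<close>
    then show "\<exists>P \<in> Obj (op_cat C). \<exists>i1 \<in> Hom (op_cat C) A P. \<exists>i2 \<in> Hom (op_cat C) B P.
        \<exists>p1 \<in> Hom (op_cat C) P A. \<exists>p2 \<in> Hom (op_cat C) P B.
        p1 \<cdot>\<^bsub>op_cat C\<^esub> i1 = Id (op_cat C) A \<and> p2 \<cdot>\<^bsub>op_cat C\<^esub> i2 = Id (op_cat C) B \<and>
        p1 \<cdot>\<^bsub>op_cat C\<^esub> i2 = Zero (op_susp S) B A \<and> p2 \<cdot>\<^bsub>op_cat C\<^esub> i1 = Zero (op_susp S) A B \<and>
        Add (op_susp S) (i1 \<cdot>\<^bsub>op_cat C\<^esub> p1) (i2 \<cdot>\<^bsub>op_cat C\<^esub> p2) = Id (op_cat C) P"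
      unfolding H op_cat_simps op_susp_simps
      by blast
  qed (use Comp_Add Add_Comp ex_zero_object in \<open>auto simp: H Z\<close>)
qed

lemma suspended_category_op:
  assumes "suspended_category C S"
  shows "suspended_category (op_cat C) (op_susp S)"
proof -
  interpret suspended_category C S by fact
  have "additive_category (op_cat C) (op_susp S)"
    by (rule additive_category_op) (rule additive_category_axioms)
  moreover have "cat_functor (op_cat C) (op_cat C) (Susp S)" "cat_functor (op_cat C) (op_cat C) (Desusp S)"
    by (rule cat_functor_op, rule susp.cat_functor_axioms, rule cat_functor_op, rule desusp.cat_functor_axioms)
  ultimately show ?thesis
    by (simp add: suspended_category_def suspended_category_axioms_def)
qed

lemma suspended_functorI:
  assumes "suspended_category C S" "suspended_category C' S'" "cat_functor C C' F"
    and "\<And>A. A \<in> Obj C \<Longrightarrow> iso_arr C' (\<phi> A) \<and> Dom C' (\<phi> A) = ob F (ob (Susp S) A) \<and>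
      Cod C' (\<phi> A) = ob (Susp S') (ob F A)"
    and "\<And>f. f \<in> Arr C \<Longrightarrow> Comp C' (ar (Susp S') (ar F f)) (\<phi> (Dom C f)) =
      Comp C' (\<phi> (Cod C f)) (ar F (ar (Susp S) f))"
  shows "suspended_functor C S C' S' F \<phi>"
proof -
  interpret source: suspended_category C S by fact
  interpret target: suspended_category C' S' by fact
  have "nat_iso C C' (F \<circ>\<^sub>F Susp S) (Susp S' \<circ>\<^sub>F F) \<phi>"
    by (intro nat_isoI nat_transI cat_functor_comp[OF source.susp.cat_functor_axioms assms(3)]
        cat_functor_comp[OF assms(3) target.susp.cat_functor_axioms])
      (use assms(4,5) target.iso_arr_Arr in simp_all)
  then show ?thesis using assms(1-3) by (simp add: suspended_functor_def)
qed

context suspended_functor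
begin

lemma structure_iso_arr [simp]: "A \<in> Obj C \<Longrightarrow> iso_arr C' (\<phi> A)"
  by (rule structure_iso.component_iso)

lemma structure_naturality:
  "f \<in> Arr C \<Longrightarrow> Cod C f = A \<Longrightarrow>
    \<phi> A \<cdot>\<^bsub>C'\<^esub> ar F (ar (Susp S) f) = ar (Susp S') (ar F f) \<cdot>\<^bsub>C'\<^esub> \<phi> (Dom C f)"
  using structure_iso.naturality_Cod by simp

end

lemma suspended_functor_id:
  assumes "suspended_category C S"
  shows "suspended_functor C S C S id_func (id_susp C S)"
proof -
  interpret suspended_category C S by fact
  show ?thesis
    by (rule suspended_functorI)
      (use suspended_category_axioms cat_functor_id category_axioms in \<open>auto simp: id_susp_def intro!: iso_arr_Id\<close>)
qed

lemma suspended_functor_comp: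
  assumes "suspended_functor C S C' S' F \<phi>" "suspended_functor C' S' C'' S'' G \<gamma>"
  shows "suspended_functor C S C'' S'' (G \<circ>\<^sub>F F) (comp_susp C'' G \<gamma> F \<phi>)"
proof -
  interpret F: suspended_functor C S C' S' F \<phi> by fact
  interpret G: suspended_functor C' S' C'' S'' G \<gamma> by fact
  have "ar (Susp S'') (ar G (ar F f)) \<cdot>\<^bsub>C''\<^esub> (\<gamma> (ob F (Dom C f)) \<cdot>\<^bsub>C''\<^esub> ar G (\<phi> (Dom C f))) =
      (\<gamma> (ob F (Cod C f)) \<cdot>\<^bsub>C''\<^esub> ar G (\<phi> (Cod C f))) \<cdot>\<^bsub>C''\<^esub> ar G (ar F (ar (Susp S) f))"
    if f: "f \<in> Arr C" for f
  proof -
    have "\<gamma> (ob F (Cod C f)) \<cdot>\<^bsub>C''\<^esub> (ar G (\<phi> (Cod C f)) \<cdot>\<^bsub>C''\<^esub> ar G (ar F (ar (Susp S) f))) =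
        \<gamma> (ob F (Cod C f)) \<cdot>\<^bsub>C''\<^esub> (ar G (ar (Susp S') (ar F f)) \<cdot>\<^bsub>C''\<^esub> ar G (\<phi> (Dom C f)))"
      using f G.ar_eq[OF F.structure_naturality[OF f]] by simp
    then show ?thesis
      using f by (simp add: G.target.tail[OF G.structure_naturality])
  qed
  then show ?thesis
    by (intro suspended_functorI)
      (auto simp: comp_susp_def intro!: F.source.suspended_category_axioms G.target.suspended_category_axioms
        cat_functor_comp F.cat_functor_axioms G.cat_functor_axioms G.target.iso_arr_Comp G.iso_arr_ar)
qed

text \<open>Naturality of the opposite structure at \<open>f\<close> is that of
  \<open>\<phi>\<close> at the desuspension of \<open>f\<close>, with \<open>T^-\<close> of the
  target applied to it.\<close>

lemma suspended_functor_op: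
  assumes "suspended_functor C S C' S' F \<phi>"
  shows "suspended_functor (op_cat C) (op_susp S) (op_cat C') (op_susp S') F (opposite_susp S S' \<phi>)"
proof -
  interpret suspended_functor C S C' S' F \<phi> by fact
  have "ar (Desusp S') (\<phi> (ob (Desusp S) (Cod C f))) \<cdot>\<^bsub>C'\<^esub> ar (Desusp S') (ar F f) =
      ar F (ar (Desusp S) f) \<cdot>\<^bsub>C'\<^esub> ar (Desusp S') (\<phi> (ob (Desusp S) (Dom C f)))" if f: "f \<in> Arr C" for f
    using f target.desusp.ar_eq[OF structure_naturality[of "ar (Desusp S) f"]] by simp
  then show ?thesis
    by (intro suspended_functorI)
      (auto simp: opposite_susp_def target.iso_arr_op
        intro!: suspended_category_op source.suspended_category_axioms target.suspended_category_axioms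
        cat_functor_op cat_functor_axioms target.desusp.iso_arr_ar)
qed

lemma suspended_morphismI:
  assumes "suspended_functor C S C' S' F \<phi>" "suspended_functor C S C' S' G \<gamma>" "nat_trans C C' F G \<theta>"
    and "\<And>A. A \<in> Obj C \<Longrightarrow> Comp C' (ar (Susp S') (\<theta> A)) (\<phi> A) = Comp C' (\<gamma> A) (\<theta> (ob (Susp S) A))"
  shows "suspended_morphism C S C' S' F \<phi> G \<gamma> \<theta>"
  using assms by (simp add: suspended_morphism_def suspended_morphism_axioms_def)

section \<open>The suspended structure of a right adjoint\<close>

locale suspended_adjunction =
  adjunction C D F G \<eta> \<epsilon> + left_susp: suspended_functor C S D R F \<phi>
  for C :: "('o, 'a) cat" and S and D :: "('p, 'b) cat" and R F \<phi> G \<eta> \<epsilon>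
begin

text \<open>
  An arrow \<open>h\<close> from \<open>Z\<close> to \<open>T (G B)\<close> is determined by the arrow \<open>T (\<epsilon> B) \<cdot> \<phi> \<cdot> F h\<close> from \<open>F Z\<close> to \<open>T B\<close>.
\<close>

lemma susp_transpose:
  assumes "h \<in> Arr C" "Cod C h = ob (Susp S) (ob G B)" "B \<in> Obj D"
  shows "ar (Susp R) (\<epsilon> B) \<cdot>\<^bsub>D\<^esub> (\<phi> (ob G B) \<cdot>\<^bsub>D\<^esub> ar F h) =
    ar (Susp R) (\<epsilon> B \<cdot>\<^bsub>D\<^esub> ar F (ar (Desusp S) h)) \<cdot>\<^bsub>D\<^esub> \<phi> (ob (Desusp S) (Dom C h))"
  using assms left_susp.structure_naturality[of "ar (Desusp S) h"] by simp

text \<open>By \<open>susp_transpose\<close>, the two transposes are suspensions of ordinary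
  transposes composed with the same isomorphism \<open>\<phi>\<close>. Cancelling it and
  desuspending leaves the injectivity of ordinary transposition.\<close>

lemma susp_transpose_inject:
  assumes "ar (Susp R) (\<epsilon> B) \<cdot>\<^bsub>D\<^esub> (\<phi> (ob G B) \<cdot>\<^bsub>D\<^esub> ar F h) = ar (Susp R) (\<epsilon> B) \<cdot>\<^bsub>D\<^esub> (\<phi> (ob G B) \<cdot>\<^bsub>D\<^esub> ar F h')"
    and h: "h \<in> Arr C" "h' \<in> Arr C" "Dom C h = Dom C h'" "Cod C h = ob (Susp S) (ob G B)"
      "Cod C h' = ob (Susp S) (ob G B)"
    and B: "B \<in> Obj D"
  shows "h = h'"
proof (rule left_susp.source.Desusp_inject[OF transpose_inject[of B]])
  show "\<epsilon> B \<cdot>\<^bsub>D\<^esub> ar F (ar (Desusp S) h) = \<epsilon> B \<cdot>\<^bsub>D\<^esub> ar F (ar (Desusp S) h')"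
  proof (rule left_susp.target.Susp_inject, rule counit.source.dom_cat.iso_cancel_right)
    show "iso_arr D (\<phi> (ob (Desusp S) (Dom C h)))" using h by simp
    show "ar (Susp R) (\<epsilon> B \<cdot>\<^bsub>D\<^esub> ar F (ar (Desusp S) h)) \<cdot>\<^bsub>D\<^esub> \<phi> (ob (Desusp S) (Dom C h)) =
        ar (Susp R) (\<epsilon> B \<cdot>\<^bsub>D\<^esub> ar F (ar (Desusp S) h')) \<cdot>\<^bsub>D\<^esub> \<phi> (ob (Desusp S) (Dom C h))"
      using assms(1) susp_transpose[of h B] susp_transpose[of h' B] h B by metis
  qed (use h B in simp_all)
qed (use h B in simp_all)

lemma susp_transpose_surj:
  assumes m: "m \<in> Arr D" "Dom D m = ob F Z" "Cod D m = ob (Susp R) B" and Z: "Z \<in> Obj C" and B: "B \<in> Obj D"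
  obtains h where "h \<in> Arr C" "Dom C h = Z" "Cod C h = ob (Susp S) (ob G B)"
    "ar (Susp R) (\<epsilon> B) \<cdot>\<^bsub>D\<^esub> (\<phi> (ob G B) \<cdot>\<^bsub>D\<^esub> ar F h) = m"
proof -
  let ?Z = "ob (Desusp S) Z"
  \<comment> \<open>Removing \<open>\<phi>\<close> from \<open>m\<close> and desuspending leaves an
    arrow into \<open>B\<close>, which transposes to \<open>?h0\<close>; the suspension of
    \<open>?h0\<close> is the witness.\<close>
  let ?k = "ar (Desusp R) (m \<cdot>\<^bsub>D\<^esub> inv_arr D (\<phi> ?Z))"
  let ?h0 = "ar G ?k \<cdot>\<^bsub>C\<^esub> \<eta> ?Z"
  have k: "?k \<in> Arr D" "Dom D ?k = ob F ?Z" "Cod D ?k = B" using m Z B by simp_all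
  have h0: "?h0 \<in> Arr C" "Dom C ?h0 = ?Z" "Cod C ?h0 = ob G B" using k Z by simp_all
  have "\<epsilon> B \<cdot>\<^bsub>D\<^esub> ar F ?h0 = ?k"
    by (rule transpose_left) (use k Z in simp_all)
  then have "ar (Susp R) (\<epsilon> B) \<cdot>\<^bsub>D\<^esub> (\<phi> (ob G B) \<cdot>\<^bsub>D\<^esub> ar F (ar (Susp S) ?h0)) = ar (Susp R) ?k \<cdot>\<^bsub>D\<^esub> \<phi> ?Z"
    using susp_transpose[of "ar (Susp S) ?h0" B] h0 B Z
    by (simp del: left_susp.source.susp.ar_Comp_simp left.ar_Comp_simp right.ar_Comp_simp)
  also have "\<dots> = m" using m Z B by simp
  finally show ?thesis
    using h0 Z by (intro that[of "ar (Susp S) ?h0"]) (simp_all del: left_susp.source.susp.ar_Comp_simp)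
qed

text \<open>The equation is the compatibility of the counit with the suspensions, and by
  \<open>susp_transpose_inject\<close> it has a single solution. Restriction to the objects is what
  makes the family equal to the one selected by \<open>right_adjoint_susp\<close>.\<close>

definition right_susp :: "'p \<Rightarrow> 'a" where
  "right_susp = restrict (\<lambda>B. SOME h. h \<in> Arr C \<and> Dom C h = ob G (ob (Susp R) B) \<and> Cod C h = ob (Susp S) (ob G B) \<and>
    ar (Susp R) (\<epsilon> B) \<cdot>\<^bsub>D\<^esub> (\<phi> (ob G B) \<cdot>\<^bsub>D\<^esub> ar F h) = \<epsilon> (ob (Susp R) B)) (Obj D)"

lemma right_susp_characterization:
  assumes B: "B \<in> Obj D"
  shows "right_susp B \<in> Arr C \<and> Dom C (right_susp B) = ob G (ob (Susp R) B) \<and>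
    Cod C (right_susp B) = ob (Susp S) (ob G B) \<and>
    ar (Susp R) (\<epsilon> B) \<cdot>\<^bsub>D\<^esub> (\<phi> (ob G B) \<cdot>\<^bsub>D\<^esub> ar F (right_susp B)) = \<epsilon> (ob (Susp R) B)"
proof -
  obtain h where "h \<in> Arr C" "Dom C h = ob G (ob (Susp R) B)" "Cod C h = ob (Susp S) (ob G B)"
    "ar (Susp R) (\<epsilon> B) \<cdot>\<^bsub>D\<^esub> (\<phi> (ob G B) \<cdot>\<^bsub>D\<^esub> ar F h) = \<epsilon> (ob (Susp R) B)"
    by (rule susp_transpose_surj[of "\<epsilon> (ob (Susp R) B)" "ob G (ob (Susp R) B)" B]) (use B in simp_all)
  then show ?thesis
    using B unfolding right_susp_def by (simp, intro someI) auto
qed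

lemma right_susp_simps [simp]:
  assumes "B \<in> Obj D"
  shows "right_susp B \<in> Arr C" "Dom C (right_susp B) = ob G (ob (Susp R) B)"
    "Cod C (right_susp B) = ob (Susp S) (ob G B)"
    "ar (Susp R) (\<epsilon> B) \<cdot>\<^bsub>D\<^esub> (\<phi> (ob G B) \<cdot>\<^bsub>D\<^esub> ar F (right_susp B)) = \<epsilon> (ob (Susp R) B)"
  using right_susp_characterization[OF assms] by simp_all

lemma right_susp_tail [simp]:
  assumes "B \<in> Obj D" "x \<in> Arr D" "Cod D x = ob F (ob G (ob (Susp R) B))"
  shows "ar (Susp R) (\<epsilon> B) \<cdot>\<^bsub>D\<^esub> (\<phi> (ob G B) \<cdot>\<^bsub>D\<^esub> (ar F (right_susp B) \<cdot>\<^bsub>D\<^esub> x)) = \<epsilon> (ob (Susp R) B) \<cdot>\<^bsub>D\<^esub> x"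
  using counit.source.dom_cat.tail[OF right_susp_simps(4)[OF assms(1)], of x] assms by simp

text \<open>The inverse is the transpose along \<open>F\<close> and \<open>G\<close> of
  \<open>T (\<epsilon> B) \<cdot> \<phi>\<close>, an arrow from \<open>F (T (G B))\<close> to
  \<open>T B\<close>. One composite is checked by ordinary transposition, since it ends in
  \<open>G (T B)\<close>, the other by the suspended one.\<close>

lemma right_susp_iso:
  assumes B: "B \<in> Obj D"
  shows "iso_arr C (right_susp B)"
proof -
  let ?k = "ar (Susp R) (\<epsilon> B) \<cdot>\<^bsub>D\<^esub> \<phi> (ob G B)"
  let ?d = "ar G ?k \<cdot>\<^bsub>C\<^esub> \<eta> (ob (Susp S) (ob G B))"
  have d: "?d \<in> Arr C" "Dom C ?d = ob (Susp S) (ob G B)" "Cod C ?d = ob G (ob (Susp R) B)"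
    using B by simp_all
  have eq: "\<epsilon> (ob (Susp R) B) \<cdot>\<^bsub>D\<^esub> ar F ?d = ?k"
    by (rule transpose_left) (use B in simp_all)
  show ?thesis
  proof (rule unit.source.dom_cat.iso_arrI[of _ ?d])
    have "\<epsilon> (ob (Susp R) B) \<cdot>\<^bsub>D\<^esub> (ar F ?d \<cdot>\<^bsub>D\<^esub> ar F (right_susp B)) = \<epsilon> (ob (Susp R) B)"
      using counit.source.dom_cat.tail[OF eq, of "ar F (right_susp B)"] d B
      by (simp del: left.ar_Comp_simp)
    then show "?d \<cdot>\<^bsub>C\<^esub> right_susp B = Id C (Dom C (right_susp B))"
      using d B by (intro transpose_inject[of "ob (Susp R) B"]) (simp_all del: right.ar_Comp_simp unit.source.dom_cat.assoc)
    show "right_susp B \<cdot>\<^bsub>C\<^esub> ?d = Id C (Cod C (right_susp B))"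
    proof (rule susp_transpose_inject[of B])
      show "ar (Susp R) (\<epsilon> B) \<cdot>\<^bsub>D\<^esub> (\<phi> (ob G B) \<cdot>\<^bsub>D\<^esub> ar F (right_susp B \<cdot>\<^bsub>C\<^esub> ?d)) =
          ar (Susp R) (\<epsilon> B) \<cdot>\<^bsub>D\<^esub> (\<phi> (ob G B) \<cdot>\<^bsub>D\<^esub> ar F (Id C (Cod C (right_susp B))))"
        using left.ar_Comp_simp[of ?d "right_susp B"] d B eq right_susp_tail[of B "ar F ?d"]
        by (simp del: left.ar_Comp_simp)
    qed (use d B in \<open>simp_all del: right.ar_Comp_simp\<close>)
  qed (use d B in simp_all)
qed

text \<open>Both sides have the suspended transpose \<open>T f \<cdot> \<epsilon>\<close>, by
  naturality of \<open>\<phi>\<close> and of the counit.\<close>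

lemma right_susp_naturality:
  assumes f: "f \<in> Arr D"
  shows "ar (Susp S) (ar G f) \<cdot>\<^bsub>C\<^esub> right_susp (Dom D f) = right_susp (Cod D f) \<cdot>\<^bsub>C\<^esub> ar G (ar (Susp R) f)"
proof (rule susp_transpose_inject[of "Cod D f"])
  have "ar (Susp R) (\<epsilon> (Cod D f)) \<cdot>\<^bsub>D\<^esub> (ar (Susp R) (ar F (ar G f)) \<cdot>\<^bsub>D\<^esub>
      (\<phi> (ob G (Dom D f)) \<cdot>\<^bsub>D\<^esub> ar F (right_susp (Dom D f)))) =
    ar (Susp R) f \<cdot>\<^bsub>D\<^esub> (ar (Susp R) (\<epsilon> (Dom D f)) \<cdot>\<^bsub>D\<^esub> (\<phi> (ob G (Dom D f)) \<cdot>\<^bsub>D\<^esub> ar F (right_susp (Dom D f))))"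
    using counit.source.dom_cat.tail[OF left_susp.target.susp.ar_eq[OF eps_naturality[of f "Cod D f"]],
        of "\<phi> (ob G (Dom D f)) \<cdot>\<^bsub>D\<^esub> ar F (right_susp (Dom D f))"] f
    by simp
  then show "ar (Susp R) (\<epsilon> (Cod D f)) \<cdot>\<^bsub>D\<^esub> (\<phi> (ob G (Cod D f)) \<cdot>\<^bsub>D\<^esub>
      ar F (ar (Susp S) (ar G f) \<cdot>\<^bsub>C\<^esub> right_susp (Dom D f))) =
    ar (Susp R) (\<epsilon> (Cod D f)) \<cdot>\<^bsub>D\<^esub> (\<phi> (ob G (Cod D f)) \<cdot>\<^bsub>D\<^esub> ar F (right_susp (Cod D f) \<cdot>\<^bsub>C\<^esub> ar G (ar (Susp R) f)))"
    using f by (simp add: counit.source.dom_cat.tail[OF left_susp.structure_naturality] eps_naturality)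
qed (use f in simp_all)

lemma right_susp_suspended: "suspended_functor D R C S G right_susp"
  by (rule suspended_functorI)
    (auto intro: left_susp.source.suspended_category_axioms left_susp.target.suspended_category_axioms
      right.cat_functor_axioms right_susp_iso right_susp_naturality)

text \<open>Compatibility of the counit holds by construction and already forces uniqueness;
  compatibility of the unit is then a consequence of the triangle identities.\<close>

lemma right_adjoint_susp_eq: "right_adjoint_susp C S D R F \<phi> G \<eta> \<epsilon> = right_susp"
  unfolding right_adjoint_susp_def
proof (rule the_equality, intro conjI)
  note left = left_susp.suspended_functor_axioms
  show "right_susp \<in> extensional (Obj D)"
    by (simp add: right_susp_def)
  show "suspended_functor D R C S G right_susp"
    by (rule right_susp_suspended)
  show "suspended_morphism C S C S id_func (id_susp C S) (G \<circ>\<^sub>F F) (comp_susp C G right_susp F \<phi>) \<eta>"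
  proof (rule suspended_morphismI)
    fix A assume A: "A \<in> Obj C"
    \<comment> \<open>The suspended transpose of either side is \<open>\<phi> A\<close>.\<close>
    show "ar (Susp S) (\<eta> A) \<cdot>\<^bsub>C\<^esub> id_susp C S A = comp_susp C G right_susp F \<phi> A \<cdot>\<^bsub>C\<^esub> \<eta> (ob (Susp S) A)"
    proof (rule susp_transpose_inject[of "ob F A"])
      have "ar (Susp R) (\<epsilon> (ob F A)) \<cdot>\<^bsub>D\<^esub> (ar (Susp R) (ar F (\<eta> A)) \<cdot>\<^bsub>D\<^esub> \<phi> A) = \<phi> A"
        using counit.source.dom_cat.tail[OF left_susp.target.susp.ar_eq[OF triangle_left_simp], of A "ob F A" "\<phi> A"] A by simp
      moreover have "\<epsilon> (ob (Susp R) (ob F A)) \<cdot>\<^bsub>D\<^esub> (ar F (ar G (\<phi> A)) \<cdot>\<^bsub>D\<^esub> ar F (\<eta> (ob (Susp S) A))) = \<phi> A"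
        using transpose_left[of "\<phi> A" "ob (Susp S) A"] A by simp
      ultimately show "ar (Susp R) (\<epsilon> (ob F A)) \<cdot>\<^bsub>D\<^esub> (\<phi> (ob G (ob F A)) \<cdot>\<^bsub>D\<^esub> ar F (ar (Susp S) (\<eta> A) \<cdot>\<^bsub>C\<^esub> id_susp C S A)) =
        ar (Susp R) (\<epsilon> (ob F A)) \<cdot>\<^bsub>D\<^esub> (\<phi> (ob G (ob F A)) \<cdot>\<^bsub>D\<^esub> ar F (comp_susp C G right_susp F \<phi> A \<cdot>\<^bsub>C\<^esub> \<eta> (ob (Susp S) A)))"
        using A by (simp add: id_susp_def comp_susp_def left_susp.structure_naturality)
    qed (use A in \<open>simp_all add: id_susp_def comp_susp_def\<close>)
  qed (use suspended_functor_id suspended_functor_comp left right_susp_suspended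
      left_susp.source.suspended_category_axioms unit.nat_trans_axioms in auto)
  show "suspended_morphism D R D R (F \<circ>\<^sub>F G) (comp_susp D F \<phi> G right_susp) id_func (id_susp D R) \<epsilon>"
    by (rule suspended_morphismI)
      (use suspended_functor_id suspended_functor_comp left right_susp_suspended
        left_susp.target.suspended_category_axioms counit.nat_trans_axioms
        in \<open>auto simp: id_susp_def comp_susp_def\<close>)
next
  fix \<gamma>
  assume \<gamma>: "\<gamma> \<in> extensional (Obj D) \<and>
     suspended_functor D R C S G \<gamma> \<and>
     suspended_morphism C S C S id_func (id_susp C S) (G \<circ>\<^sub>F F) (comp_susp C G \<gamma> F \<phi>) \<eta> \<and>
     suspended_morphism D R D R (F \<circ>\<^sub>F G) (comp_susp D F \<phi> G \<gamma>) id_func (id_susp D R) \<epsilon>"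
  then interpret \<gamma>: suspended_functor D R C S G \<gamma> by blast
  interpret counit_susp: suspended_morphism D R D R "F \<circ>\<^sub>F G" "comp_susp D F \<phi> G \<gamma>" id_func "id_susp D R" \<epsilon>
    using \<gamma> by blast
  show "\<gamma> = right_susp"
  proof (rule extensionalityI[of _ "Obj D"])
    fix B assume B: "B \<in> Obj D"
    \<comment> \<open>Compatibility of the counit with \<open>\<gamma>\<close> at \<open>B\<close>
      is the defining equation of \<open>right_susp B\<close>.\<close>
    show "\<gamma> B = right_susp B"
      by (rule susp_transpose_inject[of B])
        (use B counit_susp.Susp_compatible[of B] in \<open>simp_all add: id_susp_def comp_susp_def\<close>)
  qed (use \<gamma> in \<open>simp_all add: right_susp_def\<close>)
qed

end

section \<open>The right adjoint of an exact functor is exact\<close>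

context additive_category
begin

lemma Zero_simps [simp]:
  assumes "A \<in> Obj C" "B \<in> Obj C"
  shows "Zero S A B \<in> Arr C" "Dom C (Zero S A B) = A" "Cod C (Zero S A B) = B"
proof -
  interpret comm_group "Hom_group C S A B" using assms by (rule Hom_comm_group)
  have "Zero S A B \<in> Hom C A B" using one_closed by (simp add: Hom_group_def)
  then show "Zero S A B \<in> Arr C" "Dom C (Zero S A B) = A" "Cod C (Zero S A B) = B" by (simp_all add: Hom_iff)
qed

lemma Add_simps [simp]:
  assumes "f \<in> Arr C" "g \<in> Arr C" "Dom C f = Dom C g" "Cod C f = Cod C g"
  shows "Add S f g \<in> Arr C" "Dom C (Add S f g) = Dom C g" "Cod C (Add S f g) = Cod C g"
proof -
  interpret comm_group "Hom_group C S (Dom C g) (Cod C g)" using assms by (intro Hom_comm_group) simp_all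
  have "Add S f g \<in> Hom C (Dom C g) (Cod C g)"
    using m_closed[of f g] assms by (simp add: Hom_group_def Hom_iff)
  then show "Add S f g \<in> Arr C" "Dom C (Add S f g) = Dom C g" "Cod C (Add S f g) = Cod C g"
    by (simp_all add: Hom_iff)
qed

lemma Neg_simps [simp]:
  assumes "f \<in> Arr C"
  shows "Neg C S f \<in> Arr C" "Dom C (Neg C S f) = Dom C f" "Cod C (Neg C S f) = Cod C f"
    "Add S (Neg C S f) f = Zero S (Dom C f) (Cod C f)" "Add S f (Neg C S f) = Zero S (Dom C f) (Cod C f)"
proof -
  interpret comm_group "Hom_group C S (Dom C f) (Cod C f)" using assms by (intro Hom_comm_group) simp_all
  have f: "f \<in> carrier (Hom_group C S (Dom C f) (Cod C f))" using assms by (simp add: Hom_group_def Hom_iff)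
  have "Neg C S f \<in> Hom C (Dom C f) (Cod C f)"
    using inv_closed[OF f] by (simp add: Neg_def Hom_group_def)
  then show "Neg C S f \<in> Arr C" "Dom C (Neg C S f) = Dom C f" "Cod C (Neg C S f) = Cod C f"
    by (simp_all add: Hom_iff)
  show "Add S (Neg C S f) f = Zero S (Dom C f) (Cod C f)" "Add S f (Neg C S f) = Zero S (Dom C f) (Cod C f)"
    using l_inv[OF f] r_inv[OF f] by (simp_all add: Neg_def Hom_group_def)
qed

lemma Zero_Add [simp]:
  assumes "f \<in> Arr C" "Dom C f = A" "Cod C f = B"
  shows "Add S (Zero S A B) f = f" "Add S f (Zero S A B) = f"
proof -
  interpret comm_group "Hom_group C S A B" using assms by (intro Hom_comm_group) auto
  have "f \<in> carrier (Hom_group C S A B)" using assms by (simp add: Hom_group_def Hom_iff)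
  then show "Add S (Zero S A B) f = f" "Add S f (Zero S A B) = f"
    using l_one r_one by (simp_all add: Hom_group_def)
qed

lemma Add_eq_self_imp_Zero:
  assumes "Add S f f = f" "f \<in> Arr C" "Dom C f = A" "Cod C f = B"
  shows "f = Zero S A B"
proof -
  interpret comm_group "Hom_group C S A B" using assms by (intro Hom_comm_group) auto
  have "f \<in> carrier (Hom_group C S A B)" using assms by (simp add: Hom_group_def Hom_iff)
  then show ?thesis using assms(1) r_cancel_one by (simp add: Hom_group_def)
qed

lemma Neg_unique:
  assumes "Add S f g = Zero S (Dom C g) (Cod C g)" "f \<in> Arr C" "g \<in> Arr C" "Dom C f = Dom C g" "Cod C f = Cod C g"
  shows "f = Neg C S g"
proof -
  interpret comm_group "Hom_group C S (Dom C g) (Cod C g)" using assms by (intro Hom_comm_group) auto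
  have "f \<in> carrier (Hom_group C S (Dom C g) (Cod C g))" "g \<in> carrier (Hom_group C S (Dom C g) (Cod C g))"
    using assms by (simp_all add: Hom_group_def Hom_iff)
  then show ?thesis
    using assms(1) inv_unique'[of g f] inv_equality[of f g] by (simp add: Neg_def Hom_group_def)
qed

lemma Add_diff_cancel:
  assumes "f \<in> Arr C" "g \<in> Arr C" "Dom C f = Dom C g" "Cod C f = Cod C g"
  shows "Add S (Add S f (Neg C S g)) g = f"
proof -
  interpret comm_group "Hom_group C S (Dom C g) (Cod C g)" using assms by (intro Hom_comm_group) auto
  have c: "f \<in> carrier (Hom_group C S (Dom C g) (Cod C g))" "g \<in> carrier (Hom_group C S (Dom C g) (Cod C g))"
    "Neg C S g \<in> carrier (Hom_group C S (Dom C g) (Cod C g))"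
    using assms by (simp_all add: Hom_group_def Hom_iff)
  show ?thesis
    using m_assoc[of f "Neg C S g" g] c assms by (simp add: Hom_group_def)
qed

lemma Comp_Add_simp:
  "f \<in> Arr C \<Longrightarrow> f' \<in> Arr C \<Longrightarrow> g \<in> Arr C \<Longrightarrow> Dom C f = Dom C f' \<Longrightarrow> Cod C f = Dom C g \<Longrightarrow> Cod C f' = Dom C g \<Longrightarrow>
    g \<cdot> Add S f f' = Add S (g \<cdot> f) (g \<cdot> f')"
  using Comp_Add[of f "Dom C f'" "Dom C g" f' g "Cod C g"] by (simp add: Hom_iff)

lemma Add_Comp_simp:
  "g \<in> Arr C \<Longrightarrow> g' \<in> Arr C \<Longrightarrow> f \<in> Arr C \<Longrightarrow> Cod C g = Cod C g' \<Longrightarrow> Dom C g = Cod C f \<Longrightarrow> Dom C g' = Cod C f \<Longrightarrow>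
    Add S g g' \<cdot> f = Add S (g \<cdot> f) (g' \<cdot> f)"
  using Add_Comp[of f "Dom C f" "Cod C f" g "Cod C g'" g'] by (simp add: Hom_iff)

text \<open>By distributivity the composite is its own double, and such an element of a group is
  neutral.\<close>

lemma Comp_Zero [simp]:
  assumes "A \<in> Obj C" "g \<in> Arr C" "Dom C g = B"
  shows "g \<cdot> Zero S A B = Zero S A (Cod C g)"
proof -
  have "B \<in> Obj C" using assms by auto
  then show ?thesis
    using assms Comp_Add_simp[of "Zero S A B" "Zero S A B" g, symmetric] by - (rule Add_eq_self_imp_Zero, simp_all)
qed

lemma Zero_Comp [simp]:
  assumes "E \<in> Obj C" "f \<in> Arr C" "Cod C f = B"
  shows "Zero S B E \<cdot> f = Zero S (Dom C f) E"
proof -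
  have "B \<in> Obj C" using assms by auto
  then show ?thesis
    using assms Add_Comp_simp[of "Zero S B E" "Zero S B E" f, symmetric] by - (rule Add_eq_self_imp_Zero, simp_all)
qed

lemma Neg_Comp [simp]:
  assumes "f \<in> Arr C" "g \<in> Arr C" "Cod C f = Dom C g"
  shows "Neg C S g \<cdot> f = Neg C S (g \<cdot> f)"
proof (rule Neg_unique)
  have "Add S (Neg C S g \<cdot> f) (g \<cdot> f) = Add S (Neg C S g) g \<cdot> f"
    by (rule Add_Comp_simp[symmetric]) (use assms in simp_all)
  then show "Add S (Neg C S g \<cdot> f) (g \<cdot> f) = Zero S (Dom C (g \<cdot> f)) (Cod C (g \<cdot> f))"
    using assms by simp
qed (use assms in simp_all)

lemma Comp_Neg [simp]:
  assumes "f \<in> Arr C" "g \<in> Arr C" "Cod C f = Dom C g"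
  shows "g \<cdot> Neg C S f = Neg C S (g \<cdot> f)"
proof (rule Neg_unique)
  have "Add S (g \<cdot> Neg C S f) (g \<cdot> f) = g \<cdot> Add S (Neg C S f) f"
    by (rule Comp_Add_simp[symmetric]) (use assms in simp_all)
  then show "Add S (g \<cdot> Neg C S f) (g \<cdot> f) = Zero S (Dom C (g \<cdot> f)) (Cod C (g \<cdot> f))"
    using assms by simp
qed (use assms in simp_all)

lemma Neg_Neg [simp]: "f \<in> Arr C \<Longrightarrow> Neg C S (Neg C S f) = f"
  by (rule Neg_unique[symmetric]) simp_all

lemma Neg_Zero [simp]: "A \<in> Obj C \<Longrightarrow> B \<in> Obj C \<Longrightarrow> Neg C S (Zero S A B) = Zero S A B"
  by (rule Neg_unique[symmetric]) simp_all

lemma Neg_inject: "Neg C S f = Neg C S g \<Longrightarrow> f \<in> Arr C \<Longrightarrow> g \<in> Arr C \<Longrightarrow> f = g"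
  using Neg_Neg by metis

lemma from_zero_object:
  assumes "zero_object C S Z" "f \<in> Arr C" "Dom C f = Z"
  shows "f = Zero S Z (Cod C f)"
  using assms Comp_Zero[of Z f Z] by (metis Comp_Id_simp zero_object_def)

end

text \<open>A functor with a right adjoint preserves initial objects, hence zero objects and zero arrows.\<close>

lemma (in adjunction) left_preserves_Zero:
  assumes "additive_category C S" "additive_category D R" "A \<in> Obj C" "B \<in> Obj C"
  shows "ar F (Zero S A B) = Zero R (ob F A) (ob F B)"
proof -
  interpret CA: additive_category C S by fact
  interpret DA: additive_category D R by fact
  obtain Z where Z: "zero_object C S Z" using CA.ex_zero_object by blast
  then have ZO: "Z \<in> Obj C" by (simp add: zero_object_def)
  \<comment> \<open>Arrows out of \<open>F Z\<close> transpose to arrows out of the zero object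
    \<open>Z\<close>, of which there is one for each target. A zero arrow factors through
    \<open>Z\<close>, hence its image through \<open>F Z\<close>.\<close>
  have eq: "f = g" if "f \<in> Arr D" "g \<in> Arr D" "Dom D f = ob F Z" "Dom D g = ob F Z" "Cod D f = Cod D g" for f g
  proof -
    have "ar G f \<cdot>\<^bsub>C\<^esub> \<eta> Z = ar G g \<cdot>\<^bsub>C\<^esub> \<eta> Z"
      using CA.from_zero_object[OF Z, of "ar G f \<cdot>\<^bsub>C\<^esub> \<eta> Z"] CA.from_zero_object[OF Z, of "ar G g \<cdot>\<^bsub>C\<^esub> \<eta> Z"]
        that ZO by simp
    then show ?thesis
      using transpose_left[of f Z "Cod D g"] transpose_left[of g Z "Cod D g"] that ZO by metis
  qed
  have "ar F (Zero S A B) = ar F (Zero S Z B) \<cdot>\<^bsub>D\<^esub> ar F (Zero S A Z)"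
    by (rule left.ar_eq[symmetric]) (use assms ZO in simp_all)
  also have "ar F (Zero S Z B) = Zero R (ob F Z) (ob F B)"
    by (rule eq) (use assms ZO in simp_all)
  also have "Zero R (ob F Z) (ob F B) \<cdot>\<^bsub>D\<^esub> ar F (Zero S A Z) = Zero R (ob F A) (ob F B)"
    using assms ZO by simp
  finally show ?thesis .
qed

text \<open>Transposed, the left side becomes a zero arrow after the counit, the right side the
  counit after \<open>F\<close> of a zero arrow, which \<open>left_preserves_Zero\<close>
  computes.\<close>

lemma (in adjunction) right_preserves_Zero:
  assumes "additive_category C S" "additive_category D R" "A \<in> Obj D" "B \<in> Obj D"
  shows "ar G (Zero R A B) = Zero S (ob G A) (ob G B)"
proof -
  interpret CA: additive_category C S by fact
  interpret DA: additive_category D R by fact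
  show ?thesis
    by (rule transpose_inject[of B]) (use assms in \<open>simp_all add: eps_naturality left_preserves_Zero[OF assms(1,2)]\<close>)
qed

section \<open>Exactness of \<open>Hom(X, -)\<close> on triangles\<close>

context triangulated_category
begin

lemma exact_simps:
  assumes "(u, v, w) \<in> \<Delta>"
  shows "u \<in> Arr C" "v \<in> Arr C" "w \<in> Arr C" "Dom C v = Cod C u" "Dom C w = Cod C v"
    "Cod C w = ob (Susp S) (Dom C u)"
  using exact_is_triangle[OF assms] by (auto simp: is_triangle_def Hom_iff)

lemma is_triangle_iff:
  "is_triangle C S (u, v, w) \<longleftrightarrow> u \<in> Arr C \<and> v \<in> Arr C \<and> w \<in> Arr C \<and> Dom C v = Cod C u \<and>
    Dom C w = Cod C v \<and> Cod C w = ob (Susp S) (Dom C u)"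
  by (auto simp: is_triangle_def Hom_iff)

lemma exact_rotated:
  assumes "(u, v, w) \<in> \<Delta>"
  shows "(v, w, Neg C S (ar (Susp S) u)) \<in> \<Delta>"
  using assms exact_rotate[OF exact_is_triangle] by blast

text \<open>\<open>Hom(X, -)\<close> is exact at the middle vertex: compare with the triangle on the identity of \<open>X\<close>.\<close>

lemma exact_lift:
  assumes t: "(u, v, w) \<in> \<Delta>" and f: "f \<in> Arr C" "Cod C f = Dom C v" "v \<cdot> f = Zero S (Dom C f) (Cod C v)"
  obtains a where "a \<in> Arr C" "Dom C a = Dom C f" "Cod C a = Dom C u" "u \<cdot> a = f"
proof -
  note tri = exact_simps[OF t]
  let ?X = "Dom C f"
  obtain Z where Z: "zero_object C S Z" using ex_zero_object by blast
  then have ZO: "Z \<in> Obj C" by (simp add: zero_object_def)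
  have X: "?X \<in> Obj C" using f by simp
  \<comment> \<open>Both triangles are rotated once, so that \<open>f\<close> and a zero arrow are
    the two given components of a morphism; the filler between the third vertices is then the
    suspension of the desired lift.\<close>
  have 1: "(Zero S ?X Z, Zero S Z (ob (Susp S) ?X), Neg C S (ar (Susp S) (Id C ?X))) \<in> \<Delta>"
    by (rule exact_rotated[OF exact_Id[OF X Z]])
  have 2: "(v, w, Neg C S (ar (Susp S) u)) \<in> \<Delta>" by (rule exact_rotated[OF t])
  obtain d where "triangle_morphism C S (Zero S ?X Z, Zero S Z (ob (Susp S) ?X), Neg C S (ar (Susp S) (Id C ?X)))
      (v, w, Neg C S (ar (Susp S) u)) f (Zero S Z (Cod C v)) d"
    using exact_fill[OF 1 2, of f "Zero S Z (Cod C v)"] f tri X ZO by (auto simp: Hom_iff)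
  then have d: "d \<in> Arr C" "Dom C d = ob (Susp S) ?X" "Cod C d = ob (Susp S) (Dom C u)"
    "ar (Susp S) f \<cdot> Neg C S (ar (Susp S) (Id C ?X)) = Neg C S (ar (Susp S) u) \<cdot> d"
    using X ZO tri f by (simp_all add: triangle_morphism_def Hom_iff)
  \<comment> \<open>Each rotation contributed one sign, and the two cancel.\<close>
  have eq: "ar (Susp S) f = ar (Susp S) u \<cdot> d"
    by (rule Neg_inject) (use f tri X d in simp_all)
  have "f = u \<cdot> ar (Desusp S) d"
    by (rule Susp_inject) (use f tri d eq in simp_all)
  then show ?thesis
    using d tri X by (intro that[of "ar (Desusp S) d"]) simp_all
qed

text \<open>The triangle on the identity of the first vertex maps to the given one by the identity
  and \<open>u\<close>. Its third vertex is a zero object, through which \<open>v \<cdot> u\<close>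
  therefore factors.\<close>

lemma exact_Comp_Zero:
  assumes t: "(u, v, w) \<in> \<Delta>"
  shows "v \<cdot> u = Zero S (Dom C u) (Cod C v)"
proof -
  note tri = exact_simps[OF t]
  let ?A = "Dom C u"
  obtain Z where Z: "zero_object C S Z" using ex_zero_object by blast
  then have ZO: "Z \<in> Obj C" by (simp add: zero_object_def)
  have A: "?A \<in> Obj C" using tri by simp
  obtain d where "triangle_morphism C S (Id C ?A, Zero S ?A Z, Zero S Z (ob (Susp S) ?A)) (u, v, w) (Id C ?A) u d"
    using exact_fill[OF exact_Id[OF A Z] t, of "Id C ?A" u] tri A by (auto simp: Hom_iff)
  then have "d \<in> Arr C" "Dom C d = Z" "Cod C d = Cod C v" "d \<cdot> Zero S ?A Z = v \<cdot> u"
    using A ZO tri by (simp_all add: triangle_morphism_def Hom_iff)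
  then show ?thesis using A by simp
qed

end

section \<open>The comparison with a cone and the five lemma\<close>

locale exact_adjunction =
  suspended_adjunction C S D R F \<phi> G \<eta> \<epsilon> + exact: exact_functor C S \<Delta> D R \<Gamma> F \<phi>
  for C :: "('o, 'a) cat" and S \<Delta> and D :: "('p, 'b) cat" and R \<Gamma> F \<phi> G \<eta> \<epsilon>
begin

lemma F_Zero [simp]: "A \<in> Obj C \<Longrightarrow> B \<in> Obj C \<Longrightarrow> ar F (Zero S A B) = Zero R (ob F A) (ob F B)"
  by (rule left_preserves_Zero) (rule left_susp.source.additive_category_axioms left_susp.target.additive_category_axioms)+

lemma G_Zero [simp]: "A \<in> Obj D \<Longrightarrow> B \<in> Obj D \<Longrightarrow> ar G (Zero R A B) = Zero S (ob G A) (ob G B)"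
  by (rule right_preserves_Zero) (rule left_susp.source.additive_category_axioms left_susp.target.additive_category_axioms)+

text \<open>The transpose of \<open>f\<close> is killed by \<open>v\<close>, so it lifts through
  \<open>u\<close> in the category \<open>D\<close>; the transpose of this lift is the desired
  arrow. No exactness of the image triangle is presupposed.\<close>

lemma right_exact_lift:
  assumes t: "(u, v, w) \<in> \<Gamma>" and f: "f \<in> Arr C" "Cod C f = ob G (Dom D v)"
    "ar G v \<cdot>\<^bsub>C\<^esub> f = Zero S (Dom C f) (ob G (Cod D v))"
  obtains a where "a \<in> Arr C" "Dom C a = Dom C f" "Cod C a = ob G (Dom D u)" "ar G u \<cdot>\<^bsub>C\<^esub> a = f"
proof -
  note tri = exact.target.exact_simps[OF t]
  let ?X = "Dom C f" and ?k = "\<epsilon> (Dom D v) \<cdot>\<^bsub>D\<^esub> ar F f"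
  have X: "?X \<in> Obj C" and DV: "Dom D v \<in> Obj D" using f tri by simp_all
  have k: "?k \<in> Arr D" "Dom D ?k = ob F ?X" "Cod D ?k = Dom D v"
    using f DV by simp_all
  have "v \<cdot>\<^bsub>D\<^esub> ?k = \<epsilon> (Cod D v) \<cdot>\<^bsub>D\<^esub> (ar F (ar G v) \<cdot>\<^bsub>D\<^esub> ar F f)"
    using f tri(2) DV by (simp add: counit.source.dom_cat.tail[OF eps_naturality])
  also have "ar F (ar G v) \<cdot>\<^bsub>D\<^esub> ar F f = Zero R (ob F ?X) (ob F (ob G (Cod D v)))"
    using f tri(2) X by (subst left.ar_eq[OF f(3)]) simp_all
  finally have "v \<cdot>\<^bsub>D\<^esub> ?k = Zero R (Dom D ?k) (Cod D v)"
    using tri(2) X k by simp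
  then obtain a where a: "a \<in> Arr D" "Dom D a = ob F ?X" "Cod D a = Dom D u" "u \<cdot>\<^bsub>D\<^esub> a = ?k"
    using exact.target.exact_lift[OF t k(1,3)] k(2) by metis
  have "ar G u \<cdot>\<^bsub>C\<^esub> (ar G a \<cdot>\<^bsub>C\<^esub> \<eta> ?X) = (ar G u \<cdot>\<^bsub>C\<^esub> ar G a) \<cdot>\<^bsub>C\<^esub> \<eta> ?X"
    using a tri(1) X by simp
  also have "ar G u \<cdot>\<^bsub>C\<^esub> ar G a = ar G ?k"
    by (rule right.ar_eq) (use a tri(1) in simp_all)
  also have "ar G ?k \<cdot>\<^bsub>C\<^esub> \<eta> ?X = f"
    by (rule transpose_right) (use f DV in simp_all)
  finally show ?thesis
    using a X tri(1) by (intro that[of "ar G a \<cdot>\<^bsub>C\<^esub> \<eta> ?X"]) simp_all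
qed

text \<open>The comparison \<open>h\<close> from the third vertex \<open>Q\<close> of a cone of
  \<open>G u\<close> completes the identities of \<open>G A\<close> and \<open>G B\<close> to a
  morphism of triangles. Once \<open>h\<close> is shown to be invertible, closure of exact triangles
  under isomorphism finishes the proof.\<close>

lemma right_preserves_exact:
  assumes t: "(u, v, w) \<in> \<Gamma>"
  shows "(ar G u, ar G v, right_susp (Dom D u) \<cdot>\<^bsub>C\<^esub> ar G w) \<in> \<Delta>"
proof -
  let ?A = "Dom D u" and ?B = "Dom D v" and ?E = "Dom D w"
  note tri = exact.target.exact_simps[OF t]
  have AB: "?A \<in> Obj D" "?B \<in> Obj D" "?E \<in> Obj D" using tri(1,2,3) by simp_all
  have cod: "Cod D u = ?B" "Cod D v = ?E" "Cod D w = ob (Susp R) ?A" using tri by simp_all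
  note uvw = tri(1-3) cod
  have t2: "(v, w, Neg D R (ar (Susp R) u)) \<in> \<Gamma>" by (rule exact.target.exact_rotated[OF t])
  have t3: "(w, Neg D R (ar (Susp R) u), Neg D R (ar (Susp R) v)) \<in> \<Gamma>" by (rule exact.target.exact_rotated[OF t2])
  \<comment> \<open>Two consecutive arrows of the doubly rotated triangle compose to zero; the sign
    introduced by rotation is then removed.\<close>
  have uw: "ar (Susp R) u \<cdot>\<^bsub>D\<^esub> w = Zero R ?E (ob (Susp R) ?B)"
    by (rule left_susp.target.Neg_inject) (use exact.target.exact_Comp_Zero[OF t3] uvw AB in simp_all)
  obtain p q where pq: "(ar G u, p, q) \<in> \<Delta>"
    using exact.source.exact_cone[of "ar G u"] uvw by auto
  define Q where "Q = Cod C p"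
  have p: "p \<in> Arr C" "Dom C p = ob G ?B" "Cod C p = Q" and q: "q \<in> Arr C" "Dom C q = Q" "Cod C q = ob (Susp S) (ob G ?A)"
    using exact.source.exact_simps[OF pq] uvw by (simp_all add: Q_def)
  have Q: "Q \<in> Obj C" using p by auto
  have pq2: "(p, q, Neg C S (ar (Susp S) (ar G u))) \<in> \<Delta>" by (rule exact.source.exact_rotated[OF pq])
  have pq3: "(q, Neg C S (ar (Susp S) (ar G u)), Neg C S (ar (Susp S) p)) \<in> \<Delta>"
    by (rule exact.source.exact_rotated[OF pq2])
  have "(ar F (ar G u), ar F p, \<phi> (ob G ?A) \<cdot>\<^bsub>D\<^esub> ar F q) \<in> \<Gamma>"
    using exact.preserves_exact[OF pq] uvw by simp
  \<comment> \<open>Naturality of the counit at \<open>u\<close> is the commuting square required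
    for the filler.\<close>
  then obtain d where "triangle_morphism D R (ar F (ar G u), ar F p, \<phi> (ob G ?A) \<cdot>\<^bsub>D\<^esub> ar F q) (u, v, w) (\<epsilon> ?A) (\<epsilon> ?B) d"
    using exact.target.exact_fill[OF _ t, of "ar F (ar G u)" "ar F p" "\<phi> (ob G ?A) \<cdot>\<^bsub>D\<^esub> ar F q" "\<epsilon> ?A" "\<epsilon> ?B"] uvw AB
    by (auto simp: Hom_iff eps_naturality)
  then have d: "d \<in> Arr D" "Dom D d = ob F Q" "Cod D d = ?E" "d \<cdot>\<^bsub>D\<^esub> ar F p = v \<cdot>\<^bsub>D\<^esub> \<epsilon> ?B"
    "ar (Susp R) (\<epsilon> ?A) \<cdot>\<^bsub>D\<^esub> (\<phi> (ob G ?A) \<cdot>\<^bsub>D\<^esub> ar F q) = w \<cdot>\<^bsub>D\<^esub> d"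
    using p q AB by (simp_all add: triangle_morphism_def Hom_iff)
  define h where "h = ar G d \<cdot>\<^bsub>C\<^esub> \<eta> Q"
  have h: "h \<in> Arr C" "Dom C h = Q" "Cod C h = ob G ?E" using d Q by (simp_all add: h_def)
  have eh: "\<epsilon> ?E \<cdot>\<^bsub>D\<^esub> ar F h = d" unfolding h_def by (rule transpose_left) (use d Q in simp_all)
  have hp: "h \<cdot>\<^bsub>C\<^esub> p = ar G v"
  proof -
    have "h \<cdot>\<^bsub>C\<^esub> p = (ar G d \<cdot>\<^bsub>C\<^esub> ar G (ar F p)) \<cdot>\<^bsub>C\<^esub> \<eta> (ob G ?B)"
      using d p Q AB by (simp add: h_def eta_naturality)
    also have "ar G d \<cdot>\<^bsub>C\<^esub> ar G (ar F p) = ar G v \<cdot>\<^bsub>C\<^esub> ar G (\<epsilon> ?B)"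
      using right.ar_eq[OF d(4)] d p uvw AB by simp
    also have "(ar G v \<cdot>\<^bsub>C\<^esub> ar G (\<epsilon> ?B)) \<cdot>\<^bsub>C\<^esub> \<eta> (ob G ?B) = ar G v"
      using uvw AB by simp
    finally show ?thesis .
  qed
  let ?w = "right_susp ?A \<cdot>\<^bsub>C\<^esub> ar G w"
  have w': "?w \<in> Arr C" "Dom C ?w = ob G ?E" "Cod C ?w = ob (Susp S) (ob G ?A)"
    using uvw AB by simp_all
  \<comment> \<open>The last square of the filler states that the suspended transposes of
    \<open>?w \<cdot> h\<close> and \<open>q\<close> agree.\<close>
  have wh: "?w \<cdot>\<^bsub>C\<^esub> h = q"
  proof (rule susp_transpose_inject[of ?A])
    have "ar (Susp R) (\<epsilon> ?A) \<cdot>\<^bsub>D\<^esub> (\<phi> (ob G ?A) \<cdot>\<^bsub>D\<^esub> ar F (?w \<cdot>\<^bsub>C\<^esub> h)) =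
      \<epsilon> (ob (Susp R) ?A) \<cdot>\<^bsub>D\<^esub> (ar F (ar G w) \<cdot>\<^bsub>D\<^esub> ar F h)"
      using uvw AB h by simp
    also have "\<dots> = w \<cdot>\<^bsub>D\<^esub> (\<epsilon> ?E \<cdot>\<^bsub>D\<^esub> ar F h)"
      using uvw AB h by (simp add: counit.source.dom_cat.tail[OF eps_naturality])
    finally show "ar (Susp R) (\<epsilon> ?A) \<cdot>\<^bsub>D\<^esub> (\<phi> (ob G ?A) \<cdot>\<^bsub>D\<^esub> ar F (?w \<cdot>\<^bsub>C\<^esub> h)) =
      ar (Susp R) (\<epsilon> ?A) \<cdot>\<^bsub>D\<^esub> (\<phi> (ob G ?A) \<cdot>\<^bsub>D\<^esub> ar F q)"
      by (simp only: eh d(5))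
  qed (use uvw AB h q in simp_all)
  \<comment> \<open>If \<open>h\<close> kills \<open>x\<close>, so does \<open>q\<close>, hence
    \<open>x = p \<cdot> b\<close>. Then \<open>G v\<close> kills \<open>b\<close>, so
    \<open>b = G u \<cdot> a\<close>, and \<open>p \<cdot> G u = 0\<close> gives
    \<open>x = 0\<close>.\<close>
  have inj: "x = Zero S (Dom C x) Q"
    if x: "x \<in> Arr C" "Cod C x = Q" "h \<cdot>\<^bsub>C\<^esub> x = Zero S (Dom C x) (ob G ?E)" for x
  proof -
    have X: "Dom C x \<in> Obj C" using x by simp
    have "q \<cdot>\<^bsub>C\<^esub> x = ?w \<cdot>\<^bsub>C\<^esub> (h \<cdot>\<^bsub>C\<^esub> x)"
      unfolding wh[symmetric] by (rule unit.source.dom_cat.assoc) (use x h w' in simp_all)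
    also have "\<dots> = Zero S (Dom C x) (Cod C q)"
      unfolding x(3) using w' q X by (intro left_susp.source.Comp_Zero[THEN trans]) simp_all
    finally obtain b where b: "b \<in> Arr C" "Dom C b = Dom C x" "Cod C b = ob G ?B" "p \<cdot>\<^bsub>C\<^esub> b = x"
      using exact.source.exact_lift[OF pq2 x(1)] x(2) p q by metis
    have "ar G v \<cdot>\<^bsub>C\<^esub> b = h \<cdot>\<^bsub>C\<^esub> (p \<cdot>\<^bsub>C\<^esub> b)"
      unfolding hp[symmetric] by (rule unit.source.dom_cat.assoc) (use b p h in simp_all)
    then have "ar G v \<cdot>\<^bsub>C\<^esub> b = Zero S (Dom C b) (ob G (Cod D v))"
      using b x uvw by simp
    then obtain a where a: "a \<in> Arr C" "Dom C a = Dom C b" "Cod C a = ob G ?A" "ar G u \<cdot>\<^bsub>C\<^esub> a = b"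
      using right_exact_lift[OF t b(1)] b(3) by metis
    have "x = (p \<cdot>\<^bsub>C\<^esub> ar G u) \<cdot>\<^bsub>C\<^esub> a"
      unfolding b(4)[symmetric] a(4)[symmetric]
      by (rule unit.source.dom_cat.assoc[symmetric]) (use a p uvw in simp_all)
    also have "p \<cdot>\<^bsub>C\<^esub> ar G u = Zero S (ob G ?A) Q"
      using exact.source.exact_Comp_Zero[OF pq] p uvw by simp
    finally show ?thesis using a b Q by simp
  qed
  \<comment> \<open>A right inverse of \<open>h\<close>. Lifting \<open>?w\<close> through
    \<open>q\<close> gives an approximate one, which is right after composition with
    \<open>?w\<close>; the error is then corrected by an arrow that factors through
    \<open>p\<close>.\<close>
  have "\<exists>x. x \<in> Arr C \<and> Dom C x = ob G ?E \<and> Cod C x = Q \<and> h \<cdot>\<^bsub>C\<^esub> x = Id C (ob G ?E)"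
  proof -
    let ?I = "Id C (ob G ?E)"
    have GE: "ob G ?E \<in> Obj C" using AB by simp
    have "ar (Susp S) (ar G u) \<cdot>\<^bsub>C\<^esub> ?w = (ar (Susp S) (ar G u) \<cdot>\<^bsub>C\<^esub> right_susp ?A) \<cdot>\<^bsub>C\<^esub> ar G w"
      using uvw AB by simp
    also have "\<dots> = right_susp ?B \<cdot>\<^bsub>C\<^esub> (ar G (ar (Susp R) u) \<cdot>\<^bsub>C\<^esub> ar G w)"
      unfolding right_susp_naturality[OF uvw(1)] using uvw AB by simp
    also have "ar G (ar (Susp R) u) \<cdot>\<^bsub>C\<^esub> ar G w = ar G (Zero R ?E (ob (Susp R) ?B))"
      by (rule right.ar_eq[OF uw]) (use uvw AB in simp_all)
    finally have "ar (Susp S) (ar G u) \<cdot>\<^bsub>C\<^esub> ?w = Zero S (ob G ?E) (ob (Susp S) (ob G ?B))"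
      using AB by simp
    then have "Neg C S (ar (Susp S) (ar G u)) \<cdot>\<^bsub>C\<^esub> ?w = Zero S (Dom C ?w) (Cod C (Neg C S (ar (Susp S) (ar G u))))"
      using uvw AB by simp
    then obtain x where x: "x \<in> Arr C" "Dom C x = ob G ?E" "Cod C x = Q" "q \<cdot>\<^bsub>C\<^esub> x = ?w"
      using exact.source.exact_lift[OF pq3 w'(1)] w'(2,3) uvw q
      by (metis left_susp.source.Neg_simps(2) left_susp.source.susp.ar_simps(1,2) right.ar_simps(1,2))
    \<comment> \<open>The error \<open>id - h \<cdot> x\<close> is killed by \<open>?w\<close>,
      hence by \<open>G w\<close> since \<open>right_susp\<close> is invertible. It therefore lifts
      through \<open>G v = h \<cdot> p\<close> to \<open>b\<close>, and
      \<open>p \<cdot> b + x\<close> is an exact right inverse.\<close>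
    define e where "e = Add S ?I (Neg C S (h \<cdot>\<^bsub>C\<^esub> x))"
    have e: "e \<in> Arr C" "Dom C e = ob G ?E" "Cod C e = ob G ?E" using h x GE by (simp_all add: e_def)
    have "?w \<cdot>\<^bsub>C\<^esub> (h \<cdot>\<^bsub>C\<^esub> x) = (?w \<cdot>\<^bsub>C\<^esub> h) \<cdot>\<^bsub>C\<^esub> x"
      by (rule unit.source.dom_cat.assoc[symmetric]) (use h x w' in simp_all)
    then have whx: "?w \<cdot>\<^bsub>C\<^esub> (h \<cdot>\<^bsub>C\<^esub> x) = ?w" by (simp only: wh x(4))
    have "?w \<cdot>\<^bsub>C\<^esub> e = Add S (?w \<cdot>\<^bsub>C\<^esub> ?I) (?w \<cdot>\<^bsub>C\<^esub> Neg C S (h \<cdot>\<^bsub>C\<^esub> x))"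
      unfolding e_def by (rule left_susp.source.Comp_Add_simp) (use h x w' GE in simp_all)
    also have "?w \<cdot>\<^bsub>C\<^esub> Neg C S (h \<cdot>\<^bsub>C\<^esub> x) = Neg C S (?w \<cdot>\<^bsub>C\<^esub> (h \<cdot>\<^bsub>C\<^esub> x))"
      by (rule left_susp.source.Comp_Neg) (use h x w' in simp_all)
    also have "Add S (?w \<cdot>\<^bsub>C\<^esub> ?I) (Neg C S (?w \<cdot>\<^bsub>C\<^esub> (h \<cdot>\<^bsub>C\<^esub> x))) = Zero S (ob G ?E) (ob (Susp S) (ob G ?A))"
      unfolding whx using w' GE uvw AB by simp
    finally have we: "?w \<cdot>\<^bsub>C\<^esub> e = Zero S (ob G ?E) (ob (Susp S) (ob G ?A))" .
    have "ar G w \<cdot>\<^bsub>C\<^esub> e = Zero S (Dom C e) (ob G (Cod D w))"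
    proof (rule unit.source.dom_cat.iso_cancel_left[OF right_susp_iso[OF AB(1)]])
      show "right_susp ?A \<cdot>\<^bsub>C\<^esub> (ar G w \<cdot>\<^bsub>C\<^esub> e) = right_susp ?A \<cdot>\<^bsub>C\<^esub> Zero S (Dom C e) (ob G (Cod D w))"
        using we e uvw AB GE by simp
    qed (use e uvw AB GE in simp_all)
    then obtain b where b: "b \<in> Arr C" "Dom C b = Dom C e" "Cod C b = ob G ?B" "ar G v \<cdot>\<^bsub>C\<^esub> b = e"
      using right_exact_lift[OF t2 e(1,3)] by metis
    have hb: "h \<cdot>\<^bsub>C\<^esub> (p \<cdot>\<^bsub>C\<^esub> b) = e"
      using unit.source.dom_cat.tail[OF hp p(1) h(1), of b] b p h by simp
    let ?y = "Add S (p \<cdot>\<^bsub>C\<^esub> b) x"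
    have "h \<cdot>\<^bsub>C\<^esub> ?y = Add S e (h \<cdot>\<^bsub>C\<^esub> x)"
      unfolding hb[symmetric] by (rule left_susp.source.Comp_Add_simp) (use h p b x e in simp_all)
    also have "\<dots> = ?I"
      unfolding e_def by (rule left_susp.source.Add_diff_cancel) (use h x GE in simp_all)
    finally show ?thesis using p b x e by (intro exI[of _ ?y]) simp
  qed
  then obtain y where y: "y \<in> Arr C" "Dom C y = ob G ?E" "Cod C y = Q" "h \<cdot>\<^bsub>C\<^esub> y = Id C (ob G ?E)" by blast
  \<comment> \<open>\<open>h\<close> kills \<open>y \<cdot> h - id\<close>, which vanishes by
    \<open>inj\<close>: the right inverse is two-sided.\<close>
  have yh: "y \<cdot>\<^bsub>C\<^esub> h = Id C Q"
  proof -
    let ?z = "Add S (y \<cdot>\<^bsub>C\<^esub> h) (Neg C S (Id C Q))"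
    have z: "?z \<in> Arr C" "Dom C ?z = Q" "Cod C ?z = Q" using y h Q by simp_all
    have "h \<cdot>\<^bsub>C\<^esub> ?z = Add S (h \<cdot>\<^bsub>C\<^esub> (y \<cdot>\<^bsub>C\<^esub> h)) (h \<cdot>\<^bsub>C\<^esub> Neg C S (Id C Q))"
      by (rule left_susp.source.Comp_Add_simp) (use y h Q in simp_all)
    also have "h \<cdot>\<^bsub>C\<^esub> (y \<cdot>\<^bsub>C\<^esub> h) = h"
      using unit.source.dom_cat.tail[OF y(4) y(1) h(1), of h] y h by simp
    finally have "h \<cdot>\<^bsub>C\<^esub> ?z = Zero S (Dom C ?z) (ob G ?E)"
      using h Q z by simp
    then have "?z = Zero S Q Q" using inj[of ?z] z by simp
    then have "y \<cdot>\<^bsub>C\<^esub> h = Neg C S (Neg C S (Id C Q))"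
      by (intro left_susp.source.Neg_unique) (use y h Q in simp_all)
    then show ?thesis using Q by simp
  qed
  have iso: "iso_arr C h"
    by (rule unit.source.dom_cat.iso_arrI[of _ y]) (use y h yh in simp_all)
  have "triangle_morphism C S (ar G u, p, q) (ar G u, ar G v, ?w) (Id C (ob G ?A)) (Id C (ob G ?B)) h"
    using uvw AB p q h hp wh w' by (simp add: triangle_morphism_def Hom_iff)
  moreover have "is_triangle C S (ar G u, ar G v, ?w)"
    using uvw AB by (simp add: exact.source.is_triangle_iff)
  ultimately show ?thesis
    using exact.source.exact_iso_closed[OF pq] iso AB by (simp add: unit.source.dom_cat.iso_arr_Id)
qed

lemma right_susp_exact: "exact_functor D R \<Gamma> C S \<Delta> G right_susp"
  by (intro exact_functor.intro exact_functor_axioms.intro right_susp_suspended right_preserves_exact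
      exact.source.triangulated_category_axioms exact.target.triangulated_category_axioms)

end

section \<open>The morphism zeta\<close>

sublocale symmetric_monoidal_functor \<subseteq>
  alpha: nat_iso "C \<times>\<^sub>C C" D "tensor N \<circ>\<^sub>F (F \<times>\<^sub>F F)" "F \<circ>\<^sub>F tensor M" \<alpha>
  by (rule alpha_iso)

locale monoidal_adjunction =
  M1: symmetric_monoidal_closed_category C1 M1 + M2: symmetric_monoidal_closed_category C2 M2 +
  F: symmetric_monoidal_functor C1 M1 C2 M2 F \<alpha> \<upsilon> + adjunction C1 C2 F G \<eta> \<epsilon>
  for C1 :: "('o, 'a) cat" and M1 and C2 :: "('p, 'b) cat" and M2 F \<alpha> \<upsilon> G \<eta> \<epsilon>
begin

abbreviation lam where "lam \<equiv> lambda_map M1 C1 C2 M2 \<alpha> G \<eta> \<epsilon>"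

lemma alpha_iso_arr [simp]: "A \<in> Obj C1 \<Longrightarrow> B \<in> Obj C1 \<Longrightarrow> iso_arr C2 (\<alpha> (A, B))"
  using F.alpha.component_iso by simp

lemma inv_alpha_naturality:
  assumes "f \<in> Arr C1" "g \<in> Arr C1" "Cod C1 f = A" "Cod C1 g = B"
  shows "inv_arr C2 (\<alpha> (A, B)) \<cdot>\<^bsub>C2\<^esub> ar F (f \<otimes>\<^sub>a\<^bsub>M1\<^esub> g) =
    (ar F f \<otimes>\<^sub>a\<^bsub>M2\<^esub> ar F g) \<cdot>\<^bsub>C2\<^esub> inv_arr C2 (\<alpha> (Dom C1 f, Dom C1 g))"
  using F.alpha.naturality_inv[of "(f, g)"] assms by simp

lemma inv_alpha_symm:
  assumes "A \<in> Obj C1" "B \<in> Obj C1"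
  shows "inv_arr C2 (\<alpha> (B, A)) \<cdot>\<^bsub>C2\<^esub> ar F (symm M1 (A, B)) =
    symm M2 (ob F A, ob F B) \<cdot>\<^bsub>C2\<^esub> inv_arr C2 (\<alpha> (A, B))"
  by (rule M2.inv_arr_swap) (use assms F.alpha_symm in simp_all)

lemma lambda_simps [simp]:
  assumes "A \<in> Obj C2" "B \<in> Obj C2"
  shows "lam (A, B) \<in> Arr C1" "Dom C1 (lam (A, B)) = ob G A \<otimes>\<^sub>o\<^bsub>M1\<^esub> ob G B"
    "Cod C1 (lam (A, B)) = ob G (A \<otimes>\<^sub>o\<^bsub>M2\<^esub> B)"
  using assms by (simp_all add: lambda_map_def)

text \<open>\<open>lam\<close> has the form \<open>G k \<cdot> \<eta>\<close>, where
  \<open>k\<close> is the right-hand side; transposing it back returns \<open>k\<close>.\<close>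

lemma lambda_transpose:
  assumes "A \<in> Obj C2" "B \<in> Obj C2"
  shows "\<epsilon> (A \<otimes>\<^sub>o\<^bsub>M2\<^esub> B) \<cdot>\<^bsub>C2\<^esub> ar F (lam (A, B)) =
    (\<epsilon> A \<otimes>\<^sub>a\<^bsub>M2\<^esub> \<epsilon> B) \<cdot>\<^bsub>C2\<^esub> inv_arr C2 (\<alpha> (ob G A, ob G B))"
  using transpose_left[of "(\<epsilon> A \<otimes>\<^sub>a\<^bsub>M2\<^esub> \<epsilon> B) \<cdot>\<^bsub>C2\<^esub> inv_arr C2 (\<alpha> (ob G A, ob G B))" "ob G A \<otimes>\<^sub>o\<^bsub>M1\<^esub> ob G B"]
    assms by (simp add: lambda_map_def)

lemmas lambda_transpose_tail = M2.tail[OF lambda_transpose]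

text \<open>Transposition reduces the claim to naturality of the counit in both factors and of the
  inverse of \<open>\<alpha>\<close>.\<close>

lemma lambda_naturality:
  assumes "f \<in> Arr C2" "g \<in> Arr C2" "Cod C2 f = A" "Cod C2 g = B"
  shows "lam (A, B) \<cdot>\<^bsub>C1\<^esub> (ar G f \<otimes>\<^sub>a\<^bsub>M1\<^esub> ar G g) = ar G (f \<otimes>\<^sub>a\<^bsub>M2\<^esub> g) \<cdot>\<^bsub>C1\<^esub> lam (Dom C2 f, Dom C2 g)"
proof -
  have AB: "A \<in> Obj C2" "B \<in> Obj C2" using assms by auto
  show ?thesis
    by (rule transpose_inject[of "A \<otimes>\<^sub>o\<^bsub>M2\<^esub> B"])
      (use assms AB in \<open>simp_all add: lambda_transpose lambda_transpose_tail inv_alpha_naturality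
        eps_naturality M2.tail[OF eps_naturality]\<close>)
qed

lemma lambda_symm:
  assumes "A \<in> Obj C2" "B \<in> Obj C2"
  shows "lam (B, A) \<cdot>\<^bsub>C1\<^esub> symm M1 (ob G A, ob G B) = ar G (symm M2 (A, B)) \<cdot>\<^bsub>C1\<^esub> lam (A, B)"
  by (rule transpose_inject[of "B \<otimes>\<^sub>o\<^bsub>M2\<^esub> A"])
    (use assms in \<open>simp_all add: lambda_transpose lambda_transpose_tail inv_alpha_symm
      eps_naturality M2.tail[OF eps_naturality] M2.symm_naturality M2.tail[OF M2.symm_naturality]\<close>)

end

locale monoidal_adjoint_triple =
  monoidal_adjunction C1 M1 C2 M2 F \<alpha> \<upsilon> G \<eta> \<epsilon> + second: adjunction C2 C1 G H \<eta>' \<epsilon>'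
  for C1 :: "('o, 'a) cat" and M1 and C2 :: "('p, 'b) cat" and M2 F \<alpha> \<upsilon> G \<eta> \<epsilon> H \<eta>' \<epsilon>'
begin

abbreviation zeta where "zeta \<equiv> zeta_map C1 M1 C2 M2 \<alpha> G \<eta> \<epsilon> H \<epsilon>'"

lemma zeta_simps [simp]:
  assumes "A \<in> Obj C2" "K \<in> Obj C1"
  shows "zeta (A, K) \<in> Arr C1" "Dom C1 (zeta (A, K)) = ob G (A \<leadsto>\<^sub>o\<^bsub>M2\<^esub> ob H K)"
    "Cod C1 (zeta (A, K)) = ob G A \<leadsto>\<^sub>o\<^bsub>M1\<^esub> K"
  using assms by (simp_all add: zeta_map_def mu_map_def)

text \<open>All arrows after the unit \<open>coev\<close> act in the target variable of the internal
  Hom, so evaluation brings them out one by one and the triangle identity consumes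
  \<open>coev\<close>.\<close>

lemma ev_zeta:
  assumes "A \<in> Obj C2" "K \<in> Obj C1" "h \<in> Arr C1" "k \<in> Arr C1" "Cod C1 h = ob G (A \<leadsto>\<^sub>o\<^bsub>M2\<^esub> ob H K)" "Cod C1 k = ob G A"
  shows "ev M1 (ob G A) K \<cdot>\<^bsub>C1\<^esub> ((zeta (A, K) \<cdot>\<^bsub>C1\<^esub> h) \<otimes>\<^sub>a\<^bsub>M1\<^esub> k) =
    \<epsilon>' K \<cdot>\<^bsub>C1\<^esub> (ar G (ev M2 A (ob H K)) \<cdot>\<^bsub>C1\<^esub> (lam (A \<leadsto>\<^sub>o\<^bsub>M2\<^esub> ob H K, A) \<cdot>\<^bsub>C1\<^esub> (h \<otimes>\<^sub>a\<^bsub>M1\<^esub> k)))"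
  using assms by (simp add: zeta_map_def mu_map_def M1.ev_ihom_Comp M1.ev_coev)

lemma ev_zeta_Id:
  assumes "A \<in> Obj C2" "K \<in> Obj C1" "k \<in> Arr C1" "Cod C1 k = ob G A"
  shows "ev M1 (ob G A) K \<cdot>\<^bsub>C1\<^esub> (zeta (A, K) \<otimes>\<^sub>a\<^bsub>M1\<^esub> k) =
    \<epsilon>' K \<cdot>\<^bsub>C1\<^esub> (ar G (ev M2 A (ob H K)) \<cdot>\<^bsub>C1\<^esub>
      (lam (A \<leadsto>\<^sub>o\<^bsub>M2\<^esub> ob H K, A) \<cdot>\<^bsub>C1\<^esub> (Id C1 (ob G (A \<leadsto>\<^sub>o\<^bsub>M2\<^esub> ob H K)) \<otimes>\<^sub>a\<^bsub>M1\<^esub> k)))"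
  using ev_zeta[of A K "Id C1 (ob G (A \<leadsto>\<^sub>o\<^bsub>M2\<^esub> ob H K))" k] assms by simp

text \<open>Evaluation turns the left side into \<open>g \<cdot> \<epsilon>'\<close> and the right
  side into \<open>\<epsilon>' \<cdot> G (H g)\<close>, each followed on the right by
  \<open>G ev \<cdot> G (id \<otimes> f) \<cdot> lam\<close>; naturality of
  \<open>\<epsilon>'\<close> identifies them. As the first variable is contravariant,
  \<open>zeta\<close> starts at \<open>Cod f\<close>.\<close>

lemma zeta_naturality:
  assumes f: "f \<in> Arr C2" and g: "g \<in> Arr C1"
  shows "(ar G f \<leadsto>\<^sub>a\<^bsub>M1\<^esub> g) \<cdot>\<^bsub>C1\<^esub> zeta (Cod C2 f, Dom C1 g) =
    zeta (Dom C2 f, Cod C1 g) \<cdot>\<^bsub>C1\<^esub> ar G (f \<leadsto>\<^sub>a\<^bsub>M2\<^esub> ar H g)"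
proof (rule M1.ihom_eqI[of "ob G (Dom C2 f)" "Cod C1 g"])
  let ?A = "Dom C2 f" and ?B = "Cod C2 f" and ?K = "Dom C1 g" and ?L = "Cod C1 g"
  have lam1: "lam (?B \<leadsto>\<^sub>o\<^bsub>M2\<^esub> ob H ?K, ?B) \<cdot>\<^bsub>C1\<^esub> (Id C1 (ob G (?B \<leadsto>\<^sub>o\<^bsub>M2\<^esub> ob H ?K)) \<otimes>\<^sub>a\<^bsub>M1\<^esub> ar G f) =
      ar G (Id C2 (?B \<leadsto>\<^sub>o\<^bsub>M2\<^esub> ob H ?K) \<otimes>\<^sub>a\<^bsub>M2\<^esub> f) \<cdot>\<^bsub>C1\<^esub> lam (?B \<leadsto>\<^sub>o\<^bsub>M2\<^esub> ob H ?K, ?A)"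
    using lambda_naturality[OF _ _ refl refl, of "Id C2 (?B \<leadsto>\<^sub>o\<^bsub>M2\<^esub> ob H ?K)" f] f g by simp
  have lam2: "lam (?A \<leadsto>\<^sub>o\<^bsub>M2\<^esub> ob H ?L, ?A) \<cdot>\<^bsub>C1\<^esub> (ar G (f \<leadsto>\<^sub>a\<^bsub>M2\<^esub> ar H g) \<otimes>\<^sub>a\<^bsub>M1\<^esub> Id C1 (ob G ?A)) =
      ar G ((f \<leadsto>\<^sub>a\<^bsub>M2\<^esub> ar H g) \<otimes>\<^sub>a\<^bsub>M2\<^esub> Id C2 ?A) \<cdot>\<^bsub>C1\<^esub> lam (?B \<leadsto>\<^sub>o\<^bsub>M2\<^esub> ob H ?K, ?A)"
    using lambda_naturality[OF _ _ refl refl, of "f \<leadsto>\<^sub>a\<^bsub>M2\<^esub> ar H g" "Id C2 ?A"] f g by simp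
  have ev: "ar G (ev M2 ?A (ob H ?L)) \<cdot>\<^bsub>C1\<^esub> ar G ((f \<leadsto>\<^sub>a\<^bsub>M2\<^esub> ar H g) \<otimes>\<^sub>a\<^bsub>M2\<^esub> Id C2 ?A) =
      ar G (ar H g) \<cdot>\<^bsub>C1\<^esub> (ar G (ev M2 ?B (ob H ?K)) \<cdot>\<^bsub>C1\<^esub> ar G (Id C2 (?B \<leadsto>\<^sub>o\<^bsub>M2\<^esub> ob H ?K) \<otimes>\<^sub>a\<^bsub>M2\<^esub> f))"
    using right.ar_eq[OF M2.ev_ihom[of f "ar H g" "Id C2 ?A"]] f g by simp
  show "ev M1 (ob G ?A) ?L \<cdot>\<^bsub>C1\<^esub> (((ar G f \<leadsto>\<^sub>a\<^bsub>M1\<^esub> g) \<cdot>\<^bsub>C1\<^esub> zeta (?B, ?K)) \<otimes>\<^sub>a\<^bsub>M1\<^esub> Id C1 (ob G ?A)) =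
      ev M1 (ob G ?A) ?L \<cdot>\<^bsub>C1\<^esub> ((zeta (?A, ?L) \<cdot>\<^bsub>C1\<^esub> ar G (f \<leadsto>\<^sub>a\<^bsub>M2\<^esub> ar H g)) \<otimes>\<^sub>a\<^bsub>M1\<^esub> Id C1 (ob G ?A))"
    using f g by (simp add: ev_zeta ev_zeta_Id M1.ev_ihom_Comp lam1 lam2 M1.tail[OF ev]
        M1.tail[OF second.eps_naturality])
qed (use f g in simp_all)

lemma zeta_nat_trans:
  "nat_trans (op_cat C2 \<times>\<^sub>C C1) C1 (G \<circ>\<^sub>F ihom M2 \<circ>\<^sub>F (id_func \<times>\<^sub>F H)) (ihom M1 \<circ>\<^sub>F (G \<times>\<^sub>F id_func)) zeta"
proof (rule nat_transI)
  show "cat_functor (op_cat C2 \<times>\<^sub>C C1) C1 (G \<circ>\<^sub>F ihom M2 \<circ>\<^sub>F (id_func \<times>\<^sub>F H))"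
    by (intro cat_functor_comp[OF cat_functor_comp[OF _ M2.ihom_functor] right.cat_functor_axioms]
        cat_functor_prod cat_functor_id category_op second.right.cat_functor_axioms M2.category_axioms)
  show "cat_functor (op_cat C2 \<times>\<^sub>C C1) C1 (ihom M1 \<circ>\<^sub>F (G \<times>\<^sub>F id_func))"
    by (intro cat_functor_comp[OF _ M1.ihom_functor] cat_functor_prod cat_functor_id cat_functor_op
        M1.category_axioms right.cat_functor_axioms)
qed (auto simp: zeta_naturality)

lemma zeta_bidual:
  assumes A: "A \<in> Obj C2" and K: "K \<in> Obj C1"
  shows "zeta (A \<leadsto>\<^sub>o\<^bsub>M2\<^esub> ob H K, K) \<cdot>\<^bsub>C1\<^esub> ar G (bidual_map C2 M2 (ob H K) A) =
    (zeta (A, K) \<leadsto>\<^sub>a\<^bsub>M1\<^esub> Id C1 K) \<cdot>\<^bsub>C1\<^esub> bidual_map C1 M1 K (ob G A)"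
proof (rule M1.ihom_eqI[of "ob G (A \<leadsto>\<^sub>o\<^bsub>M2\<^esub> ob H K)" K])
  let ?D = "A \<leadsto>\<^sub>o\<^bsub>M2\<^esub> ob H K" and ?\<omega> = "bidual_map C2 M2 (ob H K) A"
  have D: "?D \<in> Obj C2" using A K by simp
  have lam: "lam (?D \<leadsto>\<^sub>o\<^bsub>M2\<^esub> ob H K, ?D) \<cdot>\<^bsub>C1\<^esub> (ar G ?\<omega> \<otimes>\<^sub>a\<^bsub>M1\<^esub> Id C1 (ob G ?D)) =
      ar G (?\<omega> \<otimes>\<^sub>a\<^bsub>M2\<^esub> Id C2 ?D) \<cdot>\<^bsub>C1\<^esub> lam (A, ?D)"
    using lambda_naturality[OF _ _ refl refl, of ?\<omega> "Id C2 ?D"] A D K by simp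
  \<comment> \<open>Under \<open>G\<close>, the evaluated bidual map of \<open>C2\<close> becomes an
    evaluation after the symmetry, ready to be exchanged with \<open>lam\<close>.\<close>
  have ev: "ar G (ev M2 ?D (ob H K)) \<cdot>\<^bsub>C1\<^esub> ar G (?\<omega> \<otimes>\<^sub>a\<^bsub>M2\<^esub> Id C2 ?D) =
      ar G (ev M2 A (ob H K)) \<cdot>\<^bsub>C1\<^esub> ar G (symm M2 (A, ?D))"
    using right.ar_eq[OF M2.ev_bidual_map_Id[of A "ob H K" "Id C2 ?D"]] A D K by simp
  show "ev M1 (ob G ?D) K \<cdot>\<^bsub>C1\<^esub> ((zeta (?D, K) \<cdot>\<^bsub>C1\<^esub> ar G ?\<omega>) \<otimes>\<^sub>a\<^bsub>M1\<^esub> Id C1 (ob G ?D)) =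
      ev M1 (ob G ?D) K \<cdot>\<^bsub>C1\<^esub> (((zeta (A, K) \<leadsto>\<^sub>a\<^bsub>M1\<^esub> Id C1 K) \<cdot>\<^bsub>C1\<^esub> bidual_map C1 M1 K (ob G A)) \<otimes>\<^sub>a\<^bsub>M1\<^esub> Id C1 (ob G ?D))"
    using A D K by (simp add: ev_zeta M1.ev_ihom_Comp M1.ev_bidual_map_Id M1.tail[OF ev_zeta_Id] lam M1.tail[OF ev]
        lambda_symm)
qed (use A K in simp_all)

lemma zeta_dual_nat_trans:
  assumes K: "K \<in> Obj C1"
  shows "nat_trans (op_cat C2) C1 (G \<circ>\<^sub>F dual C2 M2 (ob H K)) (dual C1 M1 K \<circ>\<^sub>F G) (\<lambda>A. zeta (A, K))"
proof (rule nat_transI)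
  show "cat_functor (op_cat C2) C1 (G \<circ>\<^sub>F dual C2 M2 (ob H K))"
    by (rule cat_functor_comp[OF M2.dual_functor right.cat_functor_axioms]) (use K in simp)
  show "cat_functor (op_cat C2) C1 (dual C1 M1 K \<circ>\<^sub>F G)"
    by (intro cat_functor_comp[OF _ M1.dual_functor] cat_functor_op right.cat_functor_axioms K)
  fix f assume "f \<in> Arr (op_cat C2)"
  then show "ar (dual C1 M1 K \<circ>\<^sub>F G) f \<cdot>\<^bsub>C1\<^esub> zeta (Dom (op_cat C2) f, K) =
      zeta (Cod (op_cat C2) f, K) \<cdot>\<^bsub>C1\<^esub> ar (G \<circ>\<^sub>F dual C2 M2 (ob H K)) f"
    using zeta_naturality[of f "Id C1 K"] K by simp
qed (use K in auto)

lemma zeta_duality_preserving: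
  assumes K: "K \<in> Obj C1"
  shows "duality_preserving_functor
    C2 (dual C2 M2 (ob H K)) (bidual_map C2 M2 (ob H K)) C1 (dual C1 M1 K) (bidual_map C1 M1 K) G (\<lambda>A. zeta (A, K))"
  by (intro duality_preserving_functor.intro duality_preserving_functor_axioms.intro
      M1.category_with_duality_dual M2.category_with_duality_dual right.cat_functor_axioms zeta_dual_nat_trans)
    (use K zeta_bidual in simp_all)

end

section \<open>The suspended structure of a duality\<close>

context suspended_symmetric_monoidal_closed_category
begin

lemma tp_iso [simp]:
  "A \<in> Obj C \<Longrightarrow> B \<in> Obj C \<Longrightarrow> iso_arr C (tp1 (A, B))" "A \<in> Obj C \<Longrightarrow> B \<in> Obj C \<Longrightarrow> iso_arr C (tp2 (A, B))"
  using first_iso.component_iso second_iso.component_iso by simp_all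

lemma tp_simps [simp]:
  assumes "A \<in> Obj C" "B \<in> Obj C"
  shows "tp1 (A, B) \<in> Arr C" "Dom C (tp1 (A, B)) = ob (Susp S) A \<otimes>\<^sub>o\<^bsub>M\<^esub> B"
    "Cod C (tp1 (A, B)) = ob (Susp S) (A \<otimes>\<^sub>o\<^bsub>M\<^esub> B)"
    "tp2 (A, B) \<in> Arr C" "Dom C (tp2 (A, B)) = A \<otimes>\<^sub>o\<^bsub>M\<^esub> ob (Susp S) B"
    "Cod C (tp2 (A, B)) = ob (Susp S) (A \<otimes>\<^sub>o\<^bsub>M\<^esub> B)"
  using assms by simp_all

lemma tp1_naturality:
  "f \<in> Arr C \<Longrightarrow> g \<in> Arr C \<Longrightarrow> Dom C f = A \<Longrightarrow> Dom C g = B \<Longrightarrow>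
    ar (Susp S) (f \<otimes>\<^sub>a\<^bsub>M\<^esub> g) \<cdot> tp1 (A, B) = tp1 (Cod C f, Cod C g) \<cdot> (ar (Susp S) f \<otimes>\<^sub>a\<^bsub>M\<^esub> g)"
  using first_iso.naturality_Dom[of "(f, g)" "(A, B)"] by simp

lemma tp2_naturality:
  "f \<in> Arr C \<Longrightarrow> g \<in> Arr C \<Longrightarrow> Dom C f = A \<Longrightarrow> Dom C g = B \<Longrightarrow>
    ar (Susp S) (f \<otimes>\<^sub>a\<^bsub>M\<^esub> g) \<cdot> tp2 (A, B) = tp2 (Cod C f, Cod C g) \<cdot> (f \<otimes>\<^sub>a\<^bsub>M\<^esub> ar (Susp S) g)"
  using second_iso.naturality_Dom[of "(f, g)" "(A, B)"] by simp

lemma inv_tp1_naturality: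
  "f \<in> Arr C \<Longrightarrow> g \<in> Arr C \<Longrightarrow> Cod C f = A \<Longrightarrow> Cod C g = B \<Longrightarrow>
    inv_arr C (tp1 (A, B)) \<cdot> ar (Susp S) (f \<otimes>\<^sub>a\<^bsub>M\<^esub> g) =
      (ar (Susp S) f \<otimes>\<^sub>a\<^bsub>M\<^esub> g) \<cdot> inv_arr C (tp1 (Dom C f, Dom C g))"
  using first_iso.naturality_inv[of "(f, g)"] by simp

text \<open>The suspension moves from the second factor to the first, from
  \<open>X \<otimes> T B\<close> to \<open>T X \<otimes> B\<close>.\<close>

definition swap12 :: "'o \<Rightarrow> 'o \<Rightarrow> 'a" where
  "swap12 X B = inv_arr C (tp1 (X, B)) \<cdot> tp2 (X, B)"

lemma swap12_simps [simp]:
  assumes "X \<in> Obj C" "B \<in> Obj C"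
  shows "swap12 X B \<in> Arr C" "Dom C (swap12 X B) = X \<otimes>\<^sub>o\<^bsub>M\<^esub> ob (Susp S) B"
    "Cod C (swap12 X B) = ob (Susp S) X \<otimes>\<^sub>o\<^bsub>M\<^esub> B" "iso_arr C (swap12 X B)"
  using assms by (simp_all add: swap12_def iso_arr_Comp iso_arr_inv_arr)

lemma tp1_swap12: "X \<in> Obj C \<Longrightarrow> B \<in> Obj C \<Longrightarrow> tp1 (X, B) \<cdot> swap12 X B = tp2 (X, B)"
  by (simp add: swap12_def)

text \<open>The arrow \<open>g\<close> is the suspension of its desuspension, so naturality of
  \<open>tp2\<close> applies to it; naturality of the inverse of \<open>tp1\<close> does the
  rest.\<close>

lemma swap12_naturality:
  assumes "f \<in> Arr C" "g \<in> Arr C" "Cod C f = X" "Cod C g = ob (Susp S) B" "B \<in> Obj C"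
  shows "swap12 X B \<cdot> (f \<otimes>\<^sub>a\<^bsub>M\<^esub> g) =
    (ar (Susp S) f \<otimes>\<^sub>a\<^bsub>M\<^esub> ar (Desusp S) g) \<cdot> swap12 (Dom C f) (ob (Desusp S) (Dom C g))"
proof -
  have X: "X \<in> Obj C" using assms by auto
  have "swap12 X B \<cdot> (f \<otimes>\<^sub>a\<^bsub>M\<^esub> g) =
      inv_arr C (tp1 (X, B)) \<cdot> (ar (Susp S) (f \<otimes>\<^sub>a\<^bsub>M\<^esub> ar (Desusp S) g) \<cdot> tp2 (Dom C f, ob (Desusp S) (Dom C g)))"
    using assms X by (simp add: swap12_def tp2_naturality)
  also have "\<dots> = (ar (Susp S) f \<otimes>\<^sub>a\<^bsub>M\<^esub> ar (Desusp S) g) \<cdot> swap12 (Dom C f) (ob (Desusp S) (Dom C g))"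
    using assms X by (simp add: swap12_def tail[OF inv_tp1_naturality])
  finally show ?thesis .
qed

abbreviation th1 where "th1 \<equiv> ihom_susp1 C M S tp1 tp2"

text \<open>The equation prescribes the evaluation of the desuspended \<open>h\<close>: existence is
  transposition, and uniqueness follows from \<open>ihom_eqI\<close> and injectivity of
  desuspension.\<close>

lemma th1_characterization:
  assumes A: "A \<in> Obj C" and K: "K \<in> Obj C"
  shows "th1 A K \<in> Hom C (ob (Desusp S) A \<leadsto>\<^sub>o\<^bsub>M\<^esub> K) (ob (Susp S) (A \<leadsto>\<^sub>o\<^bsub>M\<^esub> K)) \<and>
    ev M A K \<cdot> (ar (Desusp S) (th1 A K) \<otimes>\<^sub>a\<^bsub>M\<^esub> Id C A) =
    ev M (ob (Desusp S) A) K \<cdot> swap12 (ob (Desusp S) (ob (Desusp S) A \<leadsto>\<^sub>o\<^bsub>M\<^esub> K)) (ob (Desusp S) A)"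
proof -
  let ?B = "ob (Desusp S) A"
  let ?X = "ob (Desusp S) (?B \<leadsto>\<^sub>o\<^bsub>M\<^esub> K)"
  let ?r = "ev M ?B K \<cdot> swap12 ?X ?B"
  let ?P = "\<lambda>h. h \<in> Hom C (?B \<leadsto>\<^sub>o\<^bsub>M\<^esub> K) (ob (Susp S) (A \<leadsto>\<^sub>o\<^bsub>M\<^esub> K)) \<and>
    ev M A K \<cdot> (ar (Desusp S) h \<otimes>\<^sub>a\<^bsub>M\<^esub> Id C A) = ?r"
  have B: "?B \<in> Obj C" "?X \<in> Obj C" using A K by simp_all
  have th1_def: "th1 A K = (THE h. ?P h)"
    using B A K by (simp add: ihom_susp1_def Let_def swap12_def)
  have r: "?r \<in> Arr C" "Dom C ?r = ?X \<otimes>\<^sub>o\<^bsub>M\<^esub> A" "Cod C ?r = K" using A K B by simp_all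
  \<comment> \<open>The transpose of \<open>?r\<close>; its suspension satisfies the
    description.\<close>
  let ?h = "(Id C A \<leadsto>\<^sub>a\<^bsub>M\<^esub> ?r) \<cdot> coev M A ?X"
  have h: "?h \<in> Arr C" "Dom C ?h = ?X" "Cod C ?h = A \<leadsto>\<^sub>o\<^bsub>M\<^esub> K" using A B r by simp_all
  have "ev M A K \<cdot> (?h \<otimes>\<^sub>a\<^bsub>M\<^esub> Id C A) = ?r"
  proof -
    have "ev M A K \<cdot> (?h \<otimes>\<^sub>a\<^bsub>M\<^esub> Id C A) = ?r \<cdot> (ev M A (?X \<otimes>\<^sub>o\<^bsub>M\<^esub> A) \<cdot> (coev M A ?X \<otimes>\<^sub>a\<^bsub>M\<^esub> Id C A))"
      using ev_ihom_Comp[of "Id C A" ?r "Id C A" "coev M A ?X"] A B r by simp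
    then show ?thesis
      using ev_coev[of A "Id C ?X" "Id C A"] A B r by simp
  qed
  then have P: "?P (ar (Susp S) ?h)"
    using h A K B by (simp add: Hom_iff del: first.susp.ar_Comp_simp)
  have unique: "h' = h''" if "?P h'" "?P h''" for h' h''
  proof (rule first.Desusp_inject[OF ihom_eqI[of A K]])
    show "ev M A K \<cdot> (ar (Desusp S) h' \<otimes>\<^sub>a\<^bsub>M\<^esub> Id C A) = ev M A K \<cdot> (ar (Desusp S) h'' \<otimes>\<^sub>a\<^bsub>M\<^esub> Id C A)"
      using that by metis
  qed (use that A K in \<open>simp_all add: Hom_iff\<close>)
  show ?thesis
    unfolding th1_def by (rule theI[of ?P, OF P unique[OF _ P]])
qed

lemma th1_simps [simp]:
  assumes "A \<in> Obj C" "K \<in> Obj C"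
  shows "th1 A K \<in> Arr C" "Dom C (th1 A K) = ob (Desusp S) A \<leadsto>\<^sub>o\<^bsub>M\<^esub> K"
    "Cod C (th1 A K) = ob (Susp S) (A \<leadsto>\<^sub>o\<^bsub>M\<^esub> K)"
  using th1_characterization[OF assms] by (simp_all add: Hom_iff)

lemma ev_th1:
  assumes A: "A \<in> Obj C" and K: "K \<in> Obj C" and "h \<in> Arr C" "k \<in> Arr C" "Cod C k = A"
    "Cod C h = ob (Desusp S) (ob (Desusp S) A \<leadsto>\<^sub>o\<^bsub>M\<^esub> K)"
  shows "ev M A K \<cdot> ((ar (Desusp S) (th1 A K) \<cdot> h) \<otimes>\<^sub>a\<^bsub>M\<^esub> k) =
    ev M (ob (Desusp S) A) K \<cdot> ((ar (Susp S) h \<otimes>\<^sub>a\<^bsub>M\<^esub> ar (Desusp S) k) \<cdot> swap12 (Dom C h) (ob (Desusp S) (Dom C k)))"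
proof -
  have "ev M A K \<cdot> ((ar (Desusp S) (th1 A K) \<cdot> h) \<otimes>\<^sub>a\<^bsub>M\<^esub> k) =
      ev M A K \<cdot> ((ar (Desusp S) (th1 A K) \<otimes>\<^sub>a\<^bsub>M\<^esub> Id C A) \<cdot> (h \<otimes>\<^sub>a\<^bsub>M\<^esub> k))"
    using assms by simp
  also have "\<dots> = (ev M A K \<cdot> (ar (Desusp S) (th1 A K) \<otimes>\<^sub>a\<^bsub>M\<^esub> Id C A)) \<cdot> (h \<otimes>\<^sub>a\<^bsub>M\<^esub> k)"
    by (rule assoc[symmetric]) (use assms in simp_all)
  also have "\<dots> = ev M (ob (Desusp S) A) K \<cdot> ((ar (Susp S) h \<otimes>\<^sub>a\<^bsub>M\<^esub> ar (Desusp S) k) \<cdot> swap12 (Dom C h) (ob (Desusp S) (Dom C k)))"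
    using th1_characterization[OF A K] assms by (simp add: swap12_naturality)
  finally show ?thesis .
qed

lemma ev_th1_Id:
  assumes "A \<in> Obj C" "K \<in> Obj C" "k \<in> Arr C" "Cod C k = A"
  shows "ev M A K \<cdot> (ar (Desusp S) (th1 A K) \<otimes>\<^sub>a\<^bsub>M\<^esub> k) =
    ev M (ob (Desusp S) A) K \<cdot> ((Id C (ob (Desusp S) A \<leadsto>\<^sub>o\<^bsub>M\<^esub> K) \<otimes>\<^sub>a\<^bsub>M\<^esub> ar (Desusp S) k) \<cdot>
      swap12 (ob (Desusp S) (ob (Desusp S) A \<leadsto>\<^sub>o\<^bsub>M\<^esub> K)) (ob (Desusp S) (Dom C k)))"
  using ev_th1[of A K "Id C (ob (Desusp S) (ob (Desusp S) A \<leadsto>\<^sub>o\<^bsub>M\<^esub> K))" k] assms by simp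

text \<open>The inverse is the transpose of the same exchange run backwards: from
  \<open>T [A, K] \<otimes> B\<close> through the inverse of \<open>swap12\<close> to
  \<open>[A, K] \<otimes> A\<close>, then evaluation.\<close>

lemma th1_iso:
  assumes A: "A \<in> Obj C" and K: "K \<in> Obj C"
  shows "iso_arr C (th1 A K)"
proof -
  let ?B = "ob (Desusp S) A" and ?H = "A \<leadsto>\<^sub>o\<^bsub>M\<^esub> K"
  have B: "?B \<in> Obj C" "?H \<in> Obj C" using A K by simp_all
  let ?s = "ev M A K \<cdot> inv_arr C (swap12 ?H ?B)"
  let ?k = "(Id C ?B \<leadsto>\<^sub>a\<^bsub>M\<^esub> ?s) \<cdot> coev M ?B (ob (Susp S) ?H)"
  have s: "?s \<in> Arr C" "Dom C ?s = ob (Susp S) ?H \<otimes>\<^sub>o\<^bsub>M\<^esub> ?B" "Cod C ?s = K" using A B K by simp_all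
  have k: "?k \<in> Arr C" "Dom C ?k = ob (Susp S) ?H" "Cod C ?k = ?B \<leadsto>\<^sub>o\<^bsub>M\<^esub> K" using B s by simp_all
  have ev_k: "ev M ?B K \<cdot> ((?k \<cdot> x) \<otimes>\<^sub>a\<^bsub>M\<^esub> Id C ?B) = ?s \<cdot> (x \<otimes>\<^sub>a\<^bsub>M\<^esub> Id C ?B)"
    if x: "x \<in> Arr C" "Cod C x = ob (Susp S) ?H" for x
  proof -
    have "ev M ?B K \<cdot> ((?k \<cdot> x) \<otimes>\<^sub>a\<^bsub>M\<^esub> Id C ?B) =
        ev M ?B K \<cdot> (((Id C ?B \<leadsto>\<^sub>a\<^bsub>M\<^esub> ?s) \<cdot> (coev M ?B (ob (Susp S) ?H) \<cdot> x)) \<otimes>\<^sub>a\<^bsub>M\<^esub> Id C ?B)"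
      using x B s by (subst assoc) simp_all
    also have "\<dots> = ?s \<cdot> (ev M ?B (ob (Susp S) ?H \<otimes>\<^sub>o\<^bsub>M\<^esub> ?B) \<cdot> ((coev M ?B (ob (Susp S) ?H) \<cdot> x) \<otimes>\<^sub>a\<^bsub>M\<^esub> Id C ?B))"
      using ev_ihom_Comp[of "Id C ?B" ?s "Id C ?B" "coev M ?B (ob (Susp S) ?H) \<cdot> x"] x B s by simp
    also have "\<dots> = ?s \<cdot> (x \<otimes>\<^sub>a\<^bsub>M\<^esub> Id C ?B)"
      using ev_coev[of ?B x "Id C ?B"] x B by simp
    finally show ?thesis .
  qed
  have ev_k1: "ev M ?B K \<cdot> (?k \<otimes>\<^sub>a\<^bsub>M\<^esub> Id C ?B) = ?s"
    using ev_k[of "Id C (ob (Susp S) ?H)"] s B k by (simp del: assoc)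
  show ?thesis
  proof (rule iso_arrI[of _ ?k])
    show "?k \<cdot> th1 A K = Id C (Dom C (th1 A K))"
    proof (rule ihom_eqI[of ?B K])
      let ?h = "ar (Desusp S) (th1 A K)" and ?X = "ob (Desusp S) (?B \<leadsto>\<^sub>o\<^bsub>M\<^esub> K)"
      have h: "?h \<in> Arr C" "Dom C ?h = ?X" "Cod C ?h = ?H" "?X \<in> Obj C" using A B K by simp_all
      have eq: "inv_arr C (swap12 ?H ?B) \<cdot> (th1 A K \<otimes>\<^sub>a\<^bsub>M\<^esub> Id C ?B) = (?h \<otimes>\<^sub>a\<^bsub>M\<^esub> Id C A) \<cdot> inv_arr C (swap12 ?X ?B)"
        by (rule inv_arr_swap)
          (use swap12_naturality[of ?h "Id C A" ?H ?B] A B K h in simp_all)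
      have "ev M ?B K \<cdot> ((?k \<cdot> th1 A K) \<otimes>\<^sub>a\<^bsub>M\<^esub> Id C ?B) = ev M A K \<cdot> (inv_arr C (swap12 ?H ?B) \<cdot> (th1 A K \<otimes>\<^sub>a\<^bsub>M\<^esub> Id C ?B))"
        using ev_k[of "th1 A K"] A B K by simp
      also have "\<dots> = (ev M A K \<cdot> (?h \<otimes>\<^sub>a\<^bsub>M\<^esub> Id C A)) \<cdot> inv_arr C (swap12 ?X ?B)"
        unfolding eq using A B K h by simp
      also have "\<dots> = ev M ?B K"
        using th1_characterization[OF A K] A B K h by simp
      finally show "ev M ?B K \<cdot> ((?k \<cdot> th1 A K) \<otimes>\<^sub>a\<^bsub>M\<^esub> Id C ?B) =
          ev M ?B K \<cdot> (Id C (Dom C (th1 A K)) \<otimes>\<^sub>a\<^bsub>M\<^esub> Id C ?B)"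
        using A B K by simp
    qed (use A B K k in \<open>simp_all del: assoc\<close>)
    show "th1 A K \<cdot> ?k = Id C (Cod C (th1 A K))"
    proof (rule first.Desusp_inject[OF ihom_eqI[of A K]])
      have "ev M A K \<cdot> (ar (Desusp S) (th1 A K \<cdot> ?k) \<otimes>\<^sub>a\<^bsub>M\<^esub> Id C A) =
          ev M A K \<cdot> ((ar (Desusp S) (th1 A K) \<cdot> ar (Desusp S) ?k) \<otimes>\<^sub>a\<^bsub>M\<^esub> Id C A)"
        using k A K by (subst first.desusp.ar_Comp_simp) simp_all
      also have "\<dots> = ev M ?B K \<cdot> ((?k \<otimes>\<^sub>a\<^bsub>M\<^esub> Id C ?B) \<cdot> swap12 ?H ?B)"
        using k A B K by (subst ev_th1) (simp_all del: first.desusp.ar_Comp_simp assoc)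
      also have "\<dots> = (ev M ?B K \<cdot> (?k \<otimes>\<^sub>a\<^bsub>M\<^esub> Id C ?B)) \<cdot> swap12 ?H ?B"
        using k A B K by (intro assoc[symmetric]) (simp_all del: assoc)
      also have "\<dots> = ev M A K"
        unfolding ev_k1 using A B K by simp
      finally show "ev M A K \<cdot> (ar (Desusp S) (th1 A K \<cdot> ?k) \<otimes>\<^sub>a\<^bsub>M\<^esub> Id C A) =
          ev M A K \<cdot> (ar (Desusp S) (Id C (Cod C (th1 A K))) \<otimes>\<^sub>a\<^bsub>M\<^esub> Id C A)"
        using A B K by simp
    qed (use k A B K in \<open>simp_all del: assoc first.desusp.ar_Comp_simp\<close>)
  qed (use k A B K in \<open>simp_all del: assoc\<close>)
qed

text \<open>Desuspended and evaluated at \<open>Dom f\<close>, both sides become evaluation on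
  \<open>T^- (Cod f)\<close> after the exchange and the desuspension of \<open>f\<close> in the
  second factor.\<close>

lemma th1_naturality:
  assumes f: "f \<in> Arr C" and K: "K \<in> Obj C"
  shows "ar (Susp S) (f \<leadsto>\<^sub>a\<^bsub>M\<^esub> Id C K) \<cdot> th1 (Cod C f) K =
    th1 (Dom C f) K \<cdot> (ar (Desusp S) f \<leadsto>\<^sub>a\<^bsub>M\<^esub> Id C K)"
  by (rule first.Desusp_inject[OF ihom_eqI[of "Dom C f" K]])
    (use f K in \<open>simp_all add: ev_th1 ev_th1_Id ev_ihom ev_ihom_Comp tail[OF ev_ihom]\<close>)

text \<open>The suspension of \<open>op_cat C\<close> is \<open>T^-\<close>, so a component has to
  go from \<open>[T^- A, K]\<close> to \<open>T [A, K]\<close>, as \<open>th1\<close> does.\<close>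

lemma dual_suspended:
  assumes K: "K \<in> Obj C"
  shows "suspended_functor (op_cat C) (op_susp S) C S (dual C M K) (\<lambda>A. th1 A K)"
  by (rule suspended_functorI)
    (use K th1_iso th1_naturality in \<open>auto intro: suspended_category_op first.suspended_category_axioms dual_functor\<close>)

lemma dual_susp_suspended:
  assumes K: "K \<in> Obj C"
  shows "suspended_functor C S (op_cat C) (op_susp S) (dual C M K) (dual_susp C M S tp1 tp2 K)"
proof -
  have "opposite_susp (op_susp S) S (\<lambda>A. th1 A K) = dual_susp C M S tp1 tp2 K"
    by (rule ext) (simp add: opposite_susp_def dual_susp_def)
  then show ?thesis
    using suspended_functor_op[OF dual_suspended[OF K]] by simp
qed

end

section \<open>Compatibility of lambda and zeta with suspensions\<close>

locale suspended_monoidal_adjoint_triple =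
  monoidal_adjoint_triple C1 M1 C2 M2 F \<alpha> \<upsilon> G \<eta> \<epsilon> H \<eta>' \<epsilon>' +
  S1: suspended_symmetric_monoidal_closed_category C1 M1 S1 tp1 tp2 +
  S2: suspended_symmetric_monoidal_closed_category C2 M2 S2 tq1 tq2 +
  SF: suspended_symmetric_monoidal_functor C1 M1 S1 tp1 tp2 C2 M2 S2 tq1 tq2 F \<alpha> \<upsilon> \<phi> +
  suspended_adjunction C1 S1 C2 S2 F \<phi> G \<eta> \<epsilon>
  for C1 :: "('o, 'a) cat" and M1 S1 tp1 tp2 and C2 :: "('p, 'b) cat" and M2 S2 tq1 tq2
    and F \<alpha> \<upsilon> \<phi> G \<eta> \<epsilon> H \<eta>' \<epsilon>'
begin

lemma inv_alpha_susp1: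
  assumes "A \<in> Obj C1" "B \<in> Obj C1"
  shows "ar (Susp S2) (inv_arr C2 (\<alpha> (A, B))) \<cdot>\<^bsub>C2\<^esub> (\<phi> (A \<otimes>\<^sub>o\<^bsub>M1\<^esub> B) \<cdot>\<^bsub>C2\<^esub> ar F (tp1 (A, B))) =
    tq1 (ob F A, ob F B) \<cdot>\<^bsub>C2\<^esub> ((\<phi> A \<otimes>\<^sub>a\<^bsub>M2\<^esub> Id C2 (ob F B)) \<cdot>\<^bsub>C2\<^esub> inv_arr C2 (\<alpha> (ob (Susp S1) A, B)))"
proof (rule M2.iso_cancel_right[of "\<alpha> (ob (Susp S1) A, B)"])
  \<comment> \<open>The first compatibility of \<open>\<alpha>\<close>; cancelling
    \<open>\<alpha>\<close> on the right and its suspension on the left gives the claim for the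
    inverse.\<close>
  have alpha: "(\<phi> (A \<otimes>\<^sub>o\<^bsub>M1\<^esub> B) \<cdot>\<^bsub>C2\<^esub> ar F (tp1 (A, B))) \<cdot>\<^bsub>C2\<^esub> \<alpha> (ob (Susp S1) A, B) =
      ar (Susp S2) (\<alpha> (A, B)) \<cdot>\<^bsub>C2\<^esub> (tq1 (ob F A, ob F B) \<cdot>\<^bsub>C2\<^esub> (\<phi> A \<otimes>\<^sub>a\<^bsub>M2\<^esub> Id C2 (ob F B)))"
    using SF.first_compatible[of A B] assms by simp
  have inv: "ar (Susp S2) (inv_arr C2 (\<alpha> (A, B))) \<cdot>\<^bsub>C2\<^esub> ar (Susp S2) (\<alpha> (A, B)) = Id C2 (ob (Susp S2) (ob F A \<otimes>\<^sub>o\<^bsub>M2\<^esub> ob F B))"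
    using S2.first.susp.ar_eq[of "inv_arr C2 (\<alpha> (A, B))" "\<alpha> (A, B)"] assms by simp
  show "(ar (Susp S2) (inv_arr C2 (\<alpha> (A, B))) \<cdot>\<^bsub>C2\<^esub> (\<phi> (A \<otimes>\<^sub>o\<^bsub>M1\<^esub> B) \<cdot>\<^bsub>C2\<^esub> ar F (tp1 (A, B)))) \<cdot>\<^bsub>C2\<^esub> \<alpha> (ob (Susp S1) A, B) =
      (tq1 (ob F A, ob F B) \<cdot>\<^bsub>C2\<^esub> ((\<phi> A \<otimes>\<^sub>a\<^bsub>M2\<^esub> Id C2 (ob F B)) \<cdot>\<^bsub>C2\<^esub> inv_arr C2 (\<alpha> (ob (Susp S1) A, B)))) \<cdot>\<^bsub>C2\<^esub> \<alpha> (ob (Susp S1) A, B)"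
    using assms alpha M2.tail[OF inv, of "tq1 (ob F A, ob F B) \<cdot>\<^bsub>C2\<^esub> (\<phi> A \<otimes>\<^sub>a\<^bsub>M2\<^esub> Id C2 (ob F B))"] by simp
qed (use assms in simp_all)

lemma inv_alpha_susp2:
  assumes "A \<in> Obj C1" "B \<in> Obj C1"
  shows "ar (Susp S2) (inv_arr C2 (\<alpha> (A, B))) \<cdot>\<^bsub>C2\<^esub> (\<phi> (A \<otimes>\<^sub>o\<^bsub>M1\<^esub> B) \<cdot>\<^bsub>C2\<^esub> ar F (tp2 (A, B))) =
    tq2 (ob F A, ob F B) \<cdot>\<^bsub>C2\<^esub> ((Id C2 (ob F A) \<otimes>\<^sub>a\<^bsub>M2\<^esub> \<phi> B) \<cdot>\<^bsub>C2\<^esub> inv_arr C2 (\<alpha> (A, ob (Susp S1) B)))"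
proof (rule M2.iso_cancel_right[of "\<alpha> (A, ob (Susp S1) B)"])
  have alpha: "(\<phi> (A \<otimes>\<^sub>o\<^bsub>M1\<^esub> B) \<cdot>\<^bsub>C2\<^esub> ar F (tp2 (A, B))) \<cdot>\<^bsub>C2\<^esub> \<alpha> (A, ob (Susp S1) B) =
      ar (Susp S2) (\<alpha> (A, B)) \<cdot>\<^bsub>C2\<^esub> (tq2 (ob F A, ob F B) \<cdot>\<^bsub>C2\<^esub> (Id C2 (ob F A) \<otimes>\<^sub>a\<^bsub>M2\<^esub> \<phi> B))"
    using SF.second_compatible[of A B] assms by simp
  have inv: "ar (Susp S2) (inv_arr C2 (\<alpha> (A, B))) \<cdot>\<^bsub>C2\<^esub> ar (Susp S2) (\<alpha> (A, B)) = Id C2 (ob (Susp S2) (ob F A \<otimes>\<^sub>o\<^bsub>M2\<^esub> ob F B))"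
    using S2.first.susp.ar_eq[of "inv_arr C2 (\<alpha> (A, B))" "\<alpha> (A, B)"] assms by simp
  show "(ar (Susp S2) (inv_arr C2 (\<alpha> (A, B))) \<cdot>\<^bsub>C2\<^esub> (\<phi> (A \<otimes>\<^sub>o\<^bsub>M1\<^esub> B) \<cdot>\<^bsub>C2\<^esub> ar F (tp2 (A, B)))) \<cdot>\<^bsub>C2\<^esub> \<alpha> (A, ob (Susp S1) B) =
      (tq2 (ob F A, ob F B) \<cdot>\<^bsub>C2\<^esub> ((Id C2 (ob F A) \<otimes>\<^sub>a\<^bsub>M2\<^esub> \<phi> B) \<cdot>\<^bsub>C2\<^esub> inv_arr C2 (\<alpha> (A, ob (Susp S1) B)))) \<cdot>\<^bsub>C2\<^esub> \<alpha> (A, ob (Susp S1) B)"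
    using assms alpha M2.tail[OF inv, of "tq2 (ob F A, ob F B) \<cdot>\<^bsub>C2\<^esub> (Id C2 (ob F A) \<otimes>\<^sub>a\<^bsub>M2\<^esub> \<phi> B)"] by simp
qed (use assms in simp_all)

text \<open>The suspended transpose of either side is
  \<open>tq1 \<cdot> (\<epsilon> \<otimes> \<epsilon>)\<close> after the inverse of
  \<open>\<alpha>\<close>: the left side by the equation of \<open>right_susp\<close> at the tensor
  product, the right side by that of \<open>\<alpha>\<close> and then of
  \<open>right_susp A\<close>.\<close>

lemma lambda_susp1:
  assumes "A \<in> Obj C2" "B \<in> Obj C2"
  shows "right_susp (A \<otimes>\<^sub>o\<^bsub>M2\<^esub> B) \<cdot>\<^bsub>C1\<^esub> (ar G (tq1 (A, B)) \<cdot>\<^bsub>C1\<^esub> lam (ob (Susp S2) A, B)) =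
    ar (Susp S1) (lam (A, B)) \<cdot>\<^bsub>C1\<^esub> (tp1 (ob G A, ob G B) \<cdot>\<^bsub>C1\<^esub> (right_susp A \<otimes>\<^sub>a\<^bsub>M1\<^esub> Id C1 (ob G B)))"
proof (rule susp_transpose_inject[of "A \<otimes>\<^sub>o\<^bsub>M2\<^esub> B"])
  let ?T = "\<lambda>h. ar (Susp S2) (\<epsilon> (A \<otimes>\<^sub>o\<^bsub>M2\<^esub> B)) \<cdot>\<^bsub>C2\<^esub> (\<phi> (ob G (A \<otimes>\<^sub>o\<^bsub>M2\<^esub> B)) \<cdot>\<^bsub>C2\<^esub> ar F h)"
  let ?GA = "ob G A" and ?GB = "ob G B"
  have eps: "ar (Susp S2) (\<epsilon> (A \<otimes>\<^sub>o\<^bsub>M2\<^esub> B)) \<cdot>\<^bsub>C2\<^esub> ar (Susp S2) (ar F (lam (A, B))) =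
      ar (Susp S2) (\<epsilon> A \<otimes>\<^sub>a\<^bsub>M2\<^esub> \<epsilon> B) \<cdot>\<^bsub>C2\<^esub> ar (Susp S2) (inv_arr C2 (\<alpha> (?GA, ?GB)))"
    using S2.first.susp.ar_eq[OF lambda_transpose] assms by simp
  have "?T (ar (Susp S1) (lam (A, B)) \<cdot>\<^bsub>C1\<^esub> (tp1 (?GA, ?GB) \<cdot>\<^bsub>C1\<^esub> (right_susp A \<otimes>\<^sub>a\<^bsub>M1\<^esub> Id C1 ?GB))) =
      ar (Susp S2) (\<epsilon> A \<otimes>\<^sub>a\<^bsub>M2\<^esub> \<epsilon> B) \<cdot>\<^bsub>C2\<^esub> ((ar (Susp S2) (inv_arr C2 (\<alpha> (?GA, ?GB))) \<cdot>\<^bsub>C2\<^esub>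
        (\<phi> (?GA \<otimes>\<^sub>o\<^bsub>M1\<^esub> ?GB) \<cdot>\<^bsub>C2\<^esub> ar F (tp1 (?GA, ?GB)))) \<cdot>\<^bsub>C2\<^esub> ar F (right_susp A \<otimes>\<^sub>a\<^bsub>M1\<^esub> Id C1 ?GB))"
    using assms by (simp add: M2.tail[OF SF.structure_naturality] M2.tail[OF eps])
  also have "\<dots> = tq1 (A, B) \<cdot>\<^bsub>C2\<^esub> ((\<epsilon> (ob (Susp S2) A) \<otimes>\<^sub>a\<^bsub>M2\<^esub> \<epsilon> B) \<cdot>\<^bsub>C2\<^esub> inv_arr C2 (\<alpha> (ob G (ob (Susp S2) A), ?GB)))"
    unfolding inv_alpha_susp1[OF right.ob_Obj[OF assms(1)] right.ob_Obj[OF assms(2)]]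
    using assms by (simp add: inv_alpha_naturality M2.tail[OF S2.tp1_naturality])
  also have "\<dots> = ?T (right_susp (A \<otimes>\<^sub>o\<^bsub>M2\<^esub> B) \<cdot>\<^bsub>C1\<^esub> (ar G (tq1 (A, B)) \<cdot>\<^bsub>C1\<^esub> lam (ob (Susp S2) A, B)))"
    using assms by (simp add: M2.tail[OF eps_naturality] lambda_transpose)
  finally show "?T (right_susp (A \<otimes>\<^sub>o\<^bsub>M2\<^esub> B) \<cdot>\<^bsub>C1\<^esub> (ar G (tq1 (A, B)) \<cdot>\<^bsub>C1\<^esub> lam (ob (Susp S2) A, B))) =
      ?T (ar (Susp S1) (lam (A, B)) \<cdot>\<^bsub>C1\<^esub> (tp1 (?GA, ?GB) \<cdot>\<^bsub>C1\<^esub> (right_susp A \<otimes>\<^sub>a\<^bsub>M1\<^esub> Id C1 ?GB)))" ..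
qed (use assms in simp_all)

lemma lambda_susp2:
  assumes "A \<in> Obj C2" "B \<in> Obj C2"
  shows "right_susp (A \<otimes>\<^sub>o\<^bsub>M2\<^esub> B) \<cdot>\<^bsub>C1\<^esub> (ar G (tq2 (A, B)) \<cdot>\<^bsub>C1\<^esub> lam (A, ob (Susp S2) B)) =
    ar (Susp S1) (lam (A, B)) \<cdot>\<^bsub>C1\<^esub> (tp2 (ob G A, ob G B) \<cdot>\<^bsub>C1\<^esub> (Id C1 (ob G A) \<otimes>\<^sub>a\<^bsub>M1\<^esub> right_susp B))"
proof (rule susp_transpose_inject[of "A \<otimes>\<^sub>o\<^bsub>M2\<^esub> B"])
  let ?T = "\<lambda>h. ar (Susp S2) (\<epsilon> (A \<otimes>\<^sub>o\<^bsub>M2\<^esub> B)) \<cdot>\<^bsub>C2\<^esub> (\<phi> (ob G (A \<otimes>\<^sub>o\<^bsub>M2\<^esub> B)) \<cdot>\<^bsub>C2\<^esub> ar F h)"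
  let ?GA = "ob G A" and ?GB = "ob G B"
  have eps: "ar (Susp S2) (\<epsilon> (A \<otimes>\<^sub>o\<^bsub>M2\<^esub> B)) \<cdot>\<^bsub>C2\<^esub> ar (Susp S2) (ar F (lam (A, B))) =
      ar (Susp S2) (\<epsilon> A \<otimes>\<^sub>a\<^bsub>M2\<^esub> \<epsilon> B) \<cdot>\<^bsub>C2\<^esub> ar (Susp S2) (inv_arr C2 (\<alpha> (?GA, ?GB)))"
    using S2.first.susp.ar_eq[OF lambda_transpose] assms by simp
  have "?T (ar (Susp S1) (lam (A, B)) \<cdot>\<^bsub>C1\<^esub> (tp2 (?GA, ?GB) \<cdot>\<^bsub>C1\<^esub> (Id C1 ?GA \<otimes>\<^sub>a\<^bsub>M1\<^esub> right_susp B))) =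
      ar (Susp S2) (\<epsilon> A \<otimes>\<^sub>a\<^bsub>M2\<^esub> \<epsilon> B) \<cdot>\<^bsub>C2\<^esub> ((ar (Susp S2) (inv_arr C2 (\<alpha> (?GA, ?GB))) \<cdot>\<^bsub>C2\<^esub>
        (\<phi> (?GA \<otimes>\<^sub>o\<^bsub>M1\<^esub> ?GB) \<cdot>\<^bsub>C2\<^esub> ar F (tp2 (?GA, ?GB)))) \<cdot>\<^bsub>C2\<^esub> ar F (Id C1 ?GA \<otimes>\<^sub>a\<^bsub>M1\<^esub> right_susp B))"
    using assms by (simp add: M2.tail[OF SF.structure_naturality] M2.tail[OF eps])
  also have "\<dots> = tq2 (A, B) \<cdot>\<^bsub>C2\<^esub> ((\<epsilon> A \<otimes>\<^sub>a\<^bsub>M2\<^esub> \<epsilon> (ob (Susp S2) B)) \<cdot>\<^bsub>C2\<^esub> inv_arr C2 (\<alpha> (?GA, ob G (ob (Susp S2) B))))"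
    unfolding inv_alpha_susp2[OF right.ob_Obj[OF assms(1)] right.ob_Obj[OF assms(2)]]
    using assms by (simp add: inv_alpha_naturality M2.tail[OF S2.tp2_naturality])
  also have "\<dots> = ?T (right_susp (A \<otimes>\<^sub>o\<^bsub>M2\<^esub> B) \<cdot>\<^bsub>C1\<^esub> (ar G (tq2 (A, B)) \<cdot>\<^bsub>C1\<^esub> lam (A, ob (Susp S2) B)))"
    using assms by (simp add: M2.tail[OF eps_naturality] lambda_transpose)
  finally show "?T (right_susp (A \<otimes>\<^sub>o\<^bsub>M2\<^esub> B) \<cdot>\<^bsub>C1\<^esub> (ar G (tq2 (A, B)) \<cdot>\<^bsub>C1\<^esub> lam (A, ob (Susp S2) B))) =
      ?T (ar (Susp S1) (lam (A, B)) \<cdot>\<^bsub>C1\<^esub> (tp2 (?GA, ?GB) \<cdot>\<^bsub>C1\<^esub> (Id C1 ?GA \<otimes>\<^sub>a\<^bsub>M1\<^esub> right_susp B)))" ..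
qed (use assms in simp_all)

text \<open>Composition with the isomorphism \<open>right_susp \<cdot> G tq1\<close> absorbs both
  exchanges: the left side is then computed by \<open>lambda_susp2\<close> and the right side by
  \<open>lambda_susp1\<close>, with the common value \<open>T lam \<cdot> tp2\<close> after
  \<open>T^- (right_susp X) \<otimes> right_susp B\<close>.\<close>

lemma lambda_swap12:
  assumes X: "X \<in> Obj C2" and B: "B \<in> Obj C2"
  defines "Y \<equiv> ob (Desusp S1) (ob G (ob (Susp S2) X))"
  shows "ar G (S2.swap12 X B) \<cdot>\<^bsub>C1\<^esub> (lam (X, ob (Susp S2) B) \<cdot>\<^bsub>C1\<^esub>
      (ar (Desusp S1) (right_susp X) \<otimes>\<^sub>a\<^bsub>M1\<^esub> Id C1 (ob G (ob (Susp S2) B)))) =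
    lam (ob (Susp S2) X, B) \<cdot>\<^bsub>C1\<^esub> (S1.swap12 Y (ob G B) \<cdot>\<^bsub>C1\<^esub> (Id C1 Y \<otimes>\<^sub>a\<^bsub>M1\<^esub> right_susp B))"
    (is "?lhs = ?rhs")
proof -
  let ?GX = "ob G X" and ?GB = "ob G B" and ?TX = "ob (Susp S2) X" and ?TB = "ob (Susp S2) B"
  let ?c = "ar (Desusp S1) (right_susp X)" and ?I = "Id C1 (ob G (ob (Susp S2) B))"
  let ?r = "right_susp (X \<otimes>\<^sub>o\<^bsub>M2\<^esub> B)" and ?l = "ar (Susp S1) (lam (X, B))"
  let ?y = "S1.swap12 Y ?GB \<cdot>\<^bsub>C1\<^esub> (Id C1 Y \<otimes>\<^sub>a\<^bsub>M1\<^esub> right_susp B)"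
  have Y: "Y \<in> Obj C1" "ob (Susp S1) Y = ob G ?TX" using X by (simp_all add: Y_def)
  have c: "?c \<in> Arr C1" "Dom C1 ?c = Y" "Cod C1 ?c = ?GX" using X by (simp_all add: Y_def)
  have tq: "ar G (tq1 (X, B)) \<cdot>\<^bsub>C1\<^esub> ar G (S2.swap12 X B) = ar G (tq2 (X, B))"
    by (rule right.ar_eq[OF S2.tp1_swap12]) (use X B in simp_all)
  have "(?r \<cdot>\<^bsub>C1\<^esub> (ar G (tq2 (X, B)) \<cdot>\<^bsub>C1\<^esub> lam (X, ?TB))) \<cdot>\<^bsub>C1\<^esub> (?c \<otimes>\<^sub>a\<^bsub>M1\<^esub> ?I) =
      (?l \<cdot>\<^bsub>C1\<^esub> (tp2 (?GX, ?GB) \<cdot>\<^bsub>C1\<^esub> (Id C1 ?GX \<otimes>\<^sub>a\<^bsub>M1\<^esub> right_susp B))) \<cdot>\<^bsub>C1\<^esub> (?c \<otimes>\<^sub>a\<^bsub>M1\<^esub> ?I)"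
    by (simp only: lambda_susp2[OF X B])
  then have lhs: "?r \<cdot>\<^bsub>C1\<^esub> (ar G (tq1 (X, B)) \<cdot>\<^bsub>C1\<^esub> ?lhs) = ?l \<cdot>\<^bsub>C1\<^esub> (tp2 (?GX, ?GB) \<cdot>\<^bsub>C1\<^esub> (?c \<otimes>\<^sub>a\<^bsub>M1\<^esub> right_susp B))"
    using X B c by (simp add: M1.tail[OF tq])
  have "(?r \<cdot>\<^bsub>C1\<^esub> (ar G (tq1 (X, B)) \<cdot>\<^bsub>C1\<^esub> lam (?TX, B))) \<cdot>\<^bsub>C1\<^esub> ?y =
      (?l \<cdot>\<^bsub>C1\<^esub> (tp1 (?GX, ?GB) \<cdot>\<^bsub>C1\<^esub> (right_susp X \<otimes>\<^sub>a\<^bsub>M1\<^esub> Id C1 ?GB))) \<cdot>\<^bsub>C1\<^esub> ?y"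
    by (simp only: lambda_susp1[OF X B])
  moreover have "(right_susp X \<otimes>\<^sub>a\<^bsub>M1\<^esub> Id C1 ?GB) \<cdot>\<^bsub>C1\<^esub> S1.swap12 Y ?GB =
      S1.swap12 ?GX ?GB \<cdot>\<^bsub>C1\<^esub> (?c \<otimes>\<^sub>a\<^bsub>M1\<^esub> Id C1 (ob (Susp S1) ?GB))"
    using S1.swap12_naturality[of ?c "Id C1 (ob (Susp S1) ?GB)" ?GX ?GB] X B c by simp
  ultimately have rhs: "?r \<cdot>\<^bsub>C1\<^esub> (ar G (tq1 (X, B)) \<cdot>\<^bsub>C1\<^esub> ?rhs) = ?l \<cdot>\<^bsub>C1\<^esub> (tp2 (?GX, ?GB) \<cdot>\<^bsub>C1\<^esub> (?c \<otimes>\<^sub>a\<^bsub>M1\<^esub> right_susp B))"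
    using X B c Y
      M1.tail[of "right_susp X \<otimes>\<^sub>a\<^bsub>M1\<^esub> Id C1 ?GB" "S1.swap12 Y ?GB"
        "S1.swap12 ?GX ?GB \<cdot>\<^bsub>C1\<^esub> (?c \<otimes>\<^sub>a\<^bsub>M1\<^esub> Id C1 (ob (Susp S1) ?GB))" "Id C1 Y \<otimes>\<^sub>a\<^bsub>M1\<^esub> right_susp B"]
    by (simp add: M1.tail[OF S1.tp1_swap12])
  show ?thesis
  proof (rule M1.iso_cancel_left[of "ar G (tq1 (X, B))"], rule right.iso_arr_ar)
    show "ar G (tq1 (X, B)) \<cdot>\<^bsub>C1\<^esub> ?lhs = ar G (tq1 (X, B)) \<cdot>\<^bsub>C1\<^esub> ?rhs"
      by (rule M1.iso_cancel_left[OF right_susp_iso[of "X \<otimes>\<^sub>o\<^bsub>M2\<^esub> B"]]) (use lhs rhs X B c Y in simp_all)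
  qed (use X B c Y in simp_all)
qed

text \<open>The two composite structures are \<open>right_susp \<cdot> G th1\<close> and
  \<open>th1\<close> after the map induced by \<open>T^- (right_susp B)\<close>. Desuspension makes
  \<open>th1\<close> accessible to evaluation, and both sides reduce to
  \<open>\<epsilon>' \<cdot> G ev \<cdot> lam\<close> after the exchange on
  \<open>T^- (G [B, H K]) \<otimes> G A\<close>.\<close>

lemma zeta_susp:
  assumes A: "A \<in> Obj C2" and K: "K \<in> Obj C1"
  defines "B \<equiv> ob (Desusp S2) A"
  shows "ar (Susp S1) (zeta (A, K)) \<cdot>\<^bsub>C1\<^esub> (right_susp (A \<leadsto>\<^sub>o\<^bsub>M2\<^esub> ob H K) \<cdot>\<^bsub>C1\<^esub> ar G (S2.th1 A (ob H K))) =
    S1.th1 (ob G A) K \<cdot>\<^bsub>C1\<^esub> ((ar (Desusp S1) (right_susp B) \<leadsto>\<^sub>a\<^bsub>M1\<^esub> Id C1 K) \<cdot>\<^bsub>C1\<^esub> zeta (B, K))"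
proof (rule S1.first.Desusp_inject[OF M1.ihom_eqI[of "ob G A" K]])
  let ?HK = "ob H K" and ?D = "A \<leadsto>\<^sub>o\<^bsub>M2\<^esub> ob H K" and ?E = "B \<leadsto>\<^sub>o\<^bsub>M2\<^esub> ob H K"
  let ?X = "ob (Desusp S2) ?E" and ?Y = "ob (Desusp S1) (ob G ?E)"
  let ?c = "ar (Desusp S1) (right_susp ?X)" and ?b = "ar (Desusp S1) (right_susp B)"
  let ?t = "ar (Desusp S2) (S2.th1 A ?HK)" and ?I = "Id C1 (ob G A)"
  let ?W = "ob (Desusp S1) (ob G A)" and ?m = "(?b \<leadsto>\<^sub>a\<^bsub>M1\<^esub> Id C1 K) \<cdot>\<^bsub>C1\<^esub> zeta (B, K)"
  have B: "B \<in> Obj C2" "ob (Susp S2) B = A" using A by (simp_all add: B_def)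
  have HK: "?HK \<in> Obj C2" using K by simp
  have E: "?E \<in> Obj C2" "?X \<in> Obj C2" "?D \<in> Obj C2" "?Y \<in> Obj C1" "?W \<in> Obj C1" using A B K by simp_all
  have t: "?t \<in> Arr C2" "Dom C2 ?t = ?X" "Cod C2 ?t = ?D" using A HK by (simp_all add: B_def)
  have c: "?c \<in> Arr C1" "Dom C1 ?c = ?Y" "Cod C1 ?c = ob G ?X" using E by simp_all
  have b: "?b \<in> Arr C1" "Dom C1 ?b = ?W" "Cod C1 ?b = ob G B" using B by simp_all
  \<comment> \<open>Naturality of \<open>right_susp\<close> at \<open>?t\<close>, whose suspension
    is \<open>th1\<close>, moves \<open>th1\<close> in front of the structure of
    \<open>G\<close>.\<close>
  have ct: "ar (Desusp S1) (right_susp ?D) \<cdot>\<^bsub>C1\<^esub> ar (Desusp S1) (ar G (S2.th1 A ?HK)) = ar G ?t \<cdot>\<^bsub>C1\<^esub> ?c"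
    using S1.first.desusp.ar_eq[OF right_susp_naturality[OF t(1), symmetric]] t E A HK by simp
  have lam_t: "lam (?D, A) \<cdot>\<^bsub>C1\<^esub> ((ar G ?t \<cdot>\<^bsub>C1\<^esub> ?c) \<otimes>\<^sub>a\<^bsub>M1\<^esub> ?I) =
      ar G (?t \<otimes>\<^sub>a\<^bsub>M2\<^esub> Id C2 A) \<cdot>\<^bsub>C1\<^esub> (lam (?X, A) \<cdot>\<^bsub>C1\<^esub> (?c \<otimes>\<^sub>a\<^bsub>M1\<^esub> ?I))"
  proof -
    have "lam (?D, A) \<cdot>\<^bsub>C1\<^esub> ((ar G ?t \<cdot>\<^bsub>C1\<^esub> ?c) \<otimes>\<^sub>a\<^bsub>M1\<^esub> ?I) =
        (lam (?D, A) \<cdot>\<^bsub>C1\<^esub> (ar G ?t \<otimes>\<^sub>a\<^bsub>M1\<^esub> ar G (Id C2 A))) \<cdot>\<^bsub>C1\<^esub> (?c \<otimes>\<^sub>a\<^bsub>M1\<^esub> ?I)"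
      using A E t c by simp
    also have "lam (?D, A) \<cdot>\<^bsub>C1\<^esub> (ar G ?t \<otimes>\<^sub>a\<^bsub>M1\<^esub> ar G (Id C2 A)) = ar G (?t \<otimes>\<^sub>a\<^bsub>M2\<^esub> Id C2 A) \<cdot>\<^bsub>C1\<^esub> lam (?X, A)"
      using lambda_naturality[of ?t "Id C2 A" ?D A] t A by simp
    finally show ?thesis using A E t c by simp
  qed
  have ev_t: "ar G (ev M2 A ?HK) \<cdot>\<^bsub>C1\<^esub> ar G (?t \<otimes>\<^sub>a\<^bsub>M2\<^esub> Id C2 A) =
      ar G (ev M2 B ?HK) \<cdot>\<^bsub>C1\<^esub> ar G (S2.swap12 ?X B)"
    using right.ar_eq[OF S2.th1_characterization[OF A HK, THEN conjunct2]] A B HK E t by (simp add: B_def)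
  have "ev M1 (ob G A) K \<cdot>\<^bsub>C1\<^esub> ((zeta (A, K) \<cdot>\<^bsub>C1\<^esub> (ar G ?t \<cdot>\<^bsub>C1\<^esub> ?c)) \<otimes>\<^sub>a\<^bsub>M1\<^esub> ?I) =
      \<epsilon>' K \<cdot>\<^bsub>C1\<^esub> (ar G (ev M2 B ?HK) \<cdot>\<^bsub>C1\<^esub> (ar G (S2.swap12 ?X B) \<cdot>\<^bsub>C1\<^esub> (lam (?X, A) \<cdot>\<^bsub>C1\<^esub> (?c \<otimes>\<^sub>a\<^bsub>M1\<^esub> ?I))))"
    using ev_zeta[of A K "ar G ?t \<cdot>\<^bsub>C1\<^esub> ?c" ?I] M1.tail[OF ev_t, of "lam (?X, A) \<cdot>\<^bsub>C1\<^esub> (?c \<otimes>\<^sub>a\<^bsub>M1\<^esub> ?I)"] lam_t A B HK E K t c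
    by simp
  also have "ar G (S2.swap12 ?X B) \<cdot>\<^bsub>C1\<^esub> (lam (?X, A) \<cdot>\<^bsub>C1\<^esub> (?c \<otimes>\<^sub>a\<^bsub>M1\<^esub> ?I)) =
      lam (?E, B) \<cdot>\<^bsub>C1\<^esub> (S1.swap12 ?Y (ob G B) \<cdot>\<^bsub>C1\<^esub> (Id C1 ?Y \<otimes>\<^sub>a\<^bsub>M1\<^esub> right_susp B))"
    using lambda_swap12[OF E(2) B(1)] B E by simp
  \<comment> \<open>Crossing the exchange, \<open>right_susp B\<close> loses one suspension and
    becomes \<open>?b\<close>, the arrow that occurs on the dual side.\<close>
  also have "S1.swap12 ?Y (ob G B) \<cdot>\<^bsub>C1\<^esub> (Id C1 ?Y \<otimes>\<^sub>a\<^bsub>M1\<^esub> right_susp B) =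
      (Id C1 (ob G ?E) \<otimes>\<^sub>a\<^bsub>M1\<^esub> ?b) \<cdot>\<^bsub>C1\<^esub> S1.swap12 ?Y ?W"
    using S1.swap12_naturality[of "Id C1 ?Y" "right_susp B" ?Y "ob G B"] B E by simp
  finally have L: "ev M1 (ob G A) K \<cdot>\<^bsub>C1\<^esub> ((zeta (A, K) \<cdot>\<^bsub>C1\<^esub> (ar G ?t \<cdot>\<^bsub>C1\<^esub> ?c)) \<otimes>\<^sub>a\<^bsub>M1\<^esub> ?I) =
      \<epsilon>' K \<cdot>\<^bsub>C1\<^esub> (ar G (ev M2 B ?HK) \<cdot>\<^bsub>C1\<^esub> (lam (?E, B) \<cdot>\<^bsub>C1\<^esub> ((Id C1 (ob G ?E) \<otimes>\<^sub>a\<^bsub>M1\<^esub> ?b) \<cdot>\<^bsub>C1\<^esub> S1.swap12 ?Y ?W)))" .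
  have m: "?m \<in> Arr C1" "Dom C1 ?m = ob G ?E" "Cod C1 ?m = ?W \<leadsto>\<^sub>o\<^bsub>M1\<^esub> K" using B b K by simp_all
  have ev_m: "ev M1 ?W K \<cdot>\<^bsub>C1\<^esub> (?m \<otimes>\<^sub>a\<^bsub>M1\<^esub> Id C1 ?W) =
      \<epsilon>' K \<cdot>\<^bsub>C1\<^esub> (ar G (ev M2 B ?HK) \<cdot>\<^bsub>C1\<^esub> (lam (?E, B) \<cdot>\<^bsub>C1\<^esub> (Id C1 (ob G ?E) \<otimes>\<^sub>a\<^bsub>M1\<^esub> ?b)))"
    using M1.ev_ihom_Comp[of ?b "Id C1 K" "Id C1 ?W" "zeta (B, K)" ?W K] ev_zeta_Id[of B K ?b] B b K E
    by simp
  have "ev M1 (ob G A) K \<cdot>\<^bsub>C1\<^esub> ((ar (Desusp S1) (S1.th1 (ob G A) K) \<cdot>\<^bsub>C1\<^esub> ar (Desusp S1) ?m) \<otimes>\<^sub>a\<^bsub>M1\<^esub> ?I) =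
      ev M1 ?W K \<cdot>\<^bsub>C1\<^esub> ((?m \<otimes>\<^sub>a\<^bsub>M1\<^esub> Id C1 ?W) \<cdot>\<^bsub>C1\<^esub> S1.swap12 ?Y ?W)"
    using m A K E by (subst S1.ev_th1) (simp_all del: S1.first.desusp.ar_Comp_simp)
  also have "\<dots> = (ev M1 ?W K \<cdot>\<^bsub>C1\<^esub> (?m \<otimes>\<^sub>a\<^bsub>M1\<^esub> Id C1 ?W)) \<cdot>\<^bsub>C1\<^esub> S1.swap12 ?Y ?W"
    by (rule M1.assoc[symmetric]) (use m A K E in simp_all)
  finally have R: "ev M1 (ob G A) K \<cdot>\<^bsub>C1\<^esub> ((ar (Desusp S1) (S1.th1 (ob G A) K) \<cdot>\<^bsub>C1\<^esub> ar (Desusp S1) ?m) \<otimes>\<^sub>a\<^bsub>M1\<^esub> ?I) =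
      \<epsilon>' K \<cdot>\<^bsub>C1\<^esub> (ar G (ev M2 B ?HK) \<cdot>\<^bsub>C1\<^esub> (lam (?E, B) \<cdot>\<^bsub>C1\<^esub> ((Id C1 (ob G ?E) \<otimes>\<^sub>a\<^bsub>M1\<^esub> ?b) \<cdot>\<^bsub>C1\<^esub> S1.swap12 ?Y ?W)))"
    unfolding ev_m using A B K HK E b by simp
  have LR: "ar (Desusp S1) (ar (Susp S1) (zeta (A, K)) \<cdot>\<^bsub>C1\<^esub> (right_susp ?D \<cdot>\<^bsub>C1\<^esub> ar G (S2.th1 A ?HK))) =
      zeta (A, K) \<cdot>\<^bsub>C1\<^esub> (ar G ?t \<cdot>\<^bsub>C1\<^esub> ?c)"
    "ar (Desusp S1) (S1.th1 (ob G A) K \<cdot>\<^bsub>C1\<^esub> ?m) = ar (Desusp S1) (S1.th1 (ob G A) K) \<cdot>\<^bsub>C1\<^esub> ar (Desusp S1) ?m"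
    using A K HK E B ct m S1.first.desusp.ar_Comp_simp[of ?m "S1.th1 (ob G A) K"] by (simp_all add: B_def)
  show "ev M1 (ob G A) K \<cdot>\<^bsub>C1\<^esub> (ar (Desusp S1) (ar (Susp S1) (zeta (A, K)) \<cdot>\<^bsub>C1\<^esub>
        (right_susp ?D \<cdot>\<^bsub>C1\<^esub> ar G (S2.th1 A ?HK))) \<otimes>\<^sub>a\<^bsub>M1\<^esub> ?I) =
      ev M1 (ob G A) K \<cdot>\<^bsub>C1\<^esub> (ar (Desusp S1) (S1.th1 (ob G A) K \<cdot>\<^bsub>C1\<^esub> ?m) \<otimes>\<^sub>a\<^bsub>M1\<^esub> ?I)"
    by (simp only: LR L R)
qed (use A K in \<open>simp_all add: B_def\<close>)

lemma zeta_suspended_duality_preserving: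
  assumes K: "K \<in> Obj C1"
  shows "suspended_duality_preserving_functor
    C2 S2 (dual C2 M2 (ob H K)) (dual_susp C2 M2 S2 tq1 tq2 (ob H K)) (bidual_map C2 M2 (ob H K))
    C1 S1 (dual C1 M1 K) (dual_susp C1 M1 S1 tp1 tp2 K) (bidual_map C1 M1 K)
    G right_susp (\<lambda>A. zeta (A, K))"
proof (intro suspended_duality_preserving_functor.intro zeta_duality_preserving right_susp_suspended
    S1.dual_susp_suspended S2.dual_susp_suspended)
  let ?d2 = "opposite_susp S2 (op_susp S2) (dual_susp C2 M2 S2 tq1 tq2 (ob H K))"
  let ?d1 = "opposite_susp S1 (op_susp S1) (dual_susp C1 M1 S1 tp1 tp2 K)"
  have HK: "ob H K \<in> Obj C2" using K by simp
  have D2: "suspended_functor (op_cat C2) (op_susp S2) C2 S2 (dual C2 M2 (ob H K)) ?d2"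
    using suspended_functor_op[OF S2.dual_susp_suspended[OF HK]] by simp
  have D1: "suspended_functor (op_cat C1) (op_susp S1) C1 S1 (dual C1 M1 K) ?d1"
    using suspended_functor_op[OF S1.dual_susp_suspended[OF K]] by simp
  have G: "suspended_functor (op_cat C2) (op_susp S2) (op_cat C1) (op_susp S1) G (opposite_susp S2 S1 right_susp)"
    by (rule suspended_functor_op[OF right_susp_suspended])
  show "suspended_morphism (op_cat C2) (op_susp S2) C1 S1
      (G \<circ>\<^sub>F dual C2 M2 (ob H K)) (comp_susp C1 G right_susp (dual C2 M2 (ob H K)) ?d2)
      (dual C1 M1 K \<circ>\<^sub>F G) (comp_susp C1 (dual C1 M1 K) ?d1 G (opposite_susp S2 S1 right_susp))
      (\<lambda>A. zeta (A, K))"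
  proof (rule suspended_morphismI[OF suspended_functor_comp[OF D2 right_susp_suspended]
        suspended_functor_comp[OF G D1] zeta_dual_nat_trans[OF K]])
    fix A assume "A \<in> Obj (op_cat C2)"
    \<comment> \<open>\<open>dual_susp\<close> desuspends \<open>th1\<close> at \<open>T A\<close>;
      taking the opposite structure evaluates it at \<open>T^- A\<close> and suspends again, so
      \<open>?d1\<close> and \<open>?d2\<close> are \<open>th1\<close> itself.\<close>
    then show "ar (Susp S1) (zeta (A, K)) \<cdot>\<^bsub>C1\<^esub> comp_susp C1 G right_susp (dual C2 M2 (ob H K)) ?d2 A =
        comp_susp C1 (dual C1 M1 K) ?d1 G (opposite_susp S2 S1 right_susp) A \<cdot>\<^bsub>C1\<^esub>
        zeta (ob (Susp (op_susp S2)) A, K)"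
      using zeta_susp[of A K] K HK by (simp add: comp_susp_def opposite_susp_def dual_susp_def)
  qed
qed (use K in simp_all)

end

theorem theorem4p2p9:
  fixes C1 :: "('o1, 'a1) cat" and M1 :: "('o1, 'a1) smc"
    and C2 :: "('o2, 'a2) cat" and M2 :: "('o2, 'a2) smc"
    and fstar :: "('o1, 'a1, 'o2, 'a2) func" and \<alpha> :: "'o1 \<times> 'o1 \<Rightarrow> 'a2" and \<upsilon> :: "'a2 option"
    and fpush :: "('o2, 'a2, 'o1, 'a1) func" and \<eta> :: "'o1 \<Rightarrow> 'a1" and \<epsilon> :: "'o2 \<Rightarrow> 'a2"
    and fshriek :: "('o1, 'a1, 'o2, 'a2) func" and \<eta>' :: "'o2 \<Rightarrow> 'a2" and \<epsilon>' :: "'o1 \<Rightarrow> 'a1"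
  assumes "symmetric_monoidal_closed_category C1 M1"
    and "symmetric_monoidal_closed_category C2 M2"
    and "symmetric_monoidal_functor C1 M1 C2 M2 fstar \<alpha> \<upsilon>"
    and "adjunction C1 C2 fstar fpush \<eta> \<epsilon>"
    and "adjunction C2 C1 fpush fshriek \<eta>' \<epsilon>'"
  defines "\<zeta> \<equiv> zeta_map C1 M1 C2 M2 \<alpha> fpush \<eta> \<epsilon> fshriek \<epsilon>'"
  shows "nat_trans (op_cat C2 \<times>\<^sub>C C1) C1
           (fpush \<circ>\<^sub>F ihom M2 \<circ>\<^sub>F (id_func \<times>\<^sub>F fshriek)) (ihom M1 \<circ>\<^sub>F (fpush \<times>\<^sub>F id_func)) \<zeta>
    \<and> (\<forall>K \<in> Obj C1.
        duality_preserving_functor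
          C2 (dual C2 M2 (ob fshriek K)) (bidual_map C2 M2 (ob fshriek K))
          C1 (dual C1 M1 K) (bidual_map C1 M1 K)
          fpush (\<lambda>A. \<zeta> (A, K)))
    \<and> (\<forall>S1 tp1 tp2 S2 tq1 tq2 \<phi>.
        suspended_symmetric_monoidal_closed_category C1 M1 S1 tp1 tp2 \<longrightarrow>
        suspended_symmetric_monoidal_closed_category C2 M2 S2 tq1 tq2 \<longrightarrow>
        suspended_symmetric_monoidal_functor C1 M1 S1 tp1 tp2 C2 M2 S2 tq1 tq2 fstar \<alpha> \<upsilon> \<phi> \<longrightarrow>
        (\<forall>K \<in> Obj C1.
          suspended_duality_preserving_functor
            C2 S2 (dual C2 M2 (ob fshriek K)) (dual_susp C2 M2 S2 tq1 tq2 (ob fshriek K))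
              (bidual_map C2 M2 (ob fshriek K))
            C1 S1 (dual C1 M1 K) (dual_susp C1 M1 S1 tp1 tp2 K) (bidual_map C1 M1 K)
            fpush (right_adjoint_susp C1 S1 C2 S2 fstar \<phi> fpush \<eta> \<epsilon>) (\<lambda>A. \<zeta> (A, K))))
    \<and> (\<forall>S1 tp1 tp2 \<Delta>1 S2 tq1 tq2 \<Delta>2 \<phi>.
        triangulated_symmetric_monoidal_closed_category C1 M1 S1 tp1 tp2 \<Delta>1 \<longrightarrow>
        triangulated_symmetric_monoidal_closed_category C2 M2 S2 tq1 tq2 \<Delta>2 \<longrightarrow>
        triangulated_symmetric_monoidal_functor
          C1 M1 S1 tp1 tp2 \<Delta>1 C2 M2 S2 tq1 tq2 \<Delta>2 fstar \<alpha> \<upsilon> \<phi> \<longrightarrow>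
        (\<forall>K \<in> Obj C1.
          exact_duality_preserving_functor
            C2 S2 \<Delta>2 (dual C2 M2 (ob fshriek K)) (dual_susp C2 M2 S2 tq1 tq2 (ob fshriek K))
              (bidual_map C2 M2 (ob fshriek K))
            C1 S1 \<Delta>1 (dual C1 M1 K) (dual_susp C1 M1 S1 tp1 tp2 K) (bidual_map C1 M1 K)
            fpush (right_adjoint_susp C1 S1 C2 S2 fstar \<phi> fpush \<eta> \<epsilon>) (\<lambda>A. \<zeta> (A, K))))"
proof -
  interpret base: monoidal_adjoint_triple C1 M1 C2 M2 fstar \<alpha> \<upsilon> fpush \<eta> \<epsilon> fshriek \<eta>' \<epsilon>'
    by (intro monoidal_adjoint_triple.intro monoidal_adjunction.intro assms(1-5))
  have suspended: "suspended_duality_preserving_functor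
      C2 S2 (dual C2 M2 (ob fshriek K)) (dual_susp C2 M2 S2 tq1 tq2 (ob fshriek K)) (bidual_map C2 M2 (ob fshriek K))
      C1 S1 (dual C1 M1 K) (dual_susp C1 M1 S1 tp1 tp2 K) (bidual_map C1 M1 K)
      fpush (right_adjoint_susp C1 S1 C2 S2 fstar \<phi> fpush \<eta> \<epsilon>) (\<lambda>A. \<zeta> (A, K))"
    if "suspended_symmetric_monoidal_closed_category C1 M1 S1 tp1 tp2"
      "suspended_symmetric_monoidal_closed_category C2 M2 S2 tq1 tq2"
      "suspended_symmetric_monoidal_functor C1 M1 S1 tp1 tp2 C2 M2 S2 tq1 tq2 fstar \<alpha> \<upsilon> \<phi>"
      "K \<in> Obj C1" for S1 tp1 tp2 S2 tq1 tq2 \<phi> K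
  proof -
    interpret F: suspended_symmetric_monoidal_functor C1 M1 S1 tp1 tp2 C2 M2 S2 tq1 tq2 fstar \<alpha> \<upsilon> \<phi> by fact
    interpret suspended_monoidal_adjoint_triple C1 M1 S1 tp1 tp2 C2 M2 S2 tq1 tq2 fstar \<alpha> \<upsilon> \<phi> fpush \<eta> \<epsilon> fshriek \<eta>' \<epsilon>'
      by (intro suspended_monoidal_adjoint_triple.intro suspended_adjunction.intro that(1-3) assms(4)
          base.monoidal_adjoint_triple_axioms F.suspended_functor_axioms)
    show ?thesis
      using zeta_suspended_duality_preserving[OF that(4)] by (simp add: right_adjoint_susp_eq \<zeta>_def)
  qed
  have exact: "exact_functor C2 S2 \<Delta>2 C1 S1 \<Delta>1 fpush (right_adjoint_susp C1 S1 C2 S2 fstar \<phi> fpush \<eta> \<epsilon>)"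
    if "triangulated_symmetric_monoidal_functor C1 M1 S1 tp1 tp2 \<Delta>1 C2 M2 S2 tq1 tq2 \<Delta>2 fstar \<alpha> \<upsilon> \<phi>"
    for S1 tp1 tp2 \<Delta>1 S2 tq1 tq2 \<Delta>2 \<phi>
  proof -
    interpret F: triangulated_symmetric_monoidal_functor C1 M1 S1 tp1 tp2 \<Delta>1 C2 M2 S2 tq1 tq2 \<Delta>2 fstar \<alpha> \<upsilon> \<phi>
      by fact
    interpret exact_adjunction C1 S1 \<Delta>1 C2 S2 \<Delta>2 fstar \<phi> fpush \<eta> \<epsilon>
      by (intro exact_adjunction.intro suspended_adjunction.intro assms(4) F.suspended_functor_axioms
          F.exact_functor_axioms)
    show ?thesis using right_susp_exact by (simp add: right_adjoint_susp_eq)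
  qed
  show ?thesis
    unfolding exact_duality_preserving_functor_def
      triangulated_symmetric_monoidal_closed_category_def triangulated_symmetric_monoidal_functor_def
    using base.zeta_nat_trans base.zeta_duality_preserving suspended
      exact[unfolded triangulated_symmetric_monoidal_functor_def]
    unfolding \<zeta>_def by blast
qed

end
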